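(* Let $H$ be the generic Hecke algebra over $\mathbf Z[q_*]$ of the Weyl group $W=W_o e^X$ of a reduced based root datum. For $w=w_oe^x\in W$ ($w_o\in W_o$, $x\in X$) put $E_w:=q_w^{1/2}\,\tilde T_{w_o}\,\tilde\theta_x\in H[q_*^{-1/2}]$. Then $(E_w)_{w\in W}$ is a basis of the $\mathbf Z[q_*]$-module $H$, and the transition matrix to the Iwahori–Matsumoto basis $(T_w)_{w\in W}$ is triangular for the Chevalley–Bruhat order, with diagonal coefficients $1$; that is, for every $w\in W$, $E_w=T_w+\sum_{w'<w}a_{w'}T_{w'}$ with $a_{w'}\in\mathbf Z[q_*]$ (depending on $w$).
   Context: Root datum. $(X,X^\vee,R,R^\vee,B)$ is a reduced based root datum: $X,X^\vee$ are free abelian groups of finite rank $\ge 1$ in perfect duality $(\ ,\ ):X\times X^\vee\to\mathbf Z$; $R\subset X$, $R^\vee\subset X^\vee$ are finite nonempty sets of roots and coroots in bijection $\alpha\leftrightarrow\alpha^\vee$ with $(\alpha,\alpha^\vee)=2$; the reflections $s_\alpha(x)=x-(x,\alpha^\vee)\alpha$ preserve $R$ and the dual reflections preserve $R^\vee$; $R$ is reduced; $B$ is a basis of $R$, defining positive roots $R^+$ and negative roots $R^-$. $x\in X$ is dominant if $(x,\beta^\vee)\ge 0$ for all $\beta\in B$. Weyl groups. $W_o\subset GL(X)$ is the finite group generated by the $s_\alpha$, $\alpha\in R$. $W=W_o\ltimes X$; $x\in X$ is written $e^x$ in $W$, so $w_oe^xw_o^{-1}=e^{w_o(x)}$. $W_{aff}=W_o\ltimes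 Q(R)$, with $Q(R)\subset X$ the subgroup generated by $R$. $R_m$ is the set of roots $\alpha$ whose coroot $\alpha^\vee$ is minimal in $R^\vee$ for the order: $\alpha_1^\vee\preceq\alpha_2^\vee$ iff $\alpha_2^\vee-\alpha_1^\vee\in\sum_{\beta\in B}\mathbf N\beta^\vee$. With $S=\{s_\beta:\beta\in B\}\cup\{s_\alpha e^{\alpha}:\alpha\in R_m\}$, $(W_{aff},S)$ is a Coxeter system. The length on $W$, extending that of $(W_{aff},S)$, is $\ell(w_oe^x)=\sum_{\alpha\in R^+,w_o(\alpha)\in R^+}|(x,\alpha^\vee)|+\sum_{\alpha\in R^+,w_o(\alpha)\in R^-}|1+(x,\alpha^\vee)|$. $\Omega$ is the subgroup of elements of length $0$; it normalizes $S$ and $W=\Omega W_{aff}$ (semi-direct product). Chevalley–Bruhat order on $W$: $uw_{aff}\le u'w'_{aff}$ ($u,u'\in\Omega$, $w_{aff},w'_{aff}\in W_{aff}$) iff $u=u'$ and $w_{aff}\le w'_{aff}$ in the usual Bruhat order of $(W_{aff},S)$. Generic weights. $(q_s)_{s\in S}$ are indeterminates with $q_s=q_{s'}$ iff $s,s'$ are conjugate in $W$ (independent otherwise); $\mathbf Z[q_*]$ is the polynomial ring they generate. For $w=us_1\cdots s_n$ with $u\in\Omega$ and $s_1\cdots s_n$ a reduced expression in $W_{aff}$, $q_w=q_{s_1}\cdots q_{s_n}$; $q_x:=q_{e^x}$. One also adjoins indeterminates $q_s^{1/2}$ with squares $q_s$ (equal for conjugate $s$), and $q_w^{1/2}$ is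 the corresponding monomial. Hecke algebra. $H$ is the $\mathbf Z[q_*]$-algebra, free as a module with basis $(T_w)_{w\in W}$ (the Iwahori–Matsumoto basis), with $(T_s+1)(T_s-q_s)=0$ for $s\in S$ and $T_{ww'}=T_wT_{w'}$ if $\ell(ww')=\ell(w)+\ell(w')$. $H[q_*^{-1/2}]=H\otimes_{\mathbf Z[q_*]}\mathbf Z[q_*^{\pm1/2}]$; in it the $T_w$ are invertible, and $\tilde T_w:=q_w^{-1/2}T_w$. For $x\in X$, $\tilde\theta_x:=\tilde T_{e^y}\tilde T_{e^z}^{-1}$, where $x=y-z$ with $y,z$ dominant (independent of the choice). *)

theory Defs
  imports Complex_Main "HOL-Library.Poly_Mapping" "HOL-Algebra.Generated_Groups"
begin

section \<open>Abelian groups as \<open>\<int>\<close>-modules\<close>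

definition int_scale :: "int \<Rightarrow> 'a::ab_group_add \<Rightarrow> 'a"
  where "int_scale n x =
    (if 0 \<le> n then (((+) x) ^^ nat n) 0 else - ((((+) x) ^^ nat (- n)) 0))"

lemma funpow_plus_add:
  "(((+) (x::'a::ab_group_add)) ^^ (m + n)) 0 = (((+) x) ^^ m) 0 + (((+) x) ^^ n) 0"
  by (induction m) (simp_all add: algebra_simps)

lemma int_scale_of_nat: "int_scale (int n) x = (((+) x) ^^ n) 0"
  by (simp add: int_scale_def)

lemma int_scale_of_nat_diff:
  "int_scale (int m - int n) x = (((+) x) ^^ m) 0 - (((+) x) ^^ n) 0"
proof (cases "n \<le> m")
  case True
  then have "(((+) x) ^^ m) 0 = (((+) x) ^^ (m - n)) 0 + (((+) x) ^^ n) 0"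
    by (simp flip: funpow_plus_add)
  with True show ?thesis by (simp add: int_scale_def nat_diff_distrib)
next
  case False
  then have "(((+) x) ^^ n) 0 = (((+) x) ^^ (n - m)) 0 + (((+) x) ^^ m) 0"
    by (simp flip: funpow_plus_add)
  with False show ?thesis by (simp add: int_scale_def nat_diff_distrib)
qed

lemma int_scale_add_left: "int_scale (a + b) x = int_scale a x + int_scale b x"
proof -
  obtain k l m n where "a = int k - int l" "b = int m - int n"
    by (metis int_diff_cases)
  moreover have "(int k - int l) + (int m - int n) = int (k + m) - int (l + n)"
    by simp
  ultimately show ?thesis
    by (simp only: int_scale_of_nat_diff funpow_plus_add) (simp add: algebra_simps)
qed

lemma int_scale_add_right: "int_scale a (x + y) = int_scale a x + int_scale a y"
proof -
  have "(((+) (x + y)) ^^ n) 0 = (((+) x) ^^ n) 0 + (((+) y) ^^ n) 0" for n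
    by (induction n) (simp_all add: algebra_simps)
  then show ?thesis by (simp add: int_scale_def)
qed

lemma int_scale_one: "int_scale 1 x = x"
  by (simp add: int_scale_def)

lemma int_scale_minus_left: "int_scale (- a) x = - int_scale a x"
  using int_scale_add_left[of "- a" a x]
  by (simp add: eq_neg_iff_add_eq_0) (simp add: int_scale_def)

lemma int_scale_scale: "int_scale a (int_scale b x) = int_scale (a * b) x"
proof -
  have *: "int_scale (int n) (int_scale b x) = int_scale (int n * b) x" for n
  proof (induction n)
    case 0
    then show ?case by (simp add: int_scale_def)
  next
    case (Suc n)
    then show ?case
      by (simp add: int_scale_add_left int_scale_one algebra_simps)
  qed
  show ?thesis
  proof (cases "0 \<le> a")
    case True
    then show ?thesis using *[of "nat a"] by simp
  next
    case False
    then show ?thesis using *[of "nat (- a)"] by (simp add: int_scale_minus_left)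
  qed
qed

global_interpretation int_module: module int_scale
  by unfold_locales
    (simp_all add: int_scale_add_left int_scale_add_right int_scale_scale int_scale_one)

definition free_finite_rank_pos :: "'a::ab_group_add itself \<Rightarrow> bool"
  where "free_finite_rank_pos _ \<longleftrightarrow>
    (\<exists>A :: 'a set. finite A \<and> A \<noteq> {} \<and> \<not> int_module.dependent A \<and> int_module.span A = UNIV)"

definition nat_span :: "'a::ab_group_add set \<Rightarrow> 'a set"
  where "nat_span A = {x. \<exists>c :: 'a \<Rightarrow> nat. x = (\<Sum>a\<in>A. int_scale (int (c a)) a)}"


section \<open>Reduced based root data\<close>

text \<open>The lattices \<open>X\<close> and \<open>X\<^sup>\<or>\<close> are the types \<open>'x\<close> and \<open>'y\<close>.\<close>

record ('x, 'y) root_datum =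
  pairing :: "'x \<Rightarrow> 'y \<Rightarrow> int"
  roots :: "'x set"
  coroots :: "'y set"
  coroot :: "'x \<Rightarrow> 'y"
  base :: "'x set"

definition reflection :: "('x::ab_group_add, 'y::ab_group_add) root_datum \<Rightarrow> 'x \<Rightarrow> 'x \<Rightarrow> 'x"
  where "reflection D \<alpha> x = x - int_scale (pairing D x (coroot D \<alpha>)) \<alpha>"

definition coreflection :: "('x::ab_group_add, 'y::ab_group_add) root_datum \<Rightarrow> 'x \<Rightarrow> 'y \<Rightarrow> 'y"
  where "coreflection D \<alpha> y = y - int_scale (pairing D \<alpha> y) (coroot D \<alpha>)"

definition based_root_datum :: "('x::ab_group_add, 'y::ab_group_add) root_datum \<Rightarrow> bool"
  where "based_root_datum D \<longleftrightarrow>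
    free_finite_rank_pos TYPE('x) \<and> free_finite_rank_pos TYPE('y) \<and>
    (\<forall>x. additive (pairing D x)) \<and> (\<forall>y. additive (\<lambda>x. pairing D x y)) \<and>
    bij_betw (pairing D) UNIV {f. additive f} \<and>
    bij_betw (\<lambda>y x. pairing D x y) UNIV {f. additive f} \<and>
    finite (roots D) \<and> roots D \<noteq> {} \<and>
    bij_betw (coroot D) (roots D) (coroots D) \<and>
    (\<forall>\<alpha>\<in>roots D. pairing D \<alpha> (coroot D \<alpha>) = 2) \<and>
    (\<forall>\<alpha>\<in>roots D. reflection D \<alpha> ` roots D = roots D) \<and>
    (\<forall>\<alpha>\<in>roots D. coreflection D \<alpha> ` coroots D = coroots D) \<and>
    (\<forall>\<alpha>\<in>roots D. \<forall>\<beta>\<in>roots D. \<forall>m n.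
       m \<noteq> 0 \<and> int_scale m \<alpha> = int_scale n \<beta> \<longrightarrow> \<beta> = \<alpha> \<or> \<beta> = - \<alpha>) \<and>
    base D \<subseteq> roots D \<and> \<not> int_module.dependent (base D) \<and>
    (\<forall>\<alpha>\<in>roots D. \<alpha> \<in> nat_span (base D) \<or> - \<alpha> \<in> nat_span (base D))"

definition pos_roots :: "('x::ab_group_add, 'y) root_datum \<Rightarrow> 'x set"
  where "pos_roots D = roots D \<inter> nat_span (base D)"

definition neg_roots :: "('x::ab_group_add, 'y) root_datum \<Rightarrow> 'x set"
  where "neg_roots D = {\<alpha> \<in> roots D. - \<alpha> \<in> nat_span (base D)}"

definition dominant :: "('x, 'y) root_datum \<Rightarrow> 'x \<Rightarrow> bool"
  where "dominant D x \<longleftrightarrow> (\<forall>\<beta>\<in>base D. 0 \<le> pairing D x (coroot D \<beta>))"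


section \<open>Weyl groups\<close>

definition GL :: "('x::ab_group_add \<Rightarrow> 'x) monoid"
  where "GL = \<lparr>carrier = {f. bij f \<and> additive f}, mult = (\<circ>), one = id\<rparr>"

definition fin_weyl :: "('x::ab_group_add, 'y::ab_group_add) root_datum \<Rightarrow> ('x \<Rightarrow> 'x) set"
  where "fin_weyl D = generate GL (reflection D ` roots D)"

text \<open>The pair \<open>(w, x)\<close> stands for \<open>w e\<^sup>x\<close>; the product is
  \<open>v e\<^sup>x w e\<^sup>y = v w e\<^bsup>w\<^sup>-\<^sup>1(x) + y\<^esup>\<close>.\<close>

type_synonym 'x weyl_elt = "('x \<Rightarrow> 'x) \<times> 'x"

definition weyl :: "('x::ab_group_add, 'y::ab_group_add) root_datum \<Rightarrow> 'x weyl_elt monoid"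
  where "weyl D = \<lparr>carrier = fin_weyl D \<times> UNIV,
    mult = (\<lambda>(v, x) (w, y). (v \<circ> w, inv_into UNIV w x + y)),
    one = (id, 0)\<rparr>"

definition aff_weyl :: "('x::ab_group_add, 'y::ab_group_add) root_datum \<Rightarrow> 'x weyl_elt set"
  where "aff_weyl D = fin_weyl D \<times> int_module.span (roots D)"

definition coroot_le :: "('x, 'y::ab_group_add) root_datum \<Rightarrow> 'y \<Rightarrow> 'y \<Rightarrow> bool"
  where "coroot_le D y z \<longleftrightarrow> z - y \<in> nat_span (coroot D ` base D)"

definition min_roots :: "('x, 'y::ab_group_add) root_datum \<Rightarrow> 'x set"
  where "min_roots D =
    {\<alpha> \<in> roots D. \<forall>y\<in>coroots D. coroot_le D y (coroot D \<alpha>) \<longrightarrow> y = coroot D \<alpha>}"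

definition aff_gens :: "('x::ab_group_add, 'y::ab_group_add) root_datum \<Rightarrow> 'x weyl_elt set"
  where "aff_gens D =
    (\<lambda>\<beta>. (reflection D \<beta>, 0)) ` base D \<union> (\<lambda>\<alpha>. (reflection D \<alpha>, \<alpha>)) ` min_roots D"

fun weyl_length :: "('x::ab_group_add, 'y::ab_group_add) root_datum \<Rightarrow> 'x weyl_elt \<Rightarrow> nat"
  where "weyl_length D (w, x) = nat
    ((\<Sum>\<alpha> \<in> {\<alpha> \<in> pos_roots D. w \<alpha> \<in> pos_roots D}. \<bar>pairing D x (coroot D \<alpha>)\<bar>) +
     (\<Sum>\<alpha> \<in> {\<alpha> \<in> pos_roots D. w \<alpha> \<in> neg_roots D}. \<bar>1 + pairing D x (coroot D \<alpha>)\<bar>))"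

definition Omega :: "('x::ab_group_add, 'y::ab_group_add) root_datum \<Rightarrow> 'x weyl_elt set"
  where "Omega D = {w \<in> carrier (weyl D). weyl_length D w = 0}"

definition word_prod :: "('x::ab_group_add, 'y::ab_group_add) root_datum \<Rightarrow>
    'x weyl_elt list \<Rightarrow> 'x weyl_elt"
  where "word_prod D ss = foldr (\<otimes>\<^bsub>weyl D\<^esub>) ss \<one>\<^bsub>weyl D\<^esub>"

definition reduced_word :: "('x::ab_group_add, 'y::ab_group_add) root_datum \<Rightarrow>
    'x weyl_elt list \<Rightarrow> bool"
  where "reduced_word D ss \<longleftrightarrow> set ss \<subseteq> aff_gens D \<and>
    (\<forall>ts. set ts \<subseteq> aff_gens D \<and> word_prod D ts = word_prod D ss \<longrightarrow> length ss \<le> length ts)"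

text \<open>The Bruhat order of the Coxeter system is defined by subexpressions of reduced
  expressions; \<open>subseqs\<close> lists all, not necessarily contiguous, subsequences.\<close>

definition aff_bruhat_le :: "('x::ab_group_add, 'y::ab_group_add) root_datum \<Rightarrow>
    'x weyl_elt \<Rightarrow> 'x weyl_elt \<Rightarrow> bool"
  where "aff_bruhat_le D v w \<longleftrightarrow>
    (\<exists>ss. reduced_word D ss \<and> word_prod D ss = w \<and>
       (\<exists>ts \<in> set (subseqs ss). word_prod D ts = v))"

definition bruhat_le :: "('x::ab_group_add, 'y::ab_group_add) root_datum \<Rightarrow>
    'x weyl_elt \<Rightarrow> 'x weyl_elt \<Rightarrow> bool"
  where "bruhat_le D v w \<longleftrightarrow>
    (\<exists>u \<in> Omega D. \<exists>v' \<in> aff_weyl D. \<exists>w' \<in> aff_weyl D.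
       v = u \<otimes>\<^bsub>weyl D\<^esub> v' \<and> w = u \<otimes>\<^bsub>weyl D\<^esub> w' \<and> aff_bruhat_le D v' w')"

definition bruhat_less :: "('x::ab_group_add, 'y::ab_group_add) root_datum \<Rightarrow>
    'x weyl_elt \<Rightarrow> 'x weyl_elt \<Rightarrow> bool"
  where "bruhat_less D v w \<longleftrightarrow> bruhat_le D v w \<and> v \<noteq> w"


section \<open>Generic weights\<close>

text \<open>The indeterminates are indexed by the type \<open>'c\<close>: \<open>q\<^sub>s\<close> is the variable
  number \<open>cl s\<close>. As \<open>cl\<close> maps the generators onto \<open>'c\<close>, the types below are
  exactly \<open>\<int>[q\<^sub>*]\<close> and \<open>\<int>[q\<^sub>*\<^sup>\<plusminus>\<^sup>1\<^sup>/\<^sup>2]\<close>; the exponents in the latter are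
  those of the \<open>q\<^sub>s\<^sup>1\<^sup>/\<^sup>2\<close>.\<close>

type_synonym 'c qpoly = "('c \<Rightarrow>\<^sub>0 nat) \<Rightarrow>\<^sub>0 int"
type_synonym 'c qlaurent = "('c \<Rightarrow>\<^sub>0 int) \<Rightarrow>\<^sub>0 int"

definition weight_index :: "('x::ab_group_add, 'y::ab_group_add) root_datum \<Rightarrow>
    ('x weyl_elt \<Rightarrow> 'c) \<Rightarrow> bool"
  where "weight_index D cl \<longleftrightarrow> cl ` aff_gens D = UNIV \<and>
    (\<forall>s \<in> aff_gens D. \<forall>t \<in> aff_gens D. cl s = cl t \<longleftrightarrow>
       (\<exists>g \<in> carrier (weyl D). t = g \<otimes>\<^bsub>weyl D\<^esub> s \<otimes>\<^bsub>weyl D\<^esub> inv\<^bsub>weyl D\<^esub> g))"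

definition qvar :: "'c \<Rightarrow> 'c qpoly"
  where "qvar i = Poly_Mapping.single (Poly_Mapping.single i 1) 1"

definition sqrt_qvar :: "'c \<Rightarrow> 'c qlaurent"
  where "sqrt_qvar i = Poly_Mapping.single (Poly_Mapping.single i 1) 1"

definition qpoly_incl :: "'c qpoly \<Rightarrow> 'c qlaurent"
  where "qpoly_incl p = (\<Sum>m\<in>Poly_Mapping.keys p.
    Poly_Mapping.single (Poly_Mapping.map (\<lambda>n. 2 * int n) m) (Poly_Mapping.lookup p m))"

lemma qpoly_incl_qvar: "qpoly_incl (qvar i) = (sqrt_qvar i)\<^sup>2"
proof -
  have "Poly_Mapping.map (\<lambda>n. 2 * int n) (Poly_Mapping.single i 1) = Poly_Mapping.single i 2"
    by (rule poly_mapping_eqI) (simp add: Poly_Mapping.map.rep_eq lookup_single when_def)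
  then show ?thesis
    by (simp add: qpoly_incl_def qvar_def sqrt_qvar_def power2_eq_square mult_single
        flip: single_add)
qed

text \<open>The choices made in the next definition do not affect the monomials \<open>sqrt_q\<close>.\<close>

definition chosen_word :: "('x::ab_group_add, 'y::ab_group_add) root_datum \<Rightarrow>
    'x weyl_elt \<Rightarrow> 'x weyl_elt list"
  where "chosen_word D w =
    (SOME ss. reduced_word D ss \<and> (\<exists>u \<in> Omega D. w = u \<otimes>\<^bsub>weyl D\<^esub> word_prod D ss))"

definition sqrt_q_exponent :: "('x::ab_group_add, 'y::ab_group_add) root_datum \<Rightarrow>
    ('x weyl_elt \<Rightarrow> 'c) \<Rightarrow> 'x weyl_elt \<Rightarrow> 'c \<Rightarrow>\<^sub>0 int"
  where "sqrt_q_exponent D cl w =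
    (\<Sum>s\<leftarrow>chosen_word D w. Poly_Mapping.single (cl s) 1)"

definition sqrt_q :: "('x::ab_group_add, 'y::ab_group_add) root_datum \<Rightarrow>
    ('x weyl_elt \<Rightarrow> 'c) \<Rightarrow> 'x weyl_elt \<Rightarrow> 'c qlaurent"
  where "sqrt_q D cl w = Poly_Mapping.single (sqrt_q_exponent D cl w) 1"

definition inv_sqrt_q :: "('x::ab_group_add, 'y::ab_group_add) root_datum \<Rightarrow>
    ('x weyl_elt \<Rightarrow> 'c) \<Rightarrow> 'x weyl_elt \<Rightarrow> 'c qlaurent"
  where "inv_sqrt_q D cl w = Poly_Mapping.single (- sqrt_q_exponent D cl w) 1"

lemma sqrt_q_eq_prod: "sqrt_q D cl w = (\<Prod>s\<leftarrow>chosen_word D w. sqrt_qvar (cl s))"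
proof -
  have add: "Poly_Mapping.single (k + l) (1::int) =
      Poly_Mapping.single k 1 * Poly_Mapping.single l 1" for k l :: "_ \<Rightarrow>\<^sub>0 int"
    by (simp add: mult_single)
  have "Poly_Mapping.single (\<Sum>s\<leftarrow>ss. Poly_Mapping.single (cl s) (1::int)) (1::int) =
      (\<Prod>s\<leftarrow>ss. sqrt_qvar (cl s))" for ss
    by (induction ss) (simp_all add: sqrt_qvar_def add)
  then show ?thesis by (simp add: sqrt_q_def sqrt_q_exponent_def)
qed

lemma inv_sqrt_q_mult_sqrt_q: "inv_sqrt_q D cl w * sqrt_q D cl w = 1"
  by (simp add: inv_sqrt_q_def sqrt_q_def mult_single)


section \<open>The generic Hecke algebra\<close>

definition assoc_algebra :: "('r::comm_ring_1 \<Rightarrow> 'a::ring_1 \<Rightarrow> 'a) \<Rightarrow> bool"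
  where "assoc_algebra scale \<longleftrightarrow> module scale \<and>
    (\<forall>c a b. scale c a * b = scale c (a * b) \<and> a * scale c b = scale c (a * b))"

definition indexed_basis :: "('r::comm_ring_1 \<Rightarrow> 'a::ab_group_add \<Rightarrow> 'a) \<Rightarrow>
    'i set \<Rightarrow> ('i \<Rightarrow> 'a) \<Rightarrow> bool"
  where "indexed_basis scale I b \<longleftrightarrow> inj_on b I \<and>
    \<not> module.dependent scale (b ` I) \<and> module.span scale (b ` I) = UNIV"

text \<open>The algebra \<open>H\<close> is the ring \<open>'h\<close>, and the presentation below determines it up to
  a unique isomorphism respecting the \<open>T\<^sub>w\<close>.\<close>

record ('w, 'c, 'h) hecke =
  hscale :: "'c qpoly \<Rightarrow> 'h \<Rightarrow> 'h"
  Tbasis :: "'w \<Rightarrow> 'h"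

definition generic_hecke :: "('x::ab_group_add, 'y::ab_group_add) root_datum \<Rightarrow>
    ('x weyl_elt \<Rightarrow> 'c) \<Rightarrow> ('x weyl_elt, 'c, 'h::ring_1) hecke \<Rightarrow> bool"
  where "generic_hecke D cl H \<longleftrightarrow> assoc_algebra (hscale H) \<and>
    indexed_basis (hscale H) (carrier (weyl D)) (Tbasis H) \<and>
    (\<forall>s \<in> aff_gens D. (Tbasis H s + 1) * (Tbasis H s - hscale H (qvar (cl s)) 1) = 0) \<and>
    (\<forall>v \<in> carrier (weyl D). \<forall>w \<in> carrier (weyl D).
       weyl_length D (v \<otimes>\<^bsub>weyl D\<^esub> w) = weyl_length D v + weyl_length D w \<longrightarrow>
       Tbasis H (v \<otimes>\<^bsub>weyl D\<^esub> w) = Tbasis H v * Tbasis H w)"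

text \<open>The algebra \<open>H[q\<^sub>*\<^sup>-\<^sup>1\<^sup>/\<^sup>2]\<close> is the ring \<open>'k\<close> with structure map \<open>incl\<close> from \<open>'h\<close>.
  Since \<open>H\<close> is free on the \<open>T\<^sub>w\<close>, a homomorphism to an algebra over
  \<open>\<int>[q\<^sub>*\<^sup>\<plusminus>\<^sup>1\<^sup>/\<^sup>2]\<close> exhibits the latter as the extension of scalars \<open>H \<otimes> \<int>[q\<^sub>*\<^sup>\<plusminus>\<^sup>1\<^sup>/\<^sup>2]\<close> iff it
  takes the \<open>T\<^sub>w\<close> to a basis.\<close>

record ('c, 'h, 'k) scalar_ext =
  kscale :: "'c qlaurent \<Rightarrow> 'k \<Rightarrow> 'k"
  incl :: "'h \<Rightarrow> 'k"

definition hecke_sqrt_ext :: "('x::ab_group_add, 'y::ab_group_add) root_datum \<Rightarrow>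
    ('x weyl_elt, 'c, 'h::ring_1) hecke \<Rightarrow> ('c, 'h, 'k::ring_1) scalar_ext \<Rightarrow> bool"
  where "hecke_sqrt_ext D H K \<longleftrightarrow> assoc_algebra (kscale K) \<and>
    incl K 1 = 1 \<and>
    (\<forall>a b. incl K (a + b) = incl K a + incl K b) \<and>
    (\<forall>a b. incl K (a * b) = incl K a * incl K b) \<and>
    (\<forall>p a. incl K (hscale H p a) = kscale K (qpoly_incl p) (incl K a)) \<and>
    indexed_basis (kscale K) (carrier (weyl D)) (\<lambda>w. incl K (Tbasis H w))"

definition ring_inverse :: "'k::ring_1 \<Rightarrow> 'k"
  where "ring_inverse a = (THE b. a * b = 1 \<and> b * a = 1)"

definition Ttilde :: "('x::ab_group_add, 'y::ab_group_add) root_datum \<Rightarrow>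
    ('x weyl_elt \<Rightarrow> 'c) \<Rightarrow> ('x weyl_elt, 'c, 'h::ring_1) hecke \<Rightarrow>
    ('c, 'h, 'k::ring_1) scalar_ext \<Rightarrow> 'x weyl_elt \<Rightarrow> 'k"
  where "Ttilde D cl H K w = kscale K (inv_sqrt_q D cl w) (incl K (Tbasis H w))"

text \<open>The result does not depend on the chosen dominant \<open>y\<close> and \<open>z\<close>.\<close>

definition thetatilde :: "('x::ab_group_add, 'y::ab_group_add) root_datum \<Rightarrow>
    ('x weyl_elt \<Rightarrow> 'c) \<Rightarrow> ('x weyl_elt, 'c, 'h::ring_1) hecke \<Rightarrow>
    ('c, 'h, 'k::ring_1) scalar_ext \<Rightarrow> 'x \<Rightarrow> 'k"
  where "thetatilde D cl H K x =
    (case (SOME (y, z). dominant D y \<and> dominant D z \<and> x = y - z) of (y, z) \<Rightarrow>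
       Ttilde D cl H K (id, y) * ring_inverse (Ttilde D cl H K (id, z)))"

fun Eelt :: "('x::ab_group_add, 'y::ab_group_add) root_datum \<Rightarrow>
    ('x weyl_elt \<Rightarrow> 'c) \<Rightarrow> ('x weyl_elt, 'c, 'h::ring_1) hecke \<Rightarrow>
    ('c, 'h, 'k::ring_1) scalar_ext \<Rightarrow> 'x weyl_elt \<Rightarrow> 'k"
  where "Eelt D cl H K (w, x) =
    kscale K (sqrt_q D cl (w, x)) (Ttilde D cl H K (w, 0) * thetatilde D cl H K x)"

end

theory Submission
  imports Defs "HOL-Library.Sublist"
begin

text \<open>
  Write \<open>q\<close> for the weights and \<open>\<T>\<^sub>w = q\<^sub>w\<^sup>-\<^sup>1\<^sup>/\<^sup>2 T\<^sub>w\<close> for the normalized elements.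
  If \<open>x = y - z\<close> with \<open>y, z\<close> dominant, then \<open>\<ell>(w e\<^sup>y) = \<ell>(w) + \<ell>(e\<^sup>y)\<close> for \<open>w\<close> in the finite Weyl
  group, so \<open>E\<close> at \<open>w e\<^sup>x\<close> is \<open>q\<^sup>1\<^sup>/\<^sup>2 \<T>\<^sub>v \<T>\<^sub>u\<^sup>-\<^sup>1\<close> with \<open>v = w e\<^sup>y\<close>, \<open>u = e\<^sup>z\<close> and \<open>q\<close> taken at \<open>v u\<^sup>-\<^sup>1 = w e\<^sup>x\<close>.
  The theorem is therefore a special case of a statement about arbitrary \<open>v\<close> and \<open>u\<close>
  (\<open>normalized_quotient\<close>): \<open>q\<^sup>1\<^sup>/\<^sup>2 \<T>\<^sub>v \<T>\<^sub>u\<^sup>-\<^sup>1\<close>, with \<open>q\<close> taken at \<open>v u\<^sup>-\<^sup>1\<close>, is \<open>T\<close> at \<open>v u\<^sup>-\<^sup>1\<close> plus a combination,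
  with coefficients polynomial in the weights, of \<open>T\<close> at smaller elements.

  This is proved by induction on the length of \<open>u\<close>. Let \<open>u = u's\<close> with \<open>s\<close> simple and \<open>u' < u\<close>. If \<open>vs < v\<close>,
  the factors \<open>\<T>\<^sub>s\<close> cancel. Otherwise
  \<open>\<T>\<^sub>v \<T>\<^sub>s\<^sup>-\<^sup>1 = \<T>\<^sub>v\<^sub>s - (q\<^sub>s\<^sup>1\<^sup>/\<^sup>2 - q\<^sub>s\<^sup>-\<^sup>1\<^sup>/\<^sup>2) \<T>\<^sub>v\<close>. The first term leads to the pair \<open>(vs, u')\<close> with the same
  quotient \<open>w = v u\<^sup>-\<^sup>1\<close>, the second to \<open>(v, u')\<close> with quotient \<open>w' = v u'\<^sup>-\<^sup>1\<close>. Here \<open>w'\<close> is \<open>w\<close> times the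
  reflection \<open>u' s u'\<^sup>-\<^sup>1\<close>, and a look at the signs of roots gives \<open>w' < w\<close>. The coefficient of the
  second term is integral because the weights \<open>q\<close> of \<open>w\<close> and of \<open>w'\<close> differ by the factor \<open>q\<^sub>s\<close> times
  the square of a monomial (\<open>wt_step\<close>): by the strong exchange condition \<open>w'\<close> arises from a reduced word of \<open>w\<close> by deleting one letter
  conjugate to \<open>s\<close>, and reducing the remaining word removes letters in conjugate pairs.

  The combinatorics of length, exchange and weights only needs a group acting on a set of
  signed roots such that each simple reflection makes exactly one positive root negative, and it is
  developed for the locale \<open>root_action\<close>. The extended affine Weyl group is an instance with its
  action on affine roots: the length formula counts inversions (\<open>card_affine_inversions\<close>), and the
  reflections in the affine simple roots are controlled by the geometry of minimal coroots
  (\<open>min_root_pr_le_one\<close>). The order used internally is the transitive closure of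
  length-decreasing multiplication by reflections; strong exchange turns it into the subword
  description of the Chevalley-Bruhat order (\<open>below_subword\<close>). Finally, a family that is unitriangular
  with respect to a basis graded by length is a basis (\<open>triangular_indexed_basis\<close>).
\<close>

section \<open>Groups acting on signed roots\<close>

lemma set_subseq: "subseq xs ys \<Longrightarrow> set xs \<subseteq> set ys"
  using subseqs_powset[of ys] by auto

text \<open>The axioms are those properties of a Coxeter group acting on its root system that the
  exchange condition rests on. The group may be larger than the one generated by the simple
  reflections: elements without inversions play the role of \<open>\<Omega>\<close>. The last axiom replaces the
  statement that positive roots are nonnegative combinations of simple ones, so that no linear
  structure on roots is required.\<close>
locale root_action = group W for W (structure) +
  fixes act :: "'g \<Rightarrow> 'r \<Rightarrow> 'r"
    and Rts pos :: "'r set"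
    and neg :: "'r \<Rightarrow> 'r"
    and refl :: "'r \<Rightarrow> 'g"
    and simples :: "'r set"
  assumes act_closed: "g \<in> carrier W \<Longrightarrow> a \<in> Rts \<Longrightarrow> act g a \<in> Rts"
    and act_mult: "g \<in> carrier W \<Longrightarrow> h \<in> carrier W \<Longrightarrow> a \<in> Rts \<Longrightarrow>
      act (g \<otimes> h) a = act g (act h a)"
    and act_one: "a \<in> Rts \<Longrightarrow> act \<one> a = a"
    and act_neg: "g \<in> carrier W \<Longrightarrow> a \<in> Rts \<Longrightarrow> act g (neg a) = neg (act g a)"
    and pos_subset: "pos \<subseteq> Rts"
    and neg_pos_iff: "a \<in> Rts \<Longrightarrow> neg a \<in> pos \<longleftrightarrow> a \<notin> pos"
    and refl_closed: "a \<in> Rts \<Longrightarrow> refl a \<in> carrier W"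
    and refl_refl: "a \<in> Rts \<Longrightarrow> refl a \<otimes> refl a = \<one>"
    and act_refl_self: "a \<in> Rts \<Longrightarrow> act (refl a) a = neg a"
    and refl_act: "g \<in> carrier W \<Longrightarrow> a \<in> Rts \<Longrightarrow> refl (act g a) = g \<otimes> refl a \<otimes> inv g"
    and simples_subset: "simples \<subseteq> pos"
    and act_simple: "a \<in> simples \<Longrightarrow> b \<in> pos \<Longrightarrow> b \<noteq> a \<Longrightarrow> act (refl a) b \<in> pos"
    and finite_inversions: "g \<in> carrier W \<Longrightarrow> finite {b \<in> pos. act g b \<notin> pos}"
    and pos_if_simples_pos: "g \<in> carrier W \<Longrightarrow> (\<And>a. a \<in> simples \<Longrightarrow> act g a \<in> pos) \<Longrightarrow>
      b \<in> pos \<Longrightarrow> act g b \<in> pos"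
begin

definition inversions :: "'g \<Rightarrow> 'r set"
  where "inversions g = {b \<in> pos. act g b \<notin> pos}"

definition len :: "'g \<Rightarrow> nat"
  where "len g = card (inversions g)"

definition wprod :: "'r list \<Rightarrow> 'g"
  where "wprod as = foldr (\<lambda>a g. refl a \<otimes> g) as \<one>"

lemma finite_invs: "g \<in> carrier W \<Longrightarrow> finite (inversions g)"
  using finite_inversions by (simp add: inversions_def)

lemma posD: "b \<in> pos \<Longrightarrow> b \<in> Rts"
  using pos_subset by blast

lemma simplesD: "a \<in> simples \<Longrightarrow> a \<in> pos" "a \<in> simples \<Longrightarrow> a \<in> Rts"
  using simples_subset pos_subset by blast+

lemma act_refl_refl: "a \<in> Rts \<Longrightarrow> b \<in> Rts \<Longrightarrow> act (refl a) (act (refl a) b) = b"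
  by (metis act_mult act_one refl_closed refl_refl)

lemma mult_refl_refl: "g \<in> carrier W \<Longrightarrow> a \<in> Rts \<Longrightarrow> g \<otimes> refl a \<otimes> refl a = g"
  by (simp add: m_assoc refl_closed refl_refl)

lemma act_inv: "g \<in> carrier W \<Longrightarrow> a \<in> Rts \<Longrightarrow> act (inv g) (act g a) = a"
  by (metis act_mult act_one inv_closed l_inv)

lemma act_inv': "g \<in> carrier W \<Longrightarrow> a \<in> Rts \<Longrightarrow> act g (act (inv g) a) = a"
  by (metis act_mult act_one inv_closed r_inv)

lemma act_mult_refl_self:
  "g \<in> carrier W \<Longrightarrow> a \<in> Rts \<Longrightarrow> act (g \<otimes> refl a) a = neg (act g a)"
  by (simp add: act_mult refl_closed act_refl_self act_neg)

lemma act_mult_refl_self_pos: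
  "g \<in> carrier W \<Longrightarrow> a \<in> Rts \<Longrightarrow> act (g \<otimes> refl a) a \<in> pos \<longleftrightarrow> act g a \<notin> pos"
  by (simp add: act_mult_refl_self neg_pos_iff act_closed)

text \<open>Length changes by one under a simple reflection because the reflection permutes the positive
  roots other than its own; the description as sets, rather than cardinalities, is what also
  governs the weights.\<close>
lemma inversions_mult_simple:
  assumes g: "g \<in> carrier W" and a: "a \<in> simples" and up: "act g a \<in> pos"
  shows "inversions (g \<otimes> refl a) = insert a (act (refl a) ` inversions g)"
    and "a \<notin> act (refl a) ` inversions g"
    and "inj_on (act (refl a)) (inversions g)"
proof -
  note [simp] = simplesD[OF a] refl_closed[OF simplesD(2)[OF a]] g
  show "inj_on (act (refl a)) (inversions g)"
    by (rule inj_on_inverseI[where g="act (refl a)"])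
      (simp add: act_refl_refl inversions_def posD)
  show "a \<notin> act (refl a) ` inversions g"
  proof
    assume "a \<in> act (refl a) ` inversions g"
    then obtain b where b: "b \<in> pos" "a = act (refl a) b" by (auto simp: inversions_def)
    then have "b = neg a" by (metis act_refl_refl act_refl_self posD simplesD(2)[OF a])
    with b show False by (simp add: neg_pos_iff)
  qed
  show "inversions (g \<otimes> refl a) = insert a (act (refl a) ` inversions g)"
  proof (intro equalityI subsetI)
    fix x assume x: "x \<in> inversions (g \<otimes> refl a)"
    then have xp: "x \<in> pos" and xn: "act (g \<otimes> refl a) x \<notin> pos" by (auto simp: inversions_def)
    show "x \<in> insert a (act (refl a) ` inversions g)"
    proof (cases "x = a")
      case False
      have "act (refl a) x \<in> inversions g"
        using act_simple[OF a xp False] xn xp by (simp add: inversions_def act_mult posD)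
      moreover have "x = act (refl a) (act (refl a) x)"
        using xp by (simp add: act_refl_refl posD)
      ultimately show ?thesis by blast
    qed simp
  next
    fix x assume "x \<in> insert a (act (refl a) ` inversions g)"
    then show "x \<in> inversions (g \<otimes> refl a)"
    proof
      assume "x = a"
      then show ?thesis using up by (simp add: inversions_def act_mult_refl_self_pos)
    next
      assume "x \<in> act (refl a) ` inversions g"
      then obtain y where y: "y \<in> pos" "act g y \<notin> pos" "x = act (refl a) y"
        by (auto simp: inversions_def)
      then have "y \<noteq> a" using up by blast
      then have "x \<in> pos" using act_simple[OF a] y by simp
      then show ?thesis using y
        by (simp add: inversions_def act_mult posD act_closed act_refl_refl)
    qed
  qed
qed

lemma len_up: "g \<in> carrier W \<Longrightarrow> a \<in> simples \<Longrightarrow> act g a \<in> pos \<Longrightarrow> len (g \<otimes> refl a) = Suc (len g)"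
  by (simp add: len_def inversions_mult_simple finite_invs card_image)

lemma len_down:
  assumes "g \<in> carrier W" "a \<in> simples" "act g a \<notin> pos"
  shows "len g = Suc (len (g \<otimes> refl a))"
proof -
  have "len (g \<otimes> refl a \<otimes> refl a) = Suc (len (g \<otimes> refl a))"
    using assms by (intro len_up) (simp_all add: act_mult_refl_self_pos simplesD refl_closed)
  then show ?thesis using assms by (simp add: mult_refl_refl simplesD)
qed

lemma ex_simple_down:
  assumes "g \<in> carrier W" "len g \<noteq> 0"
  shows "\<exists>a\<in>simples. act g a \<notin> pos"
  using assms pos_if_simples_pos[of g] card_gt_0_iff[of "inversions g"]
  by (auto simp: len_def inversions_def)

lemma len_zero_act_pos:
  assumes u: "u \<in> carrier W" "len u = 0" and b: "b \<in> Rts"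
  shows "act u b \<in> pos \<longleftrightarrow> b \<in> pos"
proof -
  have *: "act u c \<in> pos" if "c \<in> pos" for c
    using that u finite_invs[of u] by (auto simp: len_def inversions_def)
  show ?thesis
    using * *[of "neg b"] b u by (auto simp: act_neg neg_pos_iff act_closed)
qed

lemma len_zero_mult:
  assumes "u \<in> carrier W" "len u = 0" "g \<in> carrier W"
  shows "len (u \<otimes> g) = len g"
proof -
  have "inversions (u \<otimes> g) = inversions g"
    using assms by (auto simp: inversions_def act_mult len_zero_act_pos act_closed posD)
  then show ?thesis by (simp add: len_def)
qed

lemma len_zero_inv:
  assumes "u \<in> carrier W" "len u = 0"
  shows "len (inv u) = 0"
proof -
  have "act (inv u) b \<in> pos" if "b \<in> pos" for b
    using len_zero_act_pos[OF assms, of "act (inv u) b"] that assms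
    by (simp add: act_inv' act_closed posD)
  then show ?thesis by (simp add: len_def inversions_def cong: conj_cong)
qed

lemma wprod_Nil [simp]: "wprod [] = \<one>"
  and wprod_Cons [simp]: "wprod (a # as) = refl a \<otimes> wprod as"
  by (simp_all add: wprod_def)

lemma wprod_closed: "set as \<subseteq> Rts \<Longrightarrow> wprod as \<in> carrier W"
  by (induction as) (simp_all add: refl_closed)

lemma wprod_append:
  "set as \<subseteq> Rts \<Longrightarrow> set bs \<subseteq> Rts \<Longrightarrow> wprod (as @ bs) = wprod as \<otimes> wprod bs"
  by (induction as) (simp_all add: refl_closed wprod_closed m_assoc)

lemma simples_Rts: "simples \<subseteq> Rts"
  using simples_subset pos_subset by blast

text \<open>Read a word from right to left while applying it to \<open>b\<close>: at some letter \<open>a\<close> the root changes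
  sign, and since the reflection in \<open>a\<close> changes the sign of \<open>a\<close> only, the root at that moment is \<open>a\<close>.
  Hence \<open>refl b\<close> is a conjugate of \<open>refl a\<close> that cancels this letter. The word need not be reduced,
  which allows repeated deletions.\<close>
lemma exchange:
  assumes "set as \<subseteq> simples" "b \<in> pos" "act (wprod as) b \<notin> pos"
  shows "\<exists>xs a ys. as = xs @ a # ys \<and> wprod as \<otimes> refl b = wprod (xs @ ys) \<and>
    (\<exists>h\<in>carrier W. b = act h a)"
  using assms
proof (induction as)
  case Nil
  then show ?case by (simp add: act_one posD)
next
  case (Cons a as)
  have as: "set as \<subseteq> Rts" and a: "a \<in> simples" and aR: "a \<in> Rts"
    using Cons.prems simples_Rts by auto
  have bR: "b \<in> Rts" using Cons.prems posD by blast
  note [simp] = wprod_closed[OF as] refl_closed[OF aR] refl_closed[OF bR] aR bR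
  show ?case
  proof (cases "act (wprod as) b \<in> pos")
    case False
    then obtain xs c ys h where IH: "as = xs @ c # ys" "wprod as \<otimes> refl b = wprod (xs @ ys)"
      "h \<in> carrier W" "b = act h c"
      using Cons by auto
    have "wprod (a # as) \<otimes> refl b = wprod ((a # xs) @ ys)"
      using IH(2) by (simp add: m_assoc)
    then show ?thesis using IH by (metis append_Cons)
  next
    case True
    have "act (refl a) (act (wprod as) b) \<notin> pos"
      using Cons.prems by (simp add: act_mult)
    then have eq: "act (wprod as) b = a"
      using act_simple[OF a True] by blast
    have "refl a = wprod as \<otimes> refl b \<otimes> inv (wprod as)"
      using refl_act[of "wprod as" b] eq by simp
    then have "wprod (a # as) \<otimes> refl b = wprod as"
      by (simp add: m_assoc refl_refl)
    moreover have "b = act (inv (wprod as)) a"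
      using eq act_inv[of "wprod as" b] by simp
    ultimately show ?thesis
      by (intro exI[of _ "[]"] exI[of _ a] exI[of _ as]) (auto intro: bexI[of _ "inv (wprod as)"])
  qed
qed

lemma len_one: "len \<one> = 0"
  by (simp add: len_def inversions_def act_one posD cong: conj_cong)

lemma len_word:
  assumes "u \<in> carrier W" "len u = 0" "set as \<subseteq> simples"
  shows "len (u \<otimes> wprod as) \<le> length as"
  using assms(3)
proof (induction as rule: rev_induct)
  case Nil
  then show ?case using assms by simp
next
  case (snoc a as)
  have a: "a \<in> simples" and aR: "set as \<subseteq> Rts" "a \<in> Rts" using snoc.prems simples_Rts by auto
  have eq: "u \<otimes> wprod (as @ [a]) = u \<otimes> wprod as \<otimes> refl a"
    using assms aR by (simp add: wprod_append wprod_closed refl_closed m_assoc)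
  have "len (u \<otimes> wprod as \<otimes> refl a) \<le> Suc (len (u \<otimes> wprod as))"
    using len_up[of "u \<otimes> wprod as" a] len_down[of "u \<otimes> wprod as" a] a assms aR
    by (cases "act (u \<otimes> wprod as) a \<in> pos") (simp_all add: wprod_closed)
  with snoc eq show ?case by simp
qed

lemma decomposition:
  assumes "g \<in> carrier W"
  shows "\<exists>u as. u \<in> carrier W \<and> len u = 0 \<and> set as \<subseteq> simples \<and> g = u \<otimes> wprod as \<and> length as = len g"
  using assms
proof (induction "len g" arbitrary: g)
  case 0
  then show ?case by (intro exI[of _ g] exI[of _ "[]"]) simp
next
  case (Suc n)
  then obtain a where a: "a \<in> simples" "act g a \<notin> pos"
    using ex_simple_down[of g] by auto
  have aR: "a \<in> Rts" using a simples_Rts by blast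
  have "n = len (g \<otimes> refl a)" using len_down[of g a] a Suc by simp
  then obtain u as where u: "u \<in> carrier W" "len u = 0" "set as \<subseteq> simples"
    "g \<otimes> refl a = u \<otimes> wprod as" "length as = n"
    using Suc.hyps(1)[of "g \<otimes> refl a"] Suc.prems refl_closed[OF aR] by auto
  have "set as \<subseteq> Rts" using u simples_Rts by blast
  then have "g = u \<otimes> wprod (as @ [a])"
    using u(1,4) Suc.prems aR mult_refl_refl[of g a]
    by (simp add: wprod_append wprod_closed refl_closed flip: m_assoc)
  then show ?case
    using u a Suc by (intro exI[of _ u] exI[of _ "as @ [a]"]) simp
qed

text \<open>A word of minimal length for a product of simple reflections has as many letters as the
  product has inversions. Unlike in \<open>decomposition\<close>, no factor without inversions is left over.\<close>
lemma word_reduce: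
  assumes "set as \<subseteq> simples"
  shows "\<exists>bs. set bs \<subseteq> simples \<and> wprod bs = wprod as \<and> length bs = len (wprod as)"
  using assms
proof (induction as rule: rev_induct)
  case Nil
  then show ?case by (simp add: len_one)
next
  case (snoc a as)
  then obtain bs where bs: "set bs \<subseteq> simples" "wprod bs = wprod as" "length bs = len (wprod as)"
    by auto
  have a: "a \<in> simples" "a \<in> Rts" "a \<in> pos" and as: "set as \<subseteq> Rts"
    using snoc.prems simplesD by auto
  have eq: "wprod (as @ [a]) = wprod bs \<otimes> refl a"
    using a as bs by (simp add: wprod_append refl_closed)
  show ?case
  proof (cases "act (wprod as) a \<in> pos")
    case True
    have "wprod (bs @ [a]) = wprod (as @ [a])"
      using eq a bs simplesD by (subst wprod_append) (auto simp: refl_closed)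
    then show ?thesis
      using len_up[of "wprod as" a] True a bs wprod_closed[OF as] eq
      by (intro exI[of _ "bs @ [a]"]) simp
  next
    case False
    then obtain xs c ys where "bs = xs @ c # ys" "wprod bs \<otimes> refl a = wprod (xs @ ys)"
      using exchange[of bs a] bs a by auto
    then show ?thesis
      using len_down[of "wprod as" a] False a bs wprod_closed[OF as] eq
      by (intro exI[of _ "xs @ ys"]) auto
  qed
qed

text \<open>The Bruhat order, generated by length-decreasing reflections. In this form transitivity is
  built in; the subword form is derived from it.\<close>
definition below :: "'g \<Rightarrow> 'g \<Rightarrow> bool"
  where "below = (\<lambda>h g. g \<in> carrier W \<and> (\<exists>b\<in>pos. act g b \<notin> pos \<and> h = g \<otimes> refl b))\<^sup>+\<^sup>+"

lemma below_step: "g \<in> carrier W \<Longrightarrow> b \<in> pos \<Longrightarrow> act g b \<notin> pos \<Longrightarrow> below (g \<otimes> refl b) g"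
  unfolding below_def by (rule tranclp.r_into_trancl) blast

lemma below_trans: "below x y \<Longrightarrow> below y z \<Longrightarrow> below x z"
  unfolding below_def by (rule tranclp_trans)

text \<open>Each step of a chain deletes a letter by \<open>exchange\<close>. Only the word for the largest element is
  given; the words obtained on the way are in general not reduced.\<close>
lemma below_subword:
  assumes "below h g" "u \<in> carrier W" "len u = 0" "set as \<subseteq> simples" "g = u \<otimes> wprod as"
  shows "\<exists>bs. subseq bs as \<and> length bs < length as \<and> h = u \<otimes> wprod bs"
proof -
  have subword_step: "\<exists>bs. subseq bs as \<and> length bs < length as \<and> g \<otimes> refl b = u \<otimes> wprod bs"
    if asm: "set as \<subseteq> simples" "g = u \<otimes> wprod as" "b \<in> pos" "act g b \<notin> pos" for g b as
  proof -
    have as: "set as \<subseteq> Rts" and b: "b \<in> Rts" using asm simples_Rts posD by auto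
    note cl = wprod_closed[OF as] refl_closed[OF b]
    have "act (wprod as) b \<notin> pos"
      using asm assms as b cl by (simp add: act_mult len_zero_act_pos act_closed)
    then obtain xs a ys where "as = xs @ a # ys" "wprod as \<otimes> refl b = wprod (xs @ ys)"
      using exchange[OF asm(1,3)] by metis
    moreover have "subseq (xs @ ys) (xs @ a # ys)"
      by (intro list_emb_append_mono) auto
    ultimately show ?thesis
      using asm assms cl by (intro exI[of _ "xs @ ys"]) (simp_all add: m_assoc)
  qed
  show ?thesis
    using assms(1,4,5) unfolding below_def
  proof (induction arbitrary: as rule: converse_tranclp_induct)
    case (base h)
    then show ?case using subword_step by blast
  next
    case (step h h')
    obtain bs where bs: "subseq bs as" "length bs < length as" "h' = u \<otimes> wprod bs"
      using step.IH step.prems by blast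
    moreover have "set bs \<subseteq> simples"
      using bs(1) step.prems(1) by (auto dest: set_subseq)
    moreover obtain b where "b \<in> pos" "act h' b \<notin> pos" "h = h' \<otimes> refl b"
      using step.hyps by blast
    ultimately obtain cs where "subseq cs bs" "length cs < length bs" "h = u \<otimes> wprod cs"
      using subword_step[of bs h' b] by auto
    with bs show ?case
      by (intro exI[of _ cs]) (auto intro: subseq_order.trans)
  qed
qed

lemma below_carrier: "below h g \<Longrightarrow> g \<in> carrier W" "below h g \<Longrightarrow> h \<in> carrier W"
proof -
  assume b: "below h g"
  then show g: "g \<in> carrier W" unfolding below_def by (auto elim: tranclp.cases)
  from b show "h \<in> carrier W" unfolding below_def
    by (induction rule: converse_tranclp_induct) (auto intro: refl_closed posD)
qed

lemma below_len:
  assumes "below h g"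
  shows "len h < len g"
proof -
  obtain u as where u: "u \<in> carrier W" "len u = 0" "set as \<subseteq> simples" "g = u \<otimes> wprod as"
    "length as = len g"
    using decomposition below_carrier assms by blast
  obtain bs where "subseq bs as" "length bs < length as" "h = u \<otimes> wprod bs"
    using below_subword[OF assms u(1-4)] by blast
  moreover have "len (u \<otimes> wprod bs) \<le> length bs"
    using u calculation by (intro len_word) (auto dest: set_subseq)
  ultimately show ?thesis using u by simp
qed

lemma inversions_mult_subset:
  assumes "g \<in> carrier W" "h \<in> carrier W"
  shows "inversions (g \<otimes> h) \<subseteq> inversions h \<union> act (inv h) ` inversions g"
proof
  fix x assume "x \<in> inversions (g \<otimes> h)"
  then have x: "x \<in> pos" "act g (act h x) \<notin> pos"
    using assms by (auto simp: inversions_def act_mult posD)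
  then show "x \<in> inversions h \<union> act (inv h) ` inversions g"
    using assms by (cases "act h x \<in> pos") (auto simp: inversions_def act_inv posD intro!: image_eqI[of x _ "act h x"])
qed

lemma len_mult_le:
  assumes "g \<in> carrier W" "h \<in> carrier W"
  shows "len (g \<otimes> h) \<le> len g + len h"
proof -
  have "len (g \<otimes> h) \<le> card (inversions h \<union> act (inv h) ` inversions g)"
    unfolding len_def using assms by (intro card_mono inversions_mult_subset) (auto simp: finite_invs)
  also have "\<dots> \<le> len h + card (act (inv h) ` inversions g)"
    unfolding len_def by (rule card_Un_le)
  also have "\<dots> \<le> len h + len g"
    unfolding len_def using assms by (simp add: card_image_le finite_invs)
  finally show ?thesis by simp
qed

lemma inversions_mult_eq:
  assumes g: "g \<in> carrier W" and h: "h \<in> carrier W" and len: "len (g \<otimes> h) = len g + len h"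
  shows "inversions (g \<otimes> h) = inversions h \<union> act (inv h) ` inversions g"
    and "inversions h \<inter> act (inv h) ` inversions g = {}"
    and "inj_on (act (inv h)) (inversions g)"
proof -
  let ?A = "act (inv h) ` inversions g"
  have f: "finite (inversions h)" "finite ?A" using g h by (auto simp: finite_invs)
  show "inj_on (act (inv h)) (inversions g)"
    by (rule inj_on_inverseI[where g="act h"]) (simp add: act_inv' inversions_def posD h)
  then have c: "card ?A = len g" by (simp add: card_image len_def)
  have le: "card (inversions (g \<otimes> h)) \<le> card (inversions h \<union> ?A)"
    using f g h by (intro card_mono inversions_mult_subset) auto
  have "card (inversions h \<union> ?A) + card (inversions h \<inter> ?A) = len h + len g"
    using card_Un_Int[OF f] c by (simp add: len_def)
  with le len have "card (inversions h \<inter> ?A) = 0"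
    and eq: "card (inversions h \<union> ?A) = card (inversions (g \<otimes> h))"
    by (simp_all add: len_def)
  then show "inversions h \<inter> ?A = {}" using f by simp
  show "inversions (g \<otimes> h) = inversions h \<union> ?A"
    using f g h eq by (intro card_subset_eq inversions_mult_subset) auto
qed

end

text \<open>An invariant function on roots with values in a commutative monoid, written additively, gives
  the exponents of the monomials \<open>q\<^sub>w\<close>: defining \<open>wt\<close> by inversions makes its independence of reduced words
  evident.\<close>
locale weighted_root_action = root_action W act Rts pos neg refl simples
  for W (structure) and act :: "'g \<Rightarrow> 'r \<Rightarrow> 'r" and Rts pos neg refl simples +
  fixes weight :: "'r \<Rightarrow> 'm::comm_monoid_add"
  assumes weight_act: "g \<in> carrier W \<Longrightarrow> a \<in> Rts \<Longrightarrow> weight (act g a) = weight a"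
begin

definition wt :: "'g \<Rightarrow> 'm"
  where "wt g = (\<Sum>b\<in>inversions g. weight b)"

lemma wt_up:
  assumes "g \<in> carrier W" "a \<in> simples" "act g a \<in> pos"
  shows "wt (g \<otimes> refl a) = wt g + weight a"
proof -
  have "wt (g \<otimes> refl a) = weight a + (\<Sum>b\<in>act (refl a) ` inversions g. weight b)"
    unfolding wt_def inversions_mult_simple[OF assms]
    using assms by (simp add: finite_invs inversions_mult_simple)
  also have "(\<Sum>b\<in>act (refl a) ` inversions g. weight b) = (\<Sum>b\<in>inversions g. weight (act (refl a) b))"
    by (simp add: sum.reindex inversions_mult_simple[OF assms])
  also have "\<dots> = wt g"
    unfolding wt_def using assms
    by (intro sum.cong) (auto simp: inversions_def weight_act refl_closed posD simplesD)
  finally show ?thesis by (simp add: add.commute)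
qed

lemma wt_down:
  assumes "g \<in> carrier W" "a \<in> simples" "act g a \<notin> pos"
  shows "wt g = wt (g \<otimes> refl a) + weight a"
proof -
  have "wt (g \<otimes> refl a \<otimes> refl a) = wt (g \<otimes> refl a) + weight a"
    using assms by (intro wt_up) (simp_all add: act_mult_refl_self_pos simplesD refl_closed)
  then show ?thesis using assms by (simp add: mult_refl_refl simplesD)
qed

lemma wt_len_zero: "g \<in> carrier W \<Longrightarrow> len g = 0 \<Longrightarrow> wt g = 0"
  using finite_invs[of g] by (simp add: wt_def len_def)

lemma wt_mult:
  assumes "g \<in> carrier W" "h \<in> carrier W" "len (g \<otimes> h) = len g + len h"
  shows "wt (g \<otimes> h) = wt g + wt h"
proof -
  have "wt (g \<otimes> h) = wt h + (\<Sum>b\<in>act (inv h) ` inversions g. weight b)"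
    unfolding wt_def inversions_mult_eq[OF assms]
    using assms by (intro sum.union_disjoint) (simp_all add: finite_invs inversions_mult_eq)
  also have "(\<Sum>b\<in>act (inv h) ` inversions g. weight b) = (\<Sum>b\<in>inversions g. weight (act (inv h) b))"
    by (simp add: sum.reindex inversions_mult_eq[OF assms])
  also have "\<dots> = wt g"
    unfolding wt_def using assms by (intro sum.cong) (auto simp: inversions_def weight_act posD)
  finally show ?thesis by (simp add: add.commute)
qed

text \<open>Each time a letter makes the length drop, it cancels the weight of an earlier letter of the
  same class, so words differ from reduced words by twice a weight.\<close>
lemma wt_word:
  assumes "u \<in> carrier W" "len u = 0" "set as \<subseteq> simples"
  shows "\<exists>m. (\<Sum>a\<leftarrow>as. weight a) = wt (u \<otimes> wprod as) + m + m"
    and "len (u \<otimes> wprod as) = length as \<Longrightarrow> (\<Sum>a\<leftarrow>as. weight a) = wt (u \<otimes> wprod as)"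
proof -
  have "(\<exists>m. (\<Sum>a\<leftarrow>as. weight a) = wt (u \<otimes> wprod as) + m + m) \<and>
    (len (u \<otimes> wprod as) = length as \<longrightarrow> (\<Sum>a\<leftarrow>as. weight a) = wt (u \<otimes> wprod as))"
    using assms(3)
  proof (induction as rule: rev_induct)
    case Nil
    then show ?case using assms by (auto simp: wt_len_zero intro: exI[of _ 0])
  next
    case (snoc a as)
    let ?g = "u \<otimes> wprod as"
    have a: "a \<in> simples" and aR: "set as \<subseteq> Rts" "a \<in> Rts" using snoc.prems simples_Rts by auto
    have g: "?g \<in> carrier W" using assms aR by (simp add: wprod_closed)
    have eq: "u \<otimes> wprod (as @ [a]) = ?g \<otimes> refl a"
      using assms aR by (simp add: wprod_append wprod_closed refl_closed m_assoc)
    obtain m where m: "(\<Sum>a\<leftarrow>as. weight a) = wt ?g + m + m" using snoc by auto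
    have le: "len ?g \<le> length as" using len_word assms snoc.prems by simp
    show ?case
    proof (cases "act ?g a \<in> pos")
      case True
      have "(\<Sum>a\<leftarrow>as @ [a]. weight a) = wt (?g \<otimes> refl a) + m + m"
        using m wt_up[OF g a True] by (simp add: ac_simps)
      moreover have "len ?g = length as \<Longrightarrow> (\<Sum>a\<leftarrow>as @ [a]. weight a) = wt (?g \<otimes> refl a)"
        using snoc wt_up[OF g a True] by simp
      ultimately show ?thesis unfolding eq using len_up[OF g a True] by auto
    next
      case False
      have "(\<Sum>a\<leftarrow>as @ [a]. weight a) = wt (?g \<otimes> refl a) + (m + weight a) + (m + weight a)"
        using m wt_down[OF g a False] by (simp add: ac_simps)
      then show ?thesis unfolding eq using len_down[OF g a False] le by auto
    qed
  qed
  then show "\<exists>m. (\<Sum>a\<leftarrow>as. weight a) = wt (u \<otimes> wprod as) + m + m"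
    and "len (u \<otimes> wprod as) = length as \<Longrightarrow> (\<Sum>a\<leftarrow>as. weight a) = wt (u \<otimes> wprod as)"
    by blast+
qed

text \<open>The source of integrality: the weight lost by passing from \<open>g\<close> to \<open>g \<otimes> refl b\<close> is that of \<open>b\<close>
  plus something divisible by two.\<close>
lemma wt_step:
  assumes g: "g \<in> carrier W" and b: "b \<in> pos" "act g b \<notin> pos"
  shows "\<exists>m. wt g = wt (g \<otimes> refl b) + weight b + m + m"
proof -
  obtain u as where u: "u \<in> carrier W" "len u = 0" "set as \<subseteq> simples" "g = u \<otimes> wprod as"
    "length as = len g"
    using decomposition[OF g] by blast
  have as: "set as \<subseteq> Rts" and bR: "b \<in> Rts" using u b simples_Rts posD by auto
  note cl = wprod_closed[OF as] refl_closed[OF bR]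
  have "act (wprod as) b \<notin> pos"
    using u as b bR cl by (simp add: act_mult len_zero_act_pos act_closed)
  then obtain xs a ys h where x: "as = xs @ a # ys" "wprod as \<otimes> refl b = wprod (xs @ ys)"
    "h \<in> carrier W" "b = act h a"
    using exchange[of as b] u b by blast
  have fb: "weight b = weight a" using x as by (simp add: weight_act)
  have eq: "g \<otimes> refl b = u \<otimes> wprod (xs @ ys)" using x u cl by (simp add: m_assoc)
  obtain m where "(\<Sum>a\<leftarrow>xs @ ys. weight a) = wt (g \<otimes> refl b) + m + m"
    using wt_word(1)[OF u(1,2), of "xs @ ys"] u(3) x(1) eq by auto
  moreover have "(\<Sum>a\<leftarrow>as. weight a) = wt g"
    using wt_word(2)[OF u(1-3)] u(4,5) by simp
  ultimately show ?thesis
    using x(1) fb by (auto simp: ac_simps intro!: exI[of _ m])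
qed

end

section \<open>Root data\<close>
lemma additive_int_scale:
  assumes "additive f"
  shows "f (int_scale n x) = int_scale n (f x)"
proof -
  have *: "f ((((+) x) ^^ k) 0) = (((+) (f x)) ^^ k) 0" for k
    by (induction k) (simp_all add: additive.add[OF assms] additive.zero[OF assms])
  show ?thesis by (simp add: int_scale_def * additive.minus[OF assms])
qed

lemma int_scale_int [simp]: "int_scale n (m::int) = n * m"
proof -
  have *: "(((+) m) ^^ k) 0 = int k * m" for k
    by (induction k) (simp_all add: algebra_simps)
  show ?thesis by (simp add: int_scale_def *)
qed

lemma int_scale_zero_left [simp]: "int_scale 0 x = 0"
  by (simp add: int_scale_def)

lemma nat_span_zero: "0 \<in> nat_span A"
  unfolding nat_span_def by (auto intro!: exI[of _ "\<lambda>_. 0"])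

lemma nat_span_add:
  assumes "x \<in> nat_span A" "y \<in> nat_span A"
  shows "x + y \<in> nat_span A"
proof -
  obtain c d where "x = (\<Sum>a\<in>A. int_scale (int (c a)) a)" "y = (\<Sum>a\<in>A. int_scale (int (d a)) a)"
    using assms by (auto simp: nat_span_def)
  then have "x + y = (\<Sum>a\<in>A. int_scale (int (c a + d a)) a)"
    by (simp add: sum.distrib int_scale_add_left)
  then show ?thesis unfolding nat_span_def by (auto intro: exI[of _ "\<lambda>a. c a + d a"])
qed

lemma nat_span_base: "finite A \<Longrightarrow> a \<in> A \<Longrightarrow> a \<in> nat_span A"
  unfolding nat_span_def
  by (auto intro!: exI[of _ "\<lambda>b. if b = a then 1 else 0"] simp: int_scale_one if_distrib
      if_distribR sum.delta cong: if_cong)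

lemma nat_span_scale: 
  assumes "x \<in> nat_span A" "0 \<le> n"
  shows "int_scale n x \<in> nat_span A"
proof -
  have "int_scale (int k) x \<in> nat_span A" for k
    by (induction k) (auto simp: nat_span_zero int_scale_add_left int_scale_one
        intro!: nat_span_add assms)
  from this[of "nat n"] assms show ?thesis by simp
qed

locale based_root_datum_ctx =
  fixes D :: "('x::ab_group_add, 'y::ab_group_add) root_datum"
  assumes root_datum: "based_root_datum D"
begin

abbreviation "pr \<equiv> pairing D"
abbreviation "R \<equiv> roots D"
abbreviation "Rpos \<equiv> pos_roots D"
abbreviation "cor \<equiv> coroot D"
abbreviation "s \<equiv> reflection D"
abbreviation "cs \<equiv> coreflection D"

lemma additive_pr_right: "additive (pr x)" and additive_pr_left: "additive (\<lambda>x. pr x y)"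
  using root_datum unfolding based_root_datum_def by blast+

lemma pr_add_left: "pr (x + x') y = pr x y + pr x' y"
  and pr_zero_left: "pr 0 y = 0"
  and pr_minus_left: "pr (- x) y = - pr x y"
  and pr_diff_left: "pr (x - x') y = pr x y - pr x' y"
  and pr_scale_left: "pr (int_scale n x) y = n * pr x y"
  using additive.add[OF additive_pr_left] additive.zero[OF additive_pr_left, of y]
    additive.minus[OF additive_pr_left] additive.diff[OF additive_pr_left]
    additive_int_scale[OF additive_pr_left, of n x y]
  by simp_all

lemma pr_add_right: "pr x (y + y') = pr x y + pr x y'"
  and pr_zero_right: "pr x 0 = 0"
  and pr_minus_right: "pr x (- y) = - pr x y"
  and pr_diff_right: "pr x (y - y') = pr x y - pr x y'"
  and pr_scale_right: "pr x (int_scale n y) = n * pr x y"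
  and pr_sum_right: "pr x (\<Sum>i\<in>I. h i) = (\<Sum>i\<in>I. pr x (h i))"
  using additive.add[OF additive_pr_right] additive.zero[OF additive_pr_right, of x]
    additive.minus[OF additive_pr_right] additive.diff[OF additive_pr_right]
    additive_int_scale[OF additive_pr_right, of x n y] additive.sum[OF additive_pr_right, of x h I]
  by simp_all

lemmas pr_simps = pr_add_left pr_zero_left pr_minus_left pr_diff_left pr_scale_left
  pr_add_right pr_zero_right pr_minus_right pr_diff_right pr_scale_right

lemma eq_if_pr_left: "(\<And>y. pr x y = pr x' y) \<Longrightarrow> x = x'"
proof -
  have "inj (pairing D)" using root_datum unfolding based_root_datum_def bij_betw_def by blast
  then show "(\<And>y. pr x y = pr x' y) \<Longrightarrow> x = x'" by (simp add: inj_def fun_eq_iff)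
qed

lemma eq_if_pr_right: "(\<And>x. pr x y = pr x y') \<Longrightarrow> y = y'"
proof -
  have "inj (\<lambda>y x. pr x y)" using root_datum unfolding based_root_datum_def bij_betw_def by blast
  then show "(\<And>x. pr x y = pr x y') \<Longrightarrow> y = y'" by (simp add: inj_def fun_eq_iff)
qed

lemma finite_roots [simp]: "finite R"
  and bij_coroot: "bij_betw cor R (coroots D)"
  and pr_coroot_self: "\<alpha> \<in> R \<Longrightarrow> pr \<alpha> (cor \<alpha>) = 2"
  and reflection_roots: "\<alpha> \<in> R \<Longrightarrow> s \<alpha> ` R = R"
  and coreflection_coroots: "\<alpha> \<in> R \<Longrightarrow> cs \<alpha> ` coroots D = coroots D"
  and reduced: "\<alpha> \<in> R \<Longrightarrow> \<beta> \<in> R \<Longrightarrow> m \<noteq> 0 \<Longrightarrow> int_scale m \<alpha> = int_scale n \<beta> \<Longrightarrow>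
    \<beta> = \<alpha> \<or> \<beta> = - \<alpha>"
  and base_subset: "base D \<subseteq> R"
  and base_independent: "\<not> int_module.dependent (base D)"
  and pos_or_neg: "\<alpha> \<in> R \<Longrightarrow> \<alpha> \<in> nat_span (base D) \<or> - \<alpha> \<in> nat_span (base D)"
  using root_datum unfolding based_root_datum_def by blast+

lemma finite_base [simp]: "finite (base D)"
  using base_subset finite_roots finite_subset by blast

lemma finite_pos [simp]: "finite Rpos"
  by (simp add: pos_roots_def)

lemma finite_coroots [simp]: "finite (coroots D)"
  using bij_coroot bij_betw_finite by fastforce

lemma coroot_in [simp]: "\<alpha> \<in> R \<Longrightarrow> cor \<alpha> \<in> coroots D"
  using bij_coroot by (auto simp: bij_betw_def)

lemma coroot_inj: "\<alpha> \<in> R \<Longrightarrow> \<beta> \<in> R \<Longrightarrow> cor \<alpha> = cor \<beta> \<Longrightarrow> \<alpha> = \<beta>"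
  using bij_coroot by (auto simp: bij_betw_def dest: inj_onD)

lemma additive_reflection: "additive (s \<alpha>)"
  by standard (simp add: reflection_def pr_simps int_scale_add_left)

lemma reflection_self: "\<alpha> \<in> R \<Longrightarrow> s \<alpha> \<alpha> = - \<alpha>"
  using int_scale_add_left[of 1 1 \<alpha>] by (simp add: reflection_def pr_coroot_self int_scale_one)

lemma coreflection_self: "\<alpha> \<in> R \<Longrightarrow> cs \<alpha> (cor \<alpha>) = - cor \<alpha>"
  using int_scale_add_left[of 1 1 "cor \<alpha>"]
  by (simp add: coreflection_def pr_coroot_self int_scale_one)

lemma reflection_in: "\<alpha> \<in> R \<Longrightarrow> \<beta> \<in> R \<Longrightarrow> s \<alpha> \<beta> \<in> R"
  using reflection_roots by blast

lemma neg_root: "\<alpha> \<in> R \<Longrightarrow> - \<alpha> \<in> R"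
  using reflection_in[of \<alpha> \<alpha>] by (simp add: reflection_self)

lemma pr_reflection: "pr (s \<alpha> x) y = pr x (cs \<alpha> y)"
  by (simp add: reflection_def coreflection_def pr_simps)

lemma pr_reflection_self: "\<alpha> \<in> R \<Longrightarrow> pr (s \<alpha> x) (cor \<alpha>) = - pr x (cor \<alpha>)"
  by (simp add: pr_reflection coreflection_self pr_simps)

lemma reflection_reflection: "\<alpha> \<in> R \<Longrightarrow> s \<alpha> (s \<alpha> x) = x"
  using pr_reflection_self[of \<alpha> x]
  by (simp add: reflection_def[of D \<alpha> "s \<alpha> x"]) (simp add: reflection_def int_scale_minus_left)

lemma coreflection_coreflection: "\<alpha> \<in> R \<Longrightarrow> cs \<alpha> (cs \<alpha> y) = y"
  by (rule eq_if_pr_right) (simp add: reflection_reflection flip: pr_reflection)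

lemma inj_coreflection: "\<alpha> \<in> R \<Longrightarrow> inj_on (cs \<alpha>) A"
  by (metis coreflection_coreflection inj_onI)

lemma inj_reflection: "\<alpha> \<in> R \<Longrightarrow> inj_on (s \<alpha>) A"
  by (metis reflection_reflection inj_onI)

text \<open>The invariant forms on the two lattices. They are only positive semidefinite, as roots need
  not span, but positive on each root; this suffices to express pairings of roots with coroots through
  a symmetric form and to recover coroots from roots.\<close>
definition bform :: "'x \<Rightarrow> 'x \<Rightarrow> int"
  where "bform x x' = (\<Sum>c\<in>coroots D. pr x c * pr x' c)"

definition cobform :: "'y \<Rightarrow> 'y \<Rightarrow> int"
  where "cobform y y' = (\<Sum>r\<in>R. pr r y * pr r y')"

lemma bform_reflection: "\<alpha> \<in> R \<Longrightarrow> bform (s \<alpha> x) (s \<alpha> x') = bform x x'"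
  using sum.reindex[OF inj_coreflection, of \<alpha> "\<lambda>c. pr x c * pr x' c" "coroots D"]
  by (simp add: bform_def pr_reflection coreflection_coroots)

lemma cobform_coreflection: "\<alpha> \<in> R \<Longrightarrow> cobform (cs \<alpha> y) (cs \<alpha> y') = cobform y y'"
  using sum.reindex[OF inj_reflection, of \<alpha> "\<lambda>r. pr r y * pr r y'" R]
  by (simp add: cobform_def reflection_roots flip: pr_reflection)

lemma additive_bform: "additive (bform x)" "additive (\<lambda>x. bform x x')"
  by (standard; simp add: bform_def pr_simps algebra_simps sum.distrib)+

lemma additive_cobform: "additive (cobform y)" "additive (\<lambda>y. cobform y y')"
  by (standard; simp add: cobform_def pr_simps algebra_simps sum.distrib)+

lemma bform_commute: "bform x x' = bform x' x"
  by (simp add: bform_def mult.commute)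

lemma bform_root:
  assumes "\<alpha> \<in> R"
  shows "2 * bform \<alpha> x = bform \<alpha> \<alpha> * pr x (cor \<alpha>)"
proof -
  have "bform \<alpha> x = bform (s \<alpha> \<alpha>) (s \<alpha> x)" using bform_reflection assms by simp
  also have "\<dots> = - bform \<alpha> (s \<alpha> x)"
    using assms by (simp add: reflection_self additive.minus[OF additive_bform(2)])
  also have "\<dots> = - bform \<alpha> x + pr x (cor \<alpha>) * bform \<alpha> \<alpha>"
    by (simp add: reflection_def additive.diff[OF additive_bform(1)]
        additive_int_scale[OF additive_bform(1)])
  finally show ?thesis by simp
qed

lemma cobform_coroot:
  assumes "\<alpha> \<in> R"
  shows "2 * cobform (cor \<alpha>) y = cobform (cor \<alpha>) (cor \<alpha>) * pr \<alpha> y"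
proof -
  have "cobform (cor \<alpha>) y = cobform (cs \<alpha> (cor \<alpha>)) (cs \<alpha> y)"
    using cobform_coreflection assms by simp
  also have "\<dots> = - cobform (cor \<alpha>) (cs \<alpha> y)"
    using assms by (simp add: coreflection_self additive.minus[OF additive_cobform(2)])
  also have "\<dots> = - cobform (cor \<alpha>) y + pr \<alpha> y * cobform (cor \<alpha>) (cor \<alpha>)"
    by (simp add: coreflection_def additive.diff[OF additive_cobform(1)]
        additive_int_scale[OF additive_cobform(1)])
  finally show ?thesis by simp
qed

lemma bform_pos:
  assumes "\<alpha> \<in> R"
  shows "0 < bform \<alpha> \<alpha>"
  unfolding bform_def
  by (rule sum_pos2[of _ "cor \<alpha>"]) (use assms in \<open>simp_all add: pr_coroot_self\<close>)

lemma cobform_pos: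
  assumes "\<alpha> \<in> R"
  shows "0 < cobform (cor \<alpha>) (cor \<alpha>)"
  unfolding cobform_def
  by (rule sum_pos2[of _ \<alpha>]) (use assms in \<open>simp_all add: pr_coroot_self\<close>)

lemma bform_zero_imp: "bform x x = 0 \<Longrightarrow> bform x x' = 0"
  by (simp add: bform_def sum_nonneg_eq_0_iff)

lemma bform_nonneg: "0 \<le> bform x x"
  by (simp add: bform_def sum_nonneg)

text \<open>A root determines its coroot, since \<open>bform_root\<close> gives the pairing with the coroot of \<open>\<alpha>\<close> as
  \<open>x \<mapsto> 2 (\<alpha>|x) / (\<alpha>|\<alpha>)\<close>. Invariance of the form then makes the bijection between roots and coroots
  equivariant.\<close>
lemma coroot_reflection:
  assumes "\<alpha> \<in> R" "\<beta> \<in> R"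
  shows "cor (s \<beta> \<alpha>) = cs \<beta> (cor \<alpha>)"
proof (rule eq_if_pr_right)
  fix x
  let ?d = "s \<beta> \<alpha>"
  have d: "?d \<in> R" using assms by (simp add: reflection_in)
  have "bform ?d ?d * pr x (cor ?d) = 2 * bform ?d x" using bform_root[OF d] by simp
  also have "bform ?d x = bform \<alpha> (s \<beta> x)"
    using bform_reflection[of \<beta> "\<alpha>" "s \<beta> x"] assms by (simp add: reflection_reflection)
  also have "2 * \<dots> = bform \<alpha> \<alpha> * pr x (cs \<beta> (cor \<alpha>))"
    using bform_root assms by (simp add: pr_reflection)
  also have "bform \<alpha> \<alpha> = bform ?d ?d" using assms by (simp add: bform_reflection)
  finally show "pr x (cor ?d) = pr x (cs \<beta> (cor \<alpha>))" using bform_pos[OF d] by simp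
qed

lemma coroot_neg: "\<alpha> \<in> R \<Longrightarrow> cor (- \<alpha>) = - cor \<alpha>"
  using coroot_reflection[of \<alpha> \<alpha>] by (simp add: reflection_self coreflection_self)

lemma pr_pos_iff:
  assumes "\<alpha> \<in> R" "\<gamma> \<in> R"
  shows "0 < pr \<alpha> (cor \<gamma>) \<longleftrightarrow> 0 < pr \<gamma> (cor \<alpha>)"
proof -
  have "bform \<gamma> \<gamma> * pr \<alpha> (cor \<gamma>) = bform \<alpha> \<alpha> * pr \<gamma> (cor \<alpha>)"
    using bform_root assms bform_commute by metis
  then show ?thesis using bform_pos assms by (metis zero_less_mult_pos mult_pos_pos)
qed

text \<open>Cauchy-Schwarz bounds the product by 4. In case of equality a combination of \<open>\<alpha>\<close> and \<open>\<gamma>\<close> lies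
  in the radical of \<open>bform\<close>; as the form is degenerate in general, this yields proportional coroots
  first, and only the dual form yields proportional roots, which reducedness excludes.\<close>
lemma pr_product_le:
  assumes \<alpha>: "\<alpha> \<in> R" and \<gamma>: "\<gamma> \<in> R" and ne: "\<gamma> \<noteq> \<alpha>" "\<gamma> \<noteq> - \<alpha>"
  shows "pr \<alpha> (cor \<gamma>) * pr \<gamma> (cor \<alpha>) \<le> 3"
proof (rule ccontr)
  define A where "A = bform \<alpha> \<alpha>"
  define C where "C = bform \<gamma> \<gamma>"
  define b where "b = bform \<alpha> \<gamma>"
  let ?x = "int_scale C \<alpha> - int_scale b \<gamma>"
  have pos: "0 < A" "0 < C" using bform_pos \<alpha> \<gamma> by (auto simp: A_def C_def)
  have k: "2 * b = C * pr \<alpha> (cor \<gamma>)" and j: "2 * b = A * pr \<gamma> (cor \<alpha>)"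
    using bform_root[OF \<gamma>, of \<alpha>] bform_root[OF \<alpha>, of \<gamma>]
    by (simp_all add: A_def C_def b_def bform_commute)
  assume "\<not> ?thesis"
  then have ge: "4 \<le> pr \<alpha> (cor \<gamma>) * pr \<gamma> (cor \<alpha>)" by simp
  have "4 * (A * C) \<le> (A * C) * (pr \<alpha> (cor \<gamma>) * pr \<gamma> (cor \<alpha>))"
    using ge pos by (simp add: mult.commute)
  also have "\<dots> = (2 * b) * (2 * b)" by (subst (1) k, subst j) (simp add: ac_simps)
  finally have AC: "A * C \<le> b * b" by simp
  have xx: "bform ?x z = C * bform \<alpha> z - b * bform \<gamma> z" for z
    by (simp add: additive.diff[OF additive_bform(2)] additive_int_scale[OF additive_bform(2)])
  have "bform ?x ?x = C * (C * A - b * b) - b * (C * b - b * C)"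
    by (simp add: xx additive.diff[OF additive_bform(1)] additive_int_scale[OF additive_bform(1)]
        A_def C_def b_def bform_commute algebra_simps)
  also have "\<dots> = C * (A * C - b * b)" by (simp add: algebra_simps)
  also have "\<dots> \<le> 0" using pos AC by (simp add: mult_nonneg_nonpos)
  finally have "bform ?x ?x = 0" using bform_nonneg[of ?x] by simp
  then have "2 * (C * bform \<alpha> z) = 2 * (b * bform \<gamma> z)" for z
    using bform_zero_imp[of ?x z] xx[of z] by simp
  then have "C * (A * pr z (cor \<alpha>)) = b * (C * pr z (cor \<gamma>))" for z
    using bform_root[OF \<alpha>, of z] bform_root[OF \<gamma>, of z] unfolding A_def C_def
    by (metis mult.left_commute)
  then have "C * (A * pr z (cor \<alpha>)) = C * (b * pr z (cor \<gamma>))" for z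
    by (simp add: mult.left_commute)
  then have "A * pr z (cor \<alpha>) = b * pr z (cor \<gamma>)" for z
    using pos mult_left_cancel[of C] by simp
  then have "int_scale A (cor \<alpha>) = int_scale b (cor \<gamma>)"
    by (intro eq_if_pr_right) (simp add: pr_simps)
  then have "cobform (int_scale A (cor \<alpha>)) y = cobform (int_scale b (cor \<gamma>)) y" for y
    by simp
  then have "A * cobform (cor \<alpha>) y = b * cobform (cor \<gamma>) y" for y
    by (simp add: additive_int_scale[OF additive_cobform(2)])
  then have "A * (2 * cobform (cor \<alpha>) y) = b * (2 * cobform (cor \<gamma>) y)" for y
    by (metis mult.left_commute)
  then have "int_scale (A * cobform (cor \<alpha>) (cor \<alpha>)) \<alpha> =
      int_scale (b * cobform (cor \<gamma>) (cor \<gamma>)) \<gamma>"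
    using \<alpha> \<gamma> by (intro eq_if_pr_left) (simp add: pr_simps cobform_coroot ac_simps)
  moreover have "A * cobform (cor \<alpha>) (cor \<alpha>) \<noteq> 0" using pos cobform_pos[OF \<alpha>] by simp
  ultimately show False using reduced \<alpha> \<gamma> ne by blast
qed

section \<open>Positive roots\<close>

lemma base_coeffs_unique:
  assumes "(\<Sum>b\<in>base D. int_scale (c b) b) = (\<Sum>b\<in>base D. int_scale (d b) b)" "b \<in> base D"
  shows "c b = d b"
proof -
  have "(\<Sum>b\<in>base D. int_scale (c b - d b) b) = 0"
    using assms by (simp add: int_module.scale_left_diff_distrib sum_subtractf)
  then have "c b - d b = 0"
    using base_independent assms(2) int_module.dependent_explicit[of "base D"] finite_base
    by (meson subset_refl)
  then show ?thesis by simp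
qed

lemma root_nonzero: "\<alpha> \<in> R \<Longrightarrow> \<alpha> \<noteq> 0"
  using pr_coroot_self[of \<alpha>] by (auto simp: pr_simps)

lemma coroot_nonzero: "\<alpha> \<in> R \<Longrightarrow> cor \<alpha> \<noteq> 0"
  using pr_coroot_self[of \<alpha>] by (auto simp: pr_simps)

lemma nat_span_base_antisym:
  assumes "x \<in> nat_span (base D)" "- x \<in> nat_span (base D)"
  shows "x = 0"
proof -
  obtain c d where c: "x = (\<Sum>b\<in>base D. int_scale (int (c b)) b)"
    and d: "- x = (\<Sum>b\<in>base D. int_scale (int (d b)) b)"
    using assms by (auto simp: nat_span_def)
  have "(\<Sum>b\<in>base D. int_scale (int (c b + d b)) b) = x + - x"
    by (simp add: int_scale_add_left sum.distrib d flip: c)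
  then have "(\<Sum>b\<in>base D. int_scale (int (c b + d b)) b) = (\<Sum>b\<in>base D. int_scale 0 b)" by simp
  then have "c b = 0" if "b \<in> base D" for b
    using base_coeffs_unique[of "\<lambda>b. int (c b + d b)" "\<lambda>_. 0" b] that by auto
  then show ?thesis by (simp add: c)
qed

lemma posD: "\<alpha> \<in> Rpos \<Longrightarrow> \<alpha> \<in> R"
  by (simp add: pos_roots_def)

lemma neg_pos_iff: "\<alpha> \<in> R \<Longrightarrow> - \<alpha> \<in> Rpos \<longleftrightarrow> \<alpha> \<notin> Rpos"
  using pos_or_neg[of \<alpha>] nat_span_base_antisym[of \<alpha>] root_nonzero[of \<alpha>] neg_root[of \<alpha>]
  by (auto simp: pos_roots_def)

lemma neg_roots_iff: "\<alpha> \<in> R \<Longrightarrow> \<alpha> \<in> neg_roots D \<longleftrightarrow> \<alpha> \<notin> Rpos"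
  using neg_pos_iff[of \<alpha>] neg_root[of \<alpha>] by (auto simp: neg_roots_def pos_roots_def)

lemma base_pos: "\<beta> \<in> base D \<Longrightarrow> \<beta> \<in> Rpos"
  using base_subset by (auto simp: pos_roots_def nat_span_base)

lemma simple_reflection_coeffs:
  assumes "\<beta> \<in> base D" "\<gamma> = (\<Sum>b\<in>base D. int_scale (c b) b)"
  shows "s \<beta> \<gamma> = (\<Sum>b\<in>base D. int_scale (c b - (if b = \<beta> then pr \<gamma> (cor \<beta>) else 0)) b)"
proof -
  have "(\<Sum>b\<in>base D. int_scale (if b = \<beta> then pr \<gamma> (cor \<beta>) else 0) b) =
    (\<Sum>b\<in>base D. if b = \<beta> then int_scale (pr \<gamma> (cor \<beta>)) \<beta> else 0)"
    by (intro sum.cong) auto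
  also have "\<dots> = int_scale (pr \<gamma> (cor \<beta>)) \<beta>" using assms by simp
  finally have e: "(\<Sum>b\<in>base D. int_scale (if b = \<beta> then pr \<gamma> (cor \<beta>) else 0) b) =
    int_scale (pr \<gamma> (cor \<beta>)) \<beta>" .
  have "s \<beta> \<gamma> = (\<Sum>b\<in>base D. int_scale (c b) b) -
      (\<Sum>b\<in>base D. int_scale (if b = \<beta> then pr \<gamma> (cor \<beta>) else 0) b)"
    unfolding e unfolding reflection_def by (simp flip: assms(2))
  then show ?thesis by (simp add: int_module.scale_left_diff_distrib sum_subtractf)
qed

lemma simple_reflection_pos:
  assumes \<beta>: "\<beta> \<in> base D" and \<gamma>: "\<gamma> \<in> Rpos" and ne: "\<gamma> \<noteq> \<beta>"
  shows "s \<beta> \<gamma> \<in> Rpos"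
proof (rule ccontr)
  have R: "\<beta> \<in> R" "\<gamma> \<in> R" using \<beta> \<gamma> base_subset posD by auto
  obtain c where c: "\<gamma> = (\<Sum>b\<in>base D. int_scale (int (c b)) b)"
    using \<gamma> by (auto simp: pos_roots_def nat_span_def)
  assume "s \<beta> \<gamma> \<notin> Rpos"
  then have "- s \<beta> \<gamma> \<in> Rpos" using R neg_pos_iff reflection_in by blast
  then obtain d where "- s \<beta> \<gamma> = (\<Sum>b\<in>base D. int_scale (int (d b)) b)"
    by (auto simp: pos_roots_def nat_span_def)
  then have "s \<beta> \<gamma> = - (\<Sum>b\<in>base D. int_scale (int (d b)) b)"
    by (metis minus_minus)
  then have "s \<beta> \<gamma> = (\<Sum>b\<in>base D. int_scale (- int (d b)) b)"
    by (simp add: int_scale_minus_left sum_negf)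
  then have d: "s \<beta> \<gamma> = (\<Sum>b\<in>base D. int_scale (- int (d b)) b)" .
  have eq: "\<And>b. b \<in> base D \<Longrightarrow>
      int (c b) - (if b = \<beta> then pr \<gamma> (cor \<beta>) else 0) = - int (d b)"
    by (rule base_coeffs_unique[OF trans[OF sym[OF simple_reflection_coeffs[OF \<beta> c]] d]])
  have "c b = 0" if "b \<in> base D" "b \<noteq> \<beta>" for b using eq[OF that(1)] that by simp
  then have "\<gamma> = (\<Sum>b\<in>base D. if b = \<beta> then int_scale (int (c \<beta>)) \<beta> else 0)"
    unfolding c by (intro sum.cong) auto
  then have "int_scale 1 \<gamma> = int_scale (int (c \<beta>)) \<beta>" using \<beta> by (simp add: int_scale_one)
  then have "\<beta> = - \<gamma>" using reduced[OF R(2,1) one_neq_zero] ne by metis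
  then show False using base_pos[OF \<beta>] \<gamma> neg_pos_iff R by blast
qed

text \<open>The functional \<open>two_rho\<close> takes the value 2 on every simple coroot, so its sign on a coroot
  decides positivity.\<close>
definition two_rho :: 'x
  where "two_rho = (\<Sum>\<gamma>\<in>Rpos. \<gamma>)"

lemma pr_two_rho_simple:
  assumes \<beta>: "\<beta> \<in> base D"
  shows "pr two_rho (cor \<beta>) = 2"
proof -
  have R: "\<beta> \<in> R" using \<beta> base_subset by auto
  have sub: "s \<beta> ` (Rpos - {\<beta>}) \<subseteq> Rpos - {\<beta>}"
  proof
    fix x assume "x \<in> s \<beta> ` (Rpos - {\<beta>})"
    then obtain \<gamma> where \<gamma>: "\<gamma> \<in> Rpos" "\<gamma> \<noteq> \<beta>" "x = s \<beta> \<gamma>" by auto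
    have "x \<noteq> \<beta>"
    proof
      assume "x = \<beta>"
      then have "\<gamma> = - \<beta>" using \<gamma>(3) reflection_reflection[OF R, of \<gamma>] by (simp add: reflection_self R)
      then show False using \<gamma> base_pos[OF \<beta>] neg_pos_iff R by blast
    qed
    then show "x \<in> Rpos - {\<beta>}" using simple_reflection_pos[OF \<beta> \<gamma>(1,2)] \<gamma> by simp
  qed
  have perm: "s \<beta> ` (Rpos - {\<beta>}) = Rpos - {\<beta>}"
    using sub by (intro endo_inj_surj inj_reflection R) auto
  let ?\<sigma> = "\<Sum>\<gamma>\<in>Rpos - {\<beta>}. \<gamma>"
  have "s \<beta> ?\<sigma> = (\<Sum>\<gamma>\<in>Rpos - {\<beta>}. s \<beta> \<gamma>)"
    using additive.sum[OF additive_reflection] by fast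
  also have "\<dots> = ?\<sigma>"
    using sum.reindex[OF inj_reflection[OF R], of "\<lambda>x. x" "Rpos - {\<beta>}"] perm by simp
  finally have "pr ?\<sigma> (cor \<beta>) = 0" using pr_reflection_self[OF R, of ?\<sigma>] by simp
  moreover have "two_rho = \<beta> + ?\<sigma>"
    unfolding two_rho_def using base_pos[OF \<beta>] by (simp add: sum.remove)
  ultimately show ?thesis using R by (simp add: pr_simps pr_coroot_self)
qed

text \<open>Positivity is defined through roots, the order on coroots through coroots. The two agree by
  induction on the height of a root: a positive root has positive pairing with some simple coroot,
  and the corresponding reflection lowers its height.\<close>
lemma coroot_pos_in_nat_span:
  assumes "\<gamma> \<in> Rpos"
  shows "cor \<gamma> \<in> nat_span (cor ` base D)"
proof -
  have "cor \<gamma> \<in> nat_span (cor ` base D)"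
    if "\<gamma> \<in> Rpos" "\<gamma> = (\<Sum>b\<in>base D. int_scale (int (c b)) b)" for c
    using that
  proof (induction "\<Sum>b\<in>base D. c b" arbitrary: \<gamma> c rule: less_induct)
    case less
    have R: "\<gamma> \<in> R" using less.prems posD by blast
    have "bform \<gamma> \<gamma> = (\<Sum>b\<in>base D. int (c b) * bform \<gamma> b)"
      by (subst (2) less.prems(2))
        (simp add: additive.sum[OF additive_bform(1)] additive_int_scale[OF additive_bform(1)])
    then have "0 < (\<Sum>b\<in>base D. int (c b) * bform \<gamma> b)" using bform_pos[OF R] by simp
    then obtain \<beta> where \<beta>: "\<beta> \<in> base D" "0 < int (c \<beta>) * bform \<gamma> \<beta>"
      by (meson not_le sum_nonpos)
    then have "0 < bform \<gamma> \<beta>" by (simp add: zero_less_mult_iff)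
    moreover have \<beta>R: "\<beta> \<in> R" using \<beta> base_subset by auto
    ultimately have k: "0 < pr \<gamma> (cor \<beta>)" and j: "0 < pr \<beta> (cor \<gamma>)"
      using bform_root[OF R, of \<beta>] bform_root[OF \<beta>R, of \<gamma>] bform_pos[OF R] bform_pos[OF \<beta>R]
        bform_commute[of \<beta> \<gamma>] by (metis mult_pos_pos zero_less_mult_pos zero_less_numeral)+
    show ?case
    proof (cases "\<gamma> = \<beta>")
      case True
      then show ?thesis using \<beta> by (auto intro!: nat_span_base)
    next
      case False
      have pos: "s \<beta> \<gamma> \<in> Rpos" using simple_reflection_pos \<beta> less.prems False by blast
      then obtain d where d: "s \<beta> \<gamma> = (\<Sum>b\<in>base D. int_scale (int (d b)) b)"
        by (auto simp: pos_roots_def nat_span_def)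
      have eq: "\<And>b. b \<in> base D \<Longrightarrow>
          int (c b) - (if b = \<beta> then pr \<gamma> (cor \<beta>) else 0) = int (d b)"
        by (rule base_coeffs_unique[OF trans[OF sym[OF simple_reflection_coeffs[OF \<beta>(1) less.prems(2)]] d]])
      have "(\<Sum>b\<in>base D. d b) < (\<Sum>b\<in>base D. c b)"
      proof (rule sum_strict_mono_ex1)
        show "\<forall>x\<in>base D. d x \<le> c x"
        proof
          fix x assume "x \<in> base D"
          then show "d x \<le> c x" using eq[of x] k by (cases "x = \<beta>") auto
        qed
        show "\<exists>a\<in>base D. d a < c a" using eq[of \<beta>] \<beta> k by (intro bexI[of _ \<beta>]) auto
      qed simp
      then have "cor (s \<beta> \<gamma>) \<in> nat_span (cor ` base D)" using less.hyps pos d by blast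
      moreover have "int_scale (pr \<beta> (cor \<gamma>)) (cor \<beta>) \<in> nat_span (cor ` base D)"
        using j \<beta> by (intro nat_span_scale nat_span_base) auto
      ultimately have "cor (s \<beta> \<gamma>) + int_scale (pr \<beta> (cor \<gamma>)) (cor \<beta>) \<in> nat_span (cor ` base D)"
        by (rule nat_span_add)
      then show ?thesis using R \<beta>R by (simp add: coroot_reflection coreflection_def)
    qed
  qed
  then show ?thesis using assms by (auto simp: pos_roots_def nat_span_def)
qed

lemma pr_nat_span_nonneg:
  assumes "\<And>\<beta>. \<beta> \<in> base D \<Longrightarrow> 0 \<le> pr x (cor \<beta>)" "y \<in> nat_span (cor ` base D)"
  shows "0 \<le> pr x y"
  using assms by (auto simp: nat_span_def pr_sum_right pr_simps intro!: sum_nonneg)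

lemma pr_two_rho_nonpos_imp_zero:
  assumes "y \<in> nat_span (cor ` base D)" "pr two_rho y \<le> 0"
  shows "y = 0"
proof -
  obtain c where c: "y = (\<Sum>a\<in>cor ` base D. int_scale (int (c a)) a)"
    using assms by (auto simp: nat_span_def)
  have "pr two_rho y = (\<Sum>a\<in>cor ` base D. int (c a) * pr two_rho a)"
    by (simp add: c pr_sum_right pr_simps)
  also have "\<dots> = (\<Sum>a\<in>cor ` base D. int (c a) * 2)"
    by (intro sum.cong) (auto simp: pr_two_rho_simple)
  finally have "(\<Sum>a\<in>cor ` base D. int (c a) * 2) \<le> 0" using assms by simp
  moreover have "0 \<le> (\<Sum>a\<in>cor ` base D. int (c a) * 2)" by (intro sum_nonneg) simp
  ultimately have "(\<Sum>a\<in>cor ` base D. int (c a) * 2) = 0" by linarith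
  then have "\<forall>a\<in>cor ` base D. int (c a) * 2 = 0" by (subst (asm) sum_nonneg_eq_0_iff) auto
  then show ?thesis unfolding c by (intro sum.neutral) auto
qed

lemma pr_two_rho_pos_iff:
  assumes "\<gamma> \<in> R"
  shows "0 < pr two_rho (cor \<gamma>) \<longleftrightarrow> \<gamma> \<in> Rpos"
proof -
  have *: "0 < pr two_rho (cor \<delta>)" if "\<delta> \<in> Rpos" for \<delta>
    using pr_two_rho_nonpos_imp_zero[OF coroot_pos_in_nat_span[OF that]] coroot_nonzero posD[OF that]
    by force
  show ?thesis
    using *[of \<gamma>] *[of "- \<gamma>"] neg_pos_iff[OF assms] coroot_neg[OF assms] by (auto simp: pr_simps)
qed

lemma dominant_pr_nonneg: "dominant D x \<Longrightarrow> \<gamma> \<in> Rpos \<Longrightarrow> 0 \<le> pr x (cor \<gamma>)"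
  using pr_nat_span_nonneg coroot_pos_in_nat_span by (auto simp: dominant_def)

lemma ex_dominant_diff: "\<exists>y z. dominant D y \<and> dominant D z \<and> x = y - z"
proof -
  define N where "N = (\<Sum>\<beta>\<in>base D. \<bar>pr x (cor \<beta>)\<bar>)"
  let ?z = "int_scale N two_rho"
  have N: "0 \<le> N" by (auto simp: N_def intro: sum_nonneg)
  then have "dominant D ?z" by (simp add: dominant_def pr_simps pr_two_rho_simple)
  moreover have "dominant D (x + ?z)"
    unfolding dominant_def
  proof
    fix \<beta> assume \<beta>: "\<beta> \<in> base D"
    have "\<bar>pr x (cor \<beta>)\<bar> \<le> N" unfolding N_def by (rule member_le_sum) (use \<beta> in auto)
    then show "0 \<le> pr (x + ?z) (cor \<beta>)" using N \<beta> by (simp add: pr_simps pr_two_rho_simple)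
  qed
  ultimately show ?thesis by (intro exI[of _ "x + ?z"] exI[of _ ?z]) simp
qed

section \<open>Roots with minimal coroot\<close>

lemma min_rootD: "\<alpha> \<in> min_roots D \<Longrightarrow> \<alpha> \<in> R"
  by (simp add: min_roots_def)

lemma min_root_minimal:
  assumes "\<alpha> \<in> min_roots D" "\<gamma> \<in> R" "cor \<alpha> - cor \<gamma> \<in> nat_span (cor ` base D)"
  shows "\<gamma> = \<alpha>"
  using assms coroot_inj by (auto simp: min_roots_def coroot_le_def)

lemma min_root_not_minus:
  assumes "\<alpha> \<in> min_roots D" "\<gamma> \<in> R" "\<delta> \<in> Rpos" "0 < n" "cor \<gamma> = cor \<alpha> - int_scale n (cor \<delta>)"
  shows False
proof -
  have "int_scale n (cor \<delta>) \<in> nat_span (cor ` base D)"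
    using assms by (intro nat_span_scale coroot_pos_in_nat_span) auto
  then have "\<gamma> = \<alpha>" using assms by (intro min_root_minimal) auto
  then have "pr \<delta> (int_scale n (cor \<delta>)) = 0" using assms by (simp add: pr_simps)
  then show False using assms posD by (simp add: pr_simps pr_coroot_self)
qed

lemma min_root_neg: "\<alpha> \<in> min_roots D \<Longrightarrow> - \<alpha> \<in> Rpos"
proof (rule ccontr)
  assume \<alpha>: "\<alpha> \<in> min_roots D" and "- \<alpha> \<notin> Rpos"
  then have "\<alpha> \<in> Rpos" using neg_pos_iff min_rootD by blast
  moreover have "cor (- \<alpha>) = cor \<alpha> - int_scale 2 (cor \<alpha>)"
    using coroot_neg[OF min_rootD[OF \<alpha>]] coreflection_self[OF min_rootD[OF \<alpha>]]
    by (simp add: coreflection_def pr_coroot_self min_rootD[OF \<alpha>])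
  ultimately show False
    using min_root_not_minus[OF \<alpha> neg_root[OF min_rootD[OF \<alpha>]], of \<alpha> 2] by simp
qed

lemma min_root_pr_nonpos:
  assumes \<alpha>: "\<alpha> \<in> min_roots D" and \<gamma>: "\<gamma> \<in> Rpos"
  shows "pr \<alpha> (cor \<gamma>) \<le> 0"
proof -
  have R: "\<alpha> \<in> R" "\<gamma> \<in> R" using \<alpha> \<gamma> min_rootD posD by auto
  have "\<not> 0 < pr \<gamma> (cor \<alpha>)"
    using min_root_not_minus[OF \<alpha> reflection_in[OF R(2,1)] \<gamma>]
      coroot_reflection[OF R] by (auto simp: coreflection_def)
  then show ?thesis using pr_pos_iff R by force
qed

text \<open>The coroot of \<open>\<alpha>\<close> is the negative of a highest coroot, hence long, so its root pairs with other
  coroots to at most 1. Suppose \<open>k = (\<alpha>,\<gamma>\<^sup>\<or>) \<ge> 2\<close>; then \<open>(\<gamma>,\<alpha>\<^sup>\<or>) = 1\<close>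
  by the bound on products. The root \<open>\<delta> = s\<^sub>\<gamma>(\<alpha>)\<close> has coroot
  \<open>\<alpha>\<^sup>\<or> - \<gamma>\<^sup>\<or>\<close> and is negative by minimality, which forces \<open>k = 2\<close>. Then \<open>\<alpha>\<^sup>\<or> + \<delta>\<^sup>\<or> = - s\<^sub>\<alpha>\<^sup>\<or>(\<gamma>\<^sup>\<or>)\<close> is a coroot
  below \<open>\<alpha>\<^sup>\<or>\<close>, a contradiction.\<close>
lemma min_root_pr_le_one:
  assumes \<alpha>: "\<alpha> \<in> min_roots D" and \<gamma>: "\<gamma> \<in> R" "\<gamma> \<noteq> \<alpha>"
  shows "pr \<alpha> (cor \<gamma>) \<le> 1"
proof (rule ccontr)
  have \<alpha>R: "\<alpha> \<in> R" using \<alpha> min_rootD by auto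
  assume "\<not> ?thesis"
  then have k: "2 \<le> pr \<alpha> (cor \<gamma>)" by simp
  then have j: "1 \<le> pr \<gamma> (cor \<alpha>)" using pr_pos_iff[OF \<alpha>R \<gamma>(1)] by auto
  have "\<gamma> \<noteq> - \<alpha>" using k \<alpha>R by (auto simp: coroot_neg pr_simps pr_coroot_self)
  then have "pr \<alpha> (cor \<gamma>) * pr \<gamma> (cor \<alpha>) \<le> 3" using pr_product_le \<alpha>R \<gamma> by blast
  moreover have "2 * 2 \<le> pr \<alpha> (cor \<gamma>) * pr \<gamma> (cor \<alpha>)" if "2 \<le> pr \<gamma> (cor \<alpha>)"
    using that k by (intro mult_mono) auto
  ultimately have j1: "pr \<gamma> (cor \<alpha>) = 1" using j by force
  define \<delta> where "\<delta> = s \<gamma> \<alpha>"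
  have \<delta>: "\<delta> \<in> R" "cor \<delta> = cor \<alpha> - cor \<gamma>"
    using \<alpha>R \<gamma> j1 by (simp_all add: \<delta>_def reflection_in coroot_reflection coreflection_def int_scale_one)
  have "\<delta> \<notin> Rpos"
    using min_root_not_minus[OF \<alpha> \<gamma>(1), of \<delta> 1] \<delta> by (auto simp: int_scale_one)
  then have neg: "- \<delta> \<in> Rpos" using neg_pos_iff \<delta> by blast
  have "pr \<alpha> (cor (- \<delta>)) \<le> 0" using min_root_pr_nonpos \<alpha> neg by blast
  then have k2: "pr \<alpha> (cor \<gamma>) = 2"
    using k \<delta> \<alpha>R by (simp add: coroot_neg pr_simps pr_coroot_self)
  have "cor (- s \<alpha> \<gamma>) = cor \<alpha> - int_scale 1 (cor (- \<delta>))"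
    using \<alpha>R \<gamma> k2 \<delta> int_scale_add_left[of 1 1 "cor \<alpha>"]
    by (simp add: coroot_neg reflection_in coroot_reflection coreflection_def int_scale_one)
  then show False
    by (rule min_root_not_minus[OF \<alpha> neg_root[OF reflection_in[OF \<alpha>R \<gamma>(1)]] neg zero_less_one])
qed

lemma ex_min_root_below:
  assumes "\<gamma> \<in> R"
  shows "\<exists>\<alpha>\<in>min_roots D. cor \<gamma> - cor \<alpha> \<in> nat_span (cor ` base D)"
proof -
  let ?C = "{\<alpha>\<in>R. cor \<gamma> - cor \<alpha> \<in> nat_span (cor ` base D)}"
  have "finite ?C" "?C \<noteq> {}" using assms nat_span_zero by force+
  then obtain \<alpha> where \<alpha>: "\<alpha> \<in> ?C" and min: "\<And>\<delta>. \<delta> \<in> ?C \<Longrightarrow> pr two_rho (cor \<alpha>) \<le> pr two_rho (cor \<delta>)"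
    using ex_min_if_finite[of "(\<lambda>\<alpha>. pr two_rho (cor \<alpha>)) ` ?C"] by fastforce
  have "cor \<delta> = cor \<alpha>" if \<delta>: "\<delta> \<in> R" "cor \<alpha> - cor \<delta> \<in> nat_span (cor ` base D)" for \<delta>
  proof -
    have "cor \<gamma> - cor \<delta> \<in> nat_span (cor ` base D)"
      using nat_span_add[OF \<delta>(2), of "cor \<gamma> - cor \<alpha>"] \<alpha> by simp
    then have "pr two_rho (cor \<alpha> - cor \<delta>) \<le> 0" using min[of \<delta>] \<delta> by (simp add: pr_simps)
    then show ?thesis using pr_two_rho_nonpos_imp_zero[OF \<delta>(2)] by simp
  qed
  then have "c = cor \<alpha>" if "c \<in> cor ` R" "cor \<alpha> - c \<in> nat_span (cor ` base D)" for c
    using that by auto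
  then have "\<alpha> \<in> min_roots D"
    using \<alpha> bij_betw_imp_surj_on[OF bij_coroot] by (auto simp: min_roots_def coroot_le_def)
  then show ?thesis using \<alpha> by blast
qed

end

section \<open>The extended affine Weyl group\<close>
lemma group_GL: "group (GL :: ('x::ab_group_add \<Rightarrow> 'x) monoid)"
proof (rule groupI)
  fix f :: "'x \<Rightarrow> 'x" assume "f \<in> carrier GL"
  then have f: "bij f" "additive f" by (auto simp: GL_def)
  have "additive (inv_into UNIV f)"
  proof
    fix x y
    show "inv_into UNIV f (x + y) = inv_into UNIV f x + inv_into UNIV f y"
      by (rule inv_f_eq[OF bij_is_inj[OF f(1)]])
        (simp add: additive.add[OF f(2)] surj_f_inv_f[OF bij_is_surj[OF f(1)]])
  qed
  then show "\<exists>g\<in>carrier GL. g \<otimes>\<^bsub>GL\<^esub> f = \<one>\<^bsub>GL\<^esub>"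
    using f by (intro bexI[of _ "inv_into UNIV f"]) (auto simp: GL_def bij_imp_bij_inv bij_is_inj)
qed (auto simp: GL_def bij_comp additive_def o_assoc)

lemma GL_inv:
  assumes "f \<in> carrier GL"
  shows "inv\<^bsub>GL\<^esub> f = inv_into UNIV f"
proof -
  interpret GL: group GL by (rule group_GL)
  have surj: "surj f" using assms by (simp add: GL_def bij_is_surj)
  have inv: "inv\<^bsub>GL\<^esub> f \<circ> f = id" using GL.l_inv[OF assms] by (simp add: GL_def)
  show ?thesis
  proof
    fix x
    have "(inv\<^bsub>GL\<^esub> f \<circ> f) (inv_into UNIV f x) = inv_into UNIV f x" by (simp add: inv)
    then show "(inv\<^bsub>GL\<^esub> f) x = inv_into UNIV f x" by (simp add: surj_f_inv_f[OF surj])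
  qed
qed

context based_root_datum_ctx
begin

lemma reflection_GL: "\<alpha> \<in> R \<Longrightarrow> s \<alpha> \<in> carrier GL"
  using o_bij[of "s \<alpha>" "s \<alpha>"] reflection_reflection[of \<alpha>]
  by (auto simp: GL_def additive_reflection fun_eq_iff)

lemma inv_reflection: "\<alpha> \<in> R \<Longrightarrow> inv_into UNIV (s \<alpha>) = s \<alpha>"
  by (intro inv_unique_comp) (auto simp: fun_eq_iff reflection_reflection)

lemma fin_weyl_subgroup: "subgroup (fin_weyl D) GL"
  unfolding fin_weyl_def
  by (rule group.generate_is_subgroup[OF group_GL]) (auto simp: reflection_GL)

lemma reflection_fin_weyl: "\<alpha> \<in> R \<Longrightarrow> s \<alpha> \<in> fin_weyl D"
  unfolding fin_weyl_def by (rule generate.incl) simp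

lemma id_fin_weyl: "id \<in> fin_weyl D"
  using subgroup.one_closed[OF fin_weyl_subgroup] by (simp add: GL_def)

lemma comp_fin_weyl: "v \<in> fin_weyl D \<Longrightarrow> w \<in> fin_weyl D \<Longrightarrow> v \<circ> w \<in> fin_weyl D"
  using subgroup.m_closed[OF fin_weyl_subgroup] by (simp add: GL_def)

lemma fin_weyl_GL: "w \<in> fin_weyl D \<Longrightarrow> w \<in> carrier GL"
  using subgroup.subset[OF fin_weyl_subgroup] by blast

lemma inv_fin_weyl: "w \<in> fin_weyl D \<Longrightarrow> inv_into UNIV w \<in> fin_weyl D"
  using subgroup.m_inv_closed[OF fin_weyl_subgroup] fin_weyl_GL by (simp add: GL_inv)

lemma bij_fin_weyl: "w \<in> fin_weyl D \<Longrightarrow> bij w"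
  and additive_fin_weyl: "w \<in> fin_weyl D \<Longrightarrow> additive w"
  using fin_weyl_GL by (auto simp: GL_def)

lemma fin_weyl_inv_apply: "w \<in> fin_weyl D \<Longrightarrow> w (inv_into UNIV w x) = x"
  "w \<in> fin_weyl D \<Longrightarrow> inv_into UNIV w (w x) = x"
  using bij_fin_weyl by (simp_all add: bij_is_surj surj_f_inv_f bij_is_inj)

lemma fin_weyl_root_coroot:
  assumes "w \<in> fin_weyl D"
  shows "\<forall>\<alpha>\<in>R. w \<alpha> \<in> R \<and> (\<forall>x. pr (w x) (cor (w \<alpha>)) = pr x (cor \<alpha>))"
  using assms unfolding fin_weyl_def
proof (induction rule: generate.induct)
  case one
  then show ?case by (simp add: GL_def)
next
  case (incl h)
  then show ?case
    by (auto simp: reflection_in coroot_reflection pr_reflection coreflection_coreflection)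
next
  case (inv h)
  then show ?case
    by (auto simp: GL_inv reflection_GL inv_reflection reflection_in coroot_reflection
        pr_reflection coreflection_coreflection)
next
  case (eng h1 h2)
  then show ?case by (simp add: GL_def)
qed

lemma fin_weyl_root: "w \<in> fin_weyl D \<Longrightarrow> \<alpha> \<in> R \<Longrightarrow> w \<alpha> \<in> R"
  and pr_fin_weyl: "w \<in> fin_weyl D \<Longrightarrow> \<alpha> \<in> R \<Longrightarrow> pr (w x) (cor (w \<alpha>)) = pr x (cor \<alpha>)"
  using fin_weyl_root_coroot by blast+

lemma pr_inv_fin_weyl: 
  "w \<in> fin_weyl D \<Longrightarrow> \<alpha> \<in> R \<Longrightarrow> pr (inv_into UNIV w x) (cor \<alpha>) = pr x (cor (w \<alpha>))"
  using pr_fin_weyl[of w \<alpha> "inv_into UNIV w x"] by (simp add: fin_weyl_inv_apply)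

lemma fin_weyl_scale: "w \<in> fin_weyl D \<Longrightarrow> w (int_scale k x) = int_scale k (w x)"
  by (rule additive_int_scale[OF additive_fin_weyl])

lemma fin_weyl_minus: "w \<in> fin_weyl D \<Longrightarrow> w (- x) = - w x"
  by (rule additive.minus[OF additive_fin_weyl])

lemma reflection_conj: "w \<in> fin_weyl D \<Longrightarrow> \<alpha> \<in> R \<Longrightarrow> s (w \<alpha>) (w x) = w (s \<alpha> x)"
  by (simp add: reflection_def pr_fin_weyl additive.diff[OF additive_fin_weyl] fin_weyl_scale)

lemma weyl_simps [simp]:
  "carrier (weyl D) = fin_weyl D \<times> UNIV"
  "(v, x) \<otimes>\<^bsub>weyl D\<^esub> (w, y) = (v \<circ> w, inv_into UNIV w x + y)"
  "\<one>\<^bsub>weyl D\<^esub> = (id, 0)"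
  by (simp_all add: weyl_def)

lemma group_weyl: "group (weyl D)"
proof (rule groupI)
  fix g h k assume "g \<in> carrier (weyl D)" "h \<in> carrier (weyl D)" "k \<in> carrier (weyl D)"
  then show "g \<otimes>\<^bsub>weyl D\<^esub> h \<otimes>\<^bsub>weyl D\<^esub> k = g \<otimes>\<^bsub>weyl D\<^esub> (h \<otimes>\<^bsub>weyl D\<^esub> k)"
    by (auto simp: o_assoc o_inv_distrib bij_fin_weyl add.assoc
        additive.add[OF additive_fin_weyl[OF inv_fin_weyl]])
next
  fix g assume "g \<in> carrier (weyl D)"
  then obtain w x where g: "g = (w, x)" "w \<in> fin_weyl D" by auto
  then have "(inv_into UNIV w, - w x) \<otimes>\<^bsub>weyl D\<^esub> g = \<one>\<^bsub>weyl D\<^esub>"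
    by (auto simp: bij_is_inj bij_fin_weyl fin_weyl_inv_apply
        additive.minus[OF additive_fin_weyl[OF inv_fin_weyl]])
  then show "\<exists>h\<in>carrier (weyl D). h \<otimes>\<^bsub>weyl D\<^esub> g = \<one>\<^bsub>weyl D\<^esub>"
    using g inv_fin_weyl by (intro bexI[of _ "(inv_into UNIV w, - w x)"]) auto
qed (auto simp: comp_fin_weyl id_fin_weyl additive.zero[OF additive_fin_weyl[OF inv_fin_weyl]])

section \<open>Affine roots\<close>

text \<open>The pair \<open>(\<gamma>, m)\<close> stands for the affine function \<open>x \<mapsto> (x,\<gamma>\<^sup>\<or>) + m\<close> on \<open>X\<close>, and \<open>aact\<close> is the action
  induced by \<open>w e\<^sup>x\<close> acting on \<open>X\<close> as translation by \<open>x\<close> followed by \<open>w\<close>. With these signs the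
  simple affine reflections are exactly the elements \<open>s\<^sub>\<beta>\<close> and \<open>s\<^sub>\<alpha>e\<^sup>\<alpha>\<close> of \<open>S\<close>.\<close>
definition aroots :: "('x \<times> int) set"
  where "aroots = R \<times> UNIV"

definition aact :: "'x weyl_elt \<Rightarrow> 'x \<times> int \<Rightarrow> 'x \<times> int"
  where "aact g a = (fst g (fst a), snd a - pr (snd g) (cor (fst a)))"

definition apos :: "('x \<times> int) set"
  where "apos = {(\<gamma>, m). \<gamma> \<in> R \<and> (0 < m \<or> m = 0 \<and> \<gamma> \<in> Rpos)}"

definition aneg :: "'x \<times> int \<Rightarrow> 'x \<times> int"
  where "aneg a = (- fst a, - snd a)"

definition arefl :: "'x \<times> int \<Rightarrow> 'x weyl_elt"
  where "arefl a = (s (fst a), int_scale (snd a) (fst a))"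

definition asimples :: "('x \<times> int) set"
  where "asimples = (\<lambda>\<beta>. (\<beta>, 0)) ` base D \<union> (\<lambda>\<alpha>. (\<alpha>, 1)) ` min_roots D"

lemma aff_gens_eq: "aff_gens D = arefl ` asimples"
  by (auto simp: aff_gens_def asimples_def arefl_def int_scale_one image_Un image_image)

text \<open>With this bound, positivity of an affine root becomes positivity of the single linear
  functional \<open>height_bound * m + (two_rho, \<gamma>\<^sup>\<or>)\<close>, whose values at coroots add up along linear relations.\<close>
definition height_bound :: int
  where "height_bound = 1 + (\<Sum>\<gamma>\<in>R. \<bar>pr two_rho (cor \<gamma>)\<bar>)"

lemma apos_iff:
  assumes "\<gamma> \<in> R"
  shows "(\<gamma>, m) \<in> apos \<longleftrightarrow> 0 < height_bound * m + pr two_rho (cor \<gamma>)"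
proof -
  have "\<bar>pr two_rho (cor \<gamma>)\<bar> \<le> (\<Sum>\<gamma>\<in>R. \<bar>pr two_rho (cor \<gamma>)\<bar>)"
    by (rule member_le_sum) (use assms in auto)
  then have b: "\<bar>pr two_rho (cor \<gamma>)\<bar> < height_bound" by (simp add: height_bound_def)
  consider "0 < m" | "m = 0" | "m < 0" by linarith
  then show ?thesis
  proof cases
    case 1
    then have "height_bound * 1 \<le> height_bound * m" using b by (intro mult_left_mono) auto
    then have "0 < height_bound * m + pr two_rho (cor \<gamma>)" using b by linarith
    then show ?thesis using 1 assms by (simp add: apos_def)
  next
    case 2
    then show ?thesis using assms by (simp add: apos_def pr_two_rho_pos_iff)
  next
    case 3
    then have "height_bound * m \<le> height_bound * (- 1)" using b by (intro mult_left_mono) auto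
    then have "\<not> 0 < height_bound * m + pr two_rho (cor \<gamma>)" using b by linarith
    then show ?thesis using 3 assms by (simp add: apos_def)
  qed
qed

lemma aact_closed: "g \<in> carrier (weyl D) \<Longrightarrow> a \<in> aroots \<Longrightarrow> aact g a \<in> aroots"
  by (auto simp: aact_def aroots_def fin_weyl_root)

lemma aneg_apos_iff: "a \<in> aroots \<Longrightarrow> aneg a \<in> apos \<longleftrightarrow> a \<notin> apos"
  by (cases a; cases "snd a = 0") (auto simp: aneg_def apos_def aroots_def neg_root neg_pos_iff)

lemma aact_aneg: "g \<in> carrier (weyl D) \<Longrightarrow> a \<in> aroots \<Longrightarrow> aact g (aneg a) = aneg (aact g a)"
  by (auto simp: aact_def aneg_def aroots_def fin_weyl_minus coroot_neg pr_simps)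

text \<open>For \<open>a = (\<alpha>, 1)\<close> with minimal coroot, \<open>(\<gamma>, m)\<close> goes to \<open>(s\<^sub>\<alpha>(\<gamma>), m - (\<alpha>,\<gamma>\<^sup>\<or>))\<close>. For \<open>\<gamma> \<noteq> \<alpha>\<close>
  the bounds \<open>min_root_pr_nonpos\<close> and \<open>min_root_pr_le_one\<close> leave only \<open>m = (\<alpha>,\<gamma>\<^sup>\<or>) \<in> {0, 1}\<close> to be
  examined, and minimality of \<open>\<alpha>\<^sup>\<or>\<close> settles these.\<close>
lemma aact_arefl_simple:
  assumes a: "a \<in> asimples" and b: "b \<in> apos" and ne: "b \<noteq> a"
  shows "aact (arefl a) b \<in> apos"
proof -
  obtain \<gamma> m where bb: "b = (\<gamma>, m)" "\<gamma> \<in> R" "0 < m \<or> m = 0 \<and> \<gamma> \<in> Rpos"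
    using b by (auto simp: apos_def)
  from a consider (fin) \<beta> where "\<beta> \<in> base D" "a = (\<beta>, 0)"
    | (aff) \<alpha> where "\<alpha> \<in> min_roots D" "a = (\<alpha>, 1)"
    by (auto simp: asimples_def)
  then show ?thesis
  proof cases
    case fin
    then have "\<beta> \<in> R" using base_subset by auto
    then show ?thesis
      using fin bb ne simple_reflection_pos[of \<beta> \<gamma>]
      by (auto simp: aact_def arefl_def apos_def reflection_in pr_simps)
  next
    case aff
    have \<alpha>R: "\<alpha> \<in> R" using aff min_rootD by auto
    have neg: "- \<alpha> \<in> Rpos" using aff min_root_neg by auto
    have eq: "aact (arefl a) b = (s \<alpha> \<gamma>, m - pr \<alpha> (cor \<gamma>))"
      by (simp add: aact_def arefl_def aff bb int_scale_one)
    have in_R: "s \<alpha> \<gamma> \<in> R" using \<alpha>R bb by (simp add: reflection_in)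
    have co: "cor (s \<alpha> \<gamma>) = cor \<gamma> - int_scale (pr \<alpha> (cor \<gamma>)) (cor \<alpha>)"
      using \<alpha>R bb by (simp add: coroot_reflection coreflection_def)
    show ?thesis
    proof (cases "\<gamma> = \<alpha>")
      case True
      have "\<alpha> \<notin> Rpos" using neg neg_pos_iff \<alpha>R by blast
      then have "2 \<le> m" using bb aff ne True by auto
      then show ?thesis
        using eq True neg \<alpha>R by (auto simp: apos_def reflection_self pr_coroot_self neg_root)
    next
      case False
      have le: "pr \<alpha> (cor \<gamma>) \<le> 1" using min_root_pr_le_one aff bb False by blast
      have pos0: "s \<alpha> \<gamma> \<in> Rpos" if "m = 0" "pr \<alpha> (cor \<gamma>) = 0"
      proof -
        have "s \<alpha> \<gamma> = \<gamma>" using co that coroot_inj in_R bb by simp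
        then show ?thesis using bb that by simp
      qed
      have pos1: "s \<alpha> \<gamma> \<in> Rpos" if "m = 1" "pr \<alpha> (cor \<gamma>) = 1"
      proof (rule ccontr)
        assume "s \<alpha> \<gamma> \<notin> Rpos"
        then have n: "- s \<alpha> \<gamma> \<in> Rpos" using neg_pos_iff in_R by blast
        have "cor \<gamma> = cor \<alpha> - int_scale 1 (cor (- s \<alpha> \<gamma>))"
          using co that in_R by (simp add: coroot_neg int_scale_one)
        with min_root_not_minus[OF aff(1) bb(2) n zero_less_one] show False .
      qed
      have "pr \<alpha> (cor \<gamma>) \<le> 0" if "m = 0" using min_root_pr_nonpos aff bb that by auto
      then have "0 < m - pr \<alpha> (cor \<gamma>) \<or> m - pr \<alpha> (cor \<gamma>) = 0 \<and> s \<alpha> \<gamma> \<in> Rpos"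
        using le pos0 pos1 bb(3) by (smt (verit))
      then show ?thesis unfolding eq using in_R by (simp add: apos_def)
    qed
  qed
qed

text \<open>The functional never vanishes on affine roots, so strict and weak inequality are
  interchangeable: the strict form is what a hypothesis provides, the weak form what nonnegative combinations
  of simple coroots preserve.\<close>
lemma aact_pos_iff:
  assumes g: "g = (w, x)" "w \<in> fin_weyl D" and \<gamma>: "\<gamma> \<in> R"
  shows "aact g (\<gamma>, m) \<in> apos \<longleftrightarrow>
      0 < height_bound * m + pr (inv_into UNIV w two_rho - int_scale height_bound x) (cor \<gamma>)" (is ?A)
    and "aact g (\<gamma>, m) \<in> apos \<longleftrightarrow>
      0 \<le> height_bound * m + pr (inv_into UNIV w two_rho - int_scale height_bound x) (cor \<gamma>)" (is ?B)
proof -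
  let ?v = "\<lambda>\<gamma> m. height_bound * m + pr (inv_into UNIV w two_rho - int_scale height_bound x) (cor \<gamma>)"
  have *: "aact g (\<gamma>, m) \<in> apos \<longleftrightarrow> 0 < ?v \<gamma> m" if \<gamma>: "\<gamma> \<in> R" for \<gamma> m
    using g \<gamma> by (simp add: aact_def apos_iff fin_weyl_root pr_simps pr_inv_fin_weyl algebra_simps)
  show ?A by (rule *[OF \<gamma>])
  have "aact g (- \<gamma>, - m) = aneg (aact g (\<gamma>, m))"
    using aact_aneg[of g "(\<gamma>, m)"] g \<gamma> by (simp add: aneg_def aroots_def)
  then have "aact g (- \<gamma>, - m) \<in> apos \<longleftrightarrow> aact g (\<gamma>, m) \<notin> apos"
    using aneg_apos_iff aact_closed g \<gamma> by (auto simp: aroots_def)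
  then show ?B
    using *[OF \<gamma>, of m] *[OF neg_root[OF \<gamma>], of "- m"] \<gamma> by (auto simp: coroot_neg pr_simps)
qed

text \<open>For \<open>m \<ge> 1\<close> choose a minimal coroot \<open>\<alpha>\<^sup>\<or>\<close> below \<open>\<gamma>\<^sup>\<or>\<close>: then \<open>(\<gamma>, m)\<close> is \<open>(\<alpha>, 1)\<close> plus a nonnegative
  combination of simple coroots and of the constant function 1, which the group fixes.\<close>
lemma apos_if_asimples_apos:
  assumes g: "g \<in> carrier (weyl D)" and simple: "\<And>a. a \<in> asimples \<Longrightarrow> aact g a \<in> apos"
    and b: "b \<in> apos"
  shows "aact g b \<in> apos"
proof -
  obtain w x where wx: "g = (w, x)" "w \<in> fin_weyl D" using g by auto
  obtain \<gamma> m where bb: "b = (\<gamma>, m)" "\<gamma> \<in> R" "0 < m \<or> m = 0 \<and> \<gamma> \<in> Rpos"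
    using b by (auto simp: apos_def)
  let ?z = "inv_into UNIV w two_rho - int_scale height_bound x"
  have base: "0 \<le> pr ?z (cor \<beta>)" if "\<beta> \<in> base D" for \<beta>
    using aact_pos_iff(1)[OF wx, of \<beta> 0] simple[of "(\<beta>, 0)"] that base_subset
    by (auto simp: asimples_def)
  have mini: "0 < height_bound + pr ?z (cor \<alpha>)" if "\<alpha> \<in> min_roots D" for \<alpha>
    using aact_pos_iff(1)[OF wx, of \<alpha> 1] simple[of "(\<alpha>, 1)"] that min_rootD
    by (auto simp: asimples_def)
  have hb: "0 \<le> height_bound" by (simp add: height_bound_def sum_nonneg)
  have "0 \<le> height_bound * m + pr ?z (cor \<gamma>)"
  proof (cases "m = 0")
    case True
    then have "\<gamma> \<in> Rpos" using bb by simp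
    then have "0 \<le> pr ?z (cor \<gamma>)"
      by (intro pr_nat_span_nonneg[OF base] coroot_pos_in_nat_span)
    then show ?thesis using True by simp
  next
    case False
    then have m: "1 \<le> m" using bb by auto
    obtain \<alpha> where \<alpha>: "\<alpha> \<in> min_roots D" "cor \<gamma> - cor \<alpha> \<in> nat_span (cor ` base D)"
      using ex_min_root_below bb by blast
    have "0 \<le> pr ?z (cor \<gamma> - cor \<alpha>)" by (rule pr_nat_span_nonneg[OF base \<alpha>(2)])
    then have "pr ?z (cor \<alpha>) \<le> pr ?z (cor \<gamma>)" by (simp add: pr_diff_right)
    moreover have "height_bound * 1 \<le> height_bound * m" using m hb by (rule mult_left_mono)
    ultimately show ?thesis using mini[OF \<alpha>(1)] by linarith
  qed
  then show ?thesis using aact_pos_iff(2)[OF wx bb(2)] bb by simp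
qed

section \<open>The length function counts inversions\<close>

text \<open>The inversions of \<open>w e\<^sup>x\<close> lying over \<open>\<gamma>\<close> and \<open>- \<gamma>\<close>, for \<open>\<gamma>\<close> positive, have second components in two
  intervals at most one of which is nonempty; their sizes add up to the summand \<open>\<bar>(x,\<gamma>\<^sup>\<or>)\<bar>\<close> or \<open>\<bar>1 + (x,\<gamma>\<^sup>\<or>)\<bar>\<close>
  of the length formula.\<close>
lemma affine_inversions:
  fixes x :: 'x
  assumes w: "w \<in> fin_weyl D"
  defines "A \<equiv> \<lambda>\<gamma>. if w \<gamma> \<in> Rpos then {0..<pr x (cor \<gamma>)} else {0..pr x (cor \<gamma>)}"
    and "B \<equiv> \<lambda>\<gamma>. if w \<gamma> \<in> Rpos then {1..- pr x (cor \<gamma>)} else {1..<- pr x (cor \<gamma>)}"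
  shows "{b \<in> apos. aact (w, x) b \<notin> apos} =
    Sigma Rpos A \<union> (\<lambda>(\<gamma>, m). (- \<gamma>, m)) ` Sigma Rpos B" (is "?I = ?S \<union> ?T")
proof (rule Set.set_eqI)
  fix b :: "'x \<times> int"
  obtain \<gamma> m where b: "b = (\<gamma>, m)" by (cases b)
  show "b \<in> ?I \<longleftrightarrow> b \<in> ?S \<union> ?T"
  proof (cases "\<gamma> \<in> R")
    case False
    then show ?thesis using b neg_root posD by (force simp: apos_def)
  next
    case True
    have T: "b \<in> ?T \<longleftrightarrow> - \<gamma> \<in> Rpos \<and> m \<in> B (- \<gamma>)"
      unfolding b by (force simp: image_iff)
    have wn: "w (- \<gamma>) \<in> Rpos \<longleftrightarrow> w \<gamma> \<notin> Rpos"
      using w True by (simp add: fin_weyl_minus neg_pos_iff fin_weyl_root)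
    show ?thesis
      using True w wn unfolding Un_iff T
      by (cases "\<gamma> \<in> Rpos")
        (auto simp: b A_def B_def apos_def aact_def fin_weyl_root neg_pos_iff coroot_neg pr_simps)
  qed
qed

lemma weyl_length_sum:
  assumes w: "w \<in> fin_weyl D"
  shows "weyl_length D (w, x) =
    nat (\<Sum>\<gamma>\<in>Rpos. if w \<gamma> \<in> Rpos then \<bar>pr x (cor \<gamma>)\<bar> else \<bar>1 + pr x (cor \<gamma>)\<bar>)"
proof -
  have "{\<gamma>\<in>Rpos. w \<gamma> \<in> neg_roots D} = {\<gamma>\<in>Rpos. w \<gamma> \<notin> Rpos}"
    using w neg_roots_iff fin_weyl_root posD by blast
  then show ?thesis by (simp add: sum.If_cases Int_def Compl_eq)
qed

lemma card_affine_inversions: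
  assumes w: "w \<in> fin_weyl D"
  shows "finite {b \<in> apos. aact (w, x) b \<notin> apos}"
    and "card {b \<in> apos. aact (w, x) b \<notin> apos} = weyl_length D (w, x)"
proof -
  define A where "A = (\<lambda>\<gamma>. if w \<gamma> \<in> Rpos then {0..<pr x (cor \<gamma>)} else {0..pr x (cor \<gamma>)})"
  define B where "B = (\<lambda>\<gamma>. if w \<gamma> \<in> Rpos then {1..- pr x (cor \<gamma>)} else {1..<- pr x (cor \<gamma>)})"
  let ?n = "\<lambda>(\<gamma>, m). (- \<gamma>, m :: int)"
  let ?L = "\<lambda>\<gamma>. if w \<gamma> \<in> Rpos then \<bar>pr x (cor \<gamma>)\<bar> else \<bar>1 + pr x (cor \<gamma>)\<bar>"
  have I: "{b \<in> apos. aact (w, x) b \<notin> apos} = Sigma Rpos A \<union> ?n ` Sigma Rpos B"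
    unfolding A_def B_def by (rule affine_inversions[OF w])
  have fin: "finite (A \<gamma>)" "finite (B \<gamma>)" for \<gamma> by (simp_all add: A_def B_def)
  then have fS: "finite (Sigma Rpos A)" "finite (Sigma Rpos B)" by auto
  then show "finite {b \<in> apos. aact (w, x) b \<notin> apos}" unfolding I by simp
  have disj: "Sigma Rpos A \<inter> ?n ` Sigma Rpos B = {}"
    using neg_pos_iff posD by auto
  have inj: "inj_on ?n (Sigma Rpos B)" by (auto simp: inj_on_def)
  have "card {b \<in> apos. aact (w, x) b \<notin> apos} = card (Sigma Rpos A) + card (Sigma Rpos B)"
    unfolding I using fS disj inj by (subst card_Un_disjoint) (auto simp: card_image)
  also have "\<dots> = (\<Sum>\<gamma>\<in>Rpos. card (A \<gamma>)) + (\<Sum>\<gamma>\<in>Rpos. card (B \<gamma>))"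
    using fin by simp
  also have "\<dots> = (\<Sum>\<gamma>\<in>Rpos. nat (?L \<gamma>))"
    unfolding sum.distrib[symmetric] by (intro sum.cong) (auto simp: A_def B_def)
  also have "\<dots> = nat (int (\<Sum>\<gamma>\<in>Rpos. nat (?L \<gamma>)))" by (simp only: nat_int)
  also have "int (\<Sum>\<gamma>\<in>Rpos. nat (?L \<gamma>)) = (\<Sum>\<gamma>\<in>Rpos. ?L \<gamma>)"
    unfolding of_nat_sum by (intro sum.cong) auto
  finally show "card {b \<in> apos. aact (w, x) b \<notin> apos} = weyl_length D (w, x)"
    by (simp only: weyl_length_sum[OF w])
qed

end

sublocale based_root_datum_ctx \<subseteq> W: root_action "weyl D" aact aroots apos aneg arefl asimples
proof (intro root_action.intro root_action_axioms.intro group_weyl)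
  fix g a assume g: "g \<in> carrier (weyl D)" and a: "a \<in> aroots"
  interpret group "weyl D" by (rule group_weyl)
  show "aact g a \<in> aroots" using g a by (rule aact_closed)
  show "aact g (aneg a) = aneg (aact g a)" using g a by (rule aact_aneg)
  obtain v x where gg: "g = (v, x)" "v \<in> fin_weyl D" using g by auto
  obtain \<alpha> k where aa: "a = (\<alpha>, k)" "\<alpha> \<in> R" using a by (auto simp: aroots_def)
  have "s (v \<alpha>) \<circ> v = v \<circ> s \<alpha>" using gg aa by (simp add: fun_eq_iff reflection_conj)
  moreover have "inv_into UNIV v (int_scale (k - pr x (cor \<alpha>)) (v \<alpha>)) + x =
    s \<alpha> x + int_scale k \<alpha>"
    using gg aa fin_weyl_scale[OF inv_fin_weyl, of v "k - pr x (cor \<alpha>)" "v \<alpha>"]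
    by (simp only: fin_weyl_inv_apply) (simp add: reflection_def int_module.scale_left_diff_distrib)
  ultimately have "arefl (aact g a) \<otimes>\<^bsub>weyl D\<^esub> g = g \<otimes>\<^bsub>weyl D\<^esub> arefl a"
    using gg aa by (simp add: arefl_def aact_def inv_reflection)
  moreover have "arefl (aact g a) \<in> carrier (weyl D)" "arefl a \<in> carrier (weyl D)"
    using gg aa by (auto simp: arefl_def aact_def reflection_fin_weyl fin_weyl_root)
  ultimately show "arefl (aact g a) = g \<otimes>\<^bsub>weyl D\<^esub> arefl a \<otimes>\<^bsub>weyl D\<^esub> inv\<^bsub>weyl D\<^esub> g"
    using g inv_solve_right m_closed by metis
next
  fix g h a assume "g \<in> carrier (weyl D)" "h \<in> carrier (weyl D)" "a \<in> aroots"
  then show "aact (g \<otimes>\<^bsub>weyl D\<^esub> h) a = aact g (aact h a)"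
    by (auto simp: aact_def aroots_def pr_add_left pr_inv_fin_weyl)
next
  fix g assume "g \<in> carrier (weyl D)"
  then show "finite {b \<in> apos. aact g b \<notin> apos}"
    using card_affine_inversions by auto
next
  fix a assume a: "a \<in> aroots"
  show "aact \<one>\<^bsub>weyl D\<^esub> a = a" by (simp add: aact_def pr_zero_left)
  show "aneg a \<in> apos \<longleftrightarrow> a \<notin> apos" using a by (rule aneg_apos_iff)
  show "arefl a \<in> carrier (weyl D)"
    using a reflection_fin_weyl by (auto simp: arefl_def aroots_def)
  show "arefl a \<otimes>\<^bsub>weyl D\<^esub> arefl a = \<one>\<^bsub>weyl D\<^esub>"
    using a by (auto simp: arefl_def aroots_def fun_eq_iff reflection_reflection inv_reflection
        additive_int_scale[OF additive_reflection] reflection_self int_module.scale_minus_right)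
  show "aact (arefl a) a = aneg a"
    using a by (auto simp: aact_def arefl_def aneg_def aroots_def reflection_self pr_scale_left
        pr_coroot_self)
next
  show "apos \<subseteq> aroots" by (auto simp: apos_def aroots_def)
  show "asimples \<subseteq> apos"
    using base_pos base_subset min_rootD by (auto simp: asimples_def apos_def)
qed (fact aact_arefl_simple apos_if_asimples_apos)+

context based_root_datum_ctx
begin

lemma weyl_length_eq: "g \<in> carrier (weyl D) \<Longrightarrow> weyl_length D g = W.len g"
  using card_affine_inversions(2)[of "fst g" "snd g"]
  by (cases g) (simp add: W.len_def W.inversions_def)

lemma Omega_eq: "Omega D = {u \<in> carrier (weyl D). W.len u = 0}"
  using weyl_length_eq unfolding Omega_def by auto

lemma word_prod_arefl: "word_prod D (map arefl as) = W.wprod as"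
  by (simp add: word_prod_def W.wprod_def foldr_map comp_def)

lemma aff_gens_words: "set ss \<subseteq> aff_gens D \<longleftrightarrow> (\<exists>as. set as \<subseteq> asimples \<and> ss = map arefl as)"
proof
  assume "set ss \<subseteq> aff_gens D"
  then show "\<exists>as. set as \<subseteq> asimples \<and> ss = map arefl as"
  proof (induction ss)
    case (Cons x ss)
    then obtain as a where "set as \<subseteq> asimples" "ss = map arefl as" "a \<in> asimples" "x = arefl a"
      by (auto simp: aff_gens_eq)
    then show ?case by (intro exI[of _ "a # as"]) simp
  qed simp
next
  assume "\<exists>as. set as \<subseteq> asimples \<and> ss = map arefl as"
  then obtain as where "set as \<subseteq> asimples" "ss = map arefl as" by blast
  then show "set ss \<subseteq> aff_gens D" by (simp add: aff_gens_eq image_mono)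
qed

lemma reduced_word_iff:
  assumes "set as \<subseteq> asimples"
  shows "reduced_word D (map arefl as) \<longleftrightarrow> length as = W.len (W.wprod as)"
proof -
  have le: "W.len (W.wprod bs) \<le> length bs" if "set bs \<subseteq> asimples" for bs
    using W.len_word[OF W.one_closed W.len_one that] W.wprod_closed[of bs] W.simples_Rts that
    by (metis W.l_one subset_trans)
  show ?thesis
  proof
    assume red: "reduced_word D (map arefl as)"
    obtain bs where bs: "set bs \<subseteq> asimples" "W.wprod bs = W.wprod as" "length bs = W.len (W.wprod as)"
      using W.word_reduce[OF assms] by blast
    have "set (map arefl bs) \<subseteq> aff_gens D \<and> word_prod D (map arefl bs) = word_prod D (map arefl as)"
      using bs by (auto simp: word_prod_arefl aff_gens_eq)
    then have "length (map arefl as) \<le> length (map arefl bs)"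
      using red unfolding reduced_word_def by blast
    then show "length as = W.len (W.wprod as)" using bs le[OF assms] by simp
  next
    assume len: "length as = W.len (W.wprod as)"
    have "length as \<le> length ts"
      if ts: "set ts \<subseteq> aff_gens D" "word_prod D ts = W.wprod as" for ts
    proof -
      obtain bs where "set bs \<subseteq> asimples" "ts = map arefl bs"
        using ts(1) unfolding aff_gens_words by blast
      then show ?thesis using ts(2) le[of bs] len by (simp add: word_prod_arefl)
    qed
    then show "reduced_word D (map arefl as)"
      using assms unfolding reduced_word_def by (auto simp: word_prod_arefl aff_gens_eq)
  qed
qed

lemma wprod_aff_weyl: "set as \<subseteq> aroots \<Longrightarrow> W.wprod as \<in> aff_weyl D"
proof (induction as)
  case Nil
  then show ?case by (simp add: aff_weyl_def id_fin_weyl int_module.span_zero)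
next
  case (Cons a as)
  then obtain w y where wy: "W.wprod as = (w, y)" "w \<in> fin_weyl D" "y \<in> int_module.span R"
    by (auto simp: aff_weyl_def)
  obtain \<alpha> k where a: "a = (\<alpha>, k)" "\<alpha> \<in> R" using Cons.prems by (auto simp: aroots_def)
  have "inv_into UNIV w \<alpha> \<in> R" using wy a by (simp add: inv_fin_weyl fin_weyl_root)
  then have "inv_into UNIV w (int_scale k \<alpha>) + y \<in> int_module.span R"
    using wy by (simp add: fin_weyl_scale[OF inv_fin_weyl] int_module.span_add
        int_module.span_scale int_module.span_base)
  then show ?case
    unfolding W.wprod_Cons wy(1)
    using wy a by (simp add: arefl_def aff_weyl_def comp_fin_weyl reflection_fin_weyl)
qed

text \<open>Words that are shortest among those with the same product are the words as long as the
  inversion set of their product is large. Hence the factorization by descents is one into an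
  element of \<open>\<Omega>\<close> and a reduced word.\<close>
lemma reduced_decomposition:
  assumes "g \<in> carrier (weyl D)"
  obtains u as where "u \<in> carrier (weyl D)" "W.len u = 0" "set as \<subseteq> asimples"
    "g = u \<otimes>\<^bsub>weyl D\<^esub> W.wprod as" "length as = W.len g" "reduced_word D (map arefl as)"
proof -
  obtain u as where u: "u \<in> carrier (weyl D)" "W.len u = 0" "set as \<subseteq> asimples"
    "g = u \<otimes>\<^bsub>weyl D\<^esub> W.wprod as" "length as = W.len g"
    using W.decomposition[OF assms] by blast
  have cl: "W.wprod as \<in> carrier (weyl D)" using u W.simples_Rts by (intro W.wprod_closed) auto
  have "W.len g \<le> W.len (W.wprod as)" using W.len_mult_le[OF u(1) cl] u by simp
  moreover have "W.len (W.wprod as) \<le> length as"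
    using W.len_word[OF W.one_closed W.len_one u(3)] W.l_one[OF cl] by simp
  ultimately have "reduced_word D (map arefl as)" using u by (simp add: reduced_word_iff)
  with u that show thesis by blast
qed

lemma below_imp_bruhat_less:
  assumes "W.below h g"
  shows "bruhat_less D h g"
proof -
  obtain u as where u: "u \<in> carrier (weyl D)" "W.len u = 0" "set as \<subseteq> asimples"
    "g = u \<otimes>\<^bsub>weyl D\<^esub> W.wprod as" "reduced_word D (map arefl as)"
    using reduced_decomposition W.below_carrier assms by metis
  obtain bs where bs: "subseq bs as" "h = u \<otimes>\<^bsub>weyl D\<^esub> W.wprod bs"
    using W.below_subword[OF assms u(1-4)] by blast
  have "set as \<subseteq> aroots" using u(3) W.simples_Rts by blast
  moreover have "set bs \<subseteq> aroots" using calculation set_subseq[OF bs(1)] by blast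
  ultimately have "W.wprod as \<in> aff_weyl D" "W.wprod bs \<in> aff_weyl D" by (auto intro: wprod_aff_weyl)
  moreover have "aff_bruhat_le D (W.wprod bs) (W.wprod as)"
    unfolding aff_bruhat_le_def
  proof (intro exI conjI bexI)
    show "map arefl bs \<in> set (subseqs (map arefl as))" using bs by (simp add: subseq_map)
  qed (simp_all add: u word_prod_arefl)
  moreover have "u \<in> Omega D" using u by (simp add: Omega_eq)
  ultimately have "bruhat_le D h g" using bs u unfolding bruhat_le_def by blast
  moreover have "h \<noteq> g" using W.below_len[OF assms] by auto
  ultimately show ?thesis by (simp add: bruhat_less_def)
qed

end

section \<open>Triangular bases\<close>

lemma (in module) span_image_sum:
  assumes "x \<in> span (b ` J)"
  shows "\<exists>F a. finite F \<and> F \<subseteq> J \<and> inj_on b F \<and> x = (\<Sum>v\<in>F. a v *s b v)"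
proof -
  obtain t r where t: "finite t" "t \<subseteq> b ` J" "x = (\<Sum>a\<in>t. r a *s a)"
    using assms by (auto simp: span_explicit)
  obtain F where F: "F \<subseteq> J" "t = b ` F" "inj_on b F"
    using t(2) by (auto simp: subset_image_inj)
  have "finite F" using t(1) F finite_imageD by blast
  moreover have "x = (\<Sum>v\<in>F. r (b v) *s b v)"
    using t(3) F by (simp add: sum.reindex)
  ultimately show ?thesis
    using F by (intro exI[of _ F] exI[of _ "\<lambda>v. r (b v)"]) simp
qed

text \<open>A basis element has no nonzero multiple in the span of the others; over a ring this has to
  be said for multiples.\<close>
lemma (in module) independent_image_coeff_zero:
  assumes indep: "\<not> dependent (b ` I)" and inj: "inj_on b I" and w: "w \<in> I"
    and c: "c *s b w \<in> span (b ` (I - {w}))"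
  shows "c = 0"
proof -
  obtain F a where F: "finite F" "F \<subseteq> I - {w}" "inj_on b F" "c *s b w = (\<Sum>v\<in>F. a v *s b v)"
    using span_image_sum[OF c] by blast
  define u where "u = (\<lambda>x. if x = b w then - c else a (the_inv_into F b x))"
  have ne: "b v \<noteq> b w" if "v \<in> F" for v using F(2) inj w that by (auto dest: inj_onD)
  then have wF: "b w \<notin> b ` F" by (metis imageE)
  have "(\<Sum>x\<in>b ` F. u x *s x) = (\<Sum>v\<in>F. u (b v) *s b v)" by (simp add: sum.reindex F(3))
  also have "\<dots> = (\<Sum>v\<in>F. a v *s b v)"
    using ne F(3) by (intro sum.cong) (auto simp: u_def the_inv_into_f_f)
  finally have "(\<Sum>x\<in>insert (b w) (b ` F). u x *s x) = 0"
    using F(1) wF by (simp add: u_def flip: F(4))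
  moreover have "insert (b w) (b ` F) \<subseteq> b ` I" "finite (insert (b w) (b ` F))"
    using F w by auto
  ultimately have "u (b w) = 0"
    using indep unfolding dependent_explicit by blast
  then show ?thesis by (simp add: u_def)
qed

text \<open>In a vanishing combination, a term \<open>E w0\<close> of maximal rank with nonzero coefficient would put a
  multiple of \<open>T w0\<close> into the span of the other \<open>T v\<close>.\<close>
lemma triangular_indexed_basis:
  fixes scale :: "'r::comm_ring_1 \<Rightarrow> 'a::ab_group_add \<Rightarrow> 'a" and rank :: "'i \<Rightarrow> nat"
  assumes "module scale" and T: "indexed_basis scale I T"
    and tri: "\<And>w. w \<in> I \<Longrightarrow> E w - T w \<in> module.span scale (T ` {v \<in> I. rank v < rank w})"
  shows "indexed_basis scale I E"
proof -
  interpret module scale by fact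
  have inj: "inj_on T I" and indep: "\<not> dependent (T ` I)" and span: "span (T ` I) = UNIV"
    using T by (auto simp: indexed_basis_def)
  have in_span: "E w \<in> span (T ` (I - {w0}))"
    if "w \<in> I" "rank w \<le> rank w0" "w \<noteq> w0" for w w0
  proof -
    have "T ` {v \<in> I. rank v < rank w} \<subseteq> T ` (I - {w0})" using that by auto
    then have "E w - T w \<in> span (T ` (I - {w0}))" using tri[OF that(1)] span_mono by blast
    moreover have "T w \<in> span (T ` (I - {w0}))" using that by (intro span_base) auto
    ultimately have "(E w - T w) + T w \<in> span (T ` (I - {w0}))" by (rule span_add)
    then show ?thesis by simp
  qed
  have family: "c w = 0"
    if G: "finite G" "G \<subseteq> I" "(\<Sum>v\<in>G. scale (c v) (E v)) = 0" "w \<in> G" for G c w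
  proof (rule ccontr)
    assume "c w \<noteq> 0"
    let ?G = "{v \<in> G. c v \<noteq> 0}"
    have fin: "finite ?G" "w \<in> ?G" using G \<open>c w \<noteq> 0\<close> by auto
    then have "Max (rank ` ?G) \<in> rank ` ?G" by (intro Max_in) auto
    then obtain w0 where w0: "w0 \<in> ?G" and "rank w0 = Max (rank ` ?G)" by auto
    then have max: "rank v \<le> rank w0" if "v \<in> ?G" for v
      using fin that by simp
    have w0I: "w0 \<in> I" using w0 G by auto
    have "(\<Sum>v\<in>?G. scale (c v) (E v)) = 0"
      using G by (subst sum.mono_neutral_cong_left[of G _ _ "\<lambda>v. scale (c v) (E v)"]) auto
    then have "scale (c w0) (E w0) = - (\<Sum>v\<in>?G - {w0}. scale (c v) (E v))"
      using sum.remove[OF fin(1) w0, of "\<lambda>v. scale (c v) (E v)"]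
      by (simp add: eq_neg_iff_add_eq_0)
    moreover have "(\<Sum>v\<in>?G - {w0}. scale (c v) (E v)) \<in> span (T ` (I - {w0}))"
      using G max by (intro span_sum span_scale in_span) auto
    ultimately have "scale (c w0) (E w0) \<in> span (T ` (I - {w0}))" by (simp add: span_neg)
    moreover have "E w0 - T w0 \<in> span (T ` (I - {w0}))"
    proof -
      have "T ` {v \<in> I. rank v < rank w0} \<subseteq> T ` (I - {w0})" by auto
      then show ?thesis using tri[OF w0I] span_mono by blast
    qed
    ultimately have "scale (c w0) (E w0) - scale (c w0) (E w0 - T w0) \<in> span (T ` (I - {w0}))"
      by (rule span_diff[OF _ span_scale])
    then have "scale (c w0) (T w0) \<in> span (T ` (I - {w0}))"
      by (simp add: scale_right_diff_distrib)
    then have "c w0 = 0" by (rule independent_image_coeff_zero[OF indep inj w0I])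
    then show False using w0 by simp
  qed
  have injE: "inj_on E I"
  proof (rule inj_onI, rule ccontr)
    fix v w assume vw: "v \<in> I" "w \<in> I" "E v = E w" "v \<noteq> w"
    have "(if v = v then 1 else - 1 :: 'r) = 0"
      by (rule family[of "{v, w}" "\<lambda>x. if x = v then 1 else - 1" v]) (use vw in auto)
    then show False by simp
  qed
  have "\<not> dependent (E ` I)"
    unfolding dependent_explicit
  proof (intro notI, elim exE conjE bexE)
    fix t u v assume t: "finite t" "t \<subseteq> E ` I" "(\<Sum>x\<in>t. scale (u x) x) = 0" "v \<in> t" "u v \<noteq> 0"
    obtain F where F: "F \<subseteq> I" "t = E ` F" "inj_on E F"
      using t(2) by (auto simp: subset_image_inj)
    then have "finite F" using t(1) finite_imageD by blast
    moreover have "(\<Sum>w\<in>F. scale (u (E w)) (E w)) = 0" using t(3) F by (simp add: sum.reindex)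
    ultimately have "u (E w) = 0" if "w \<in> F" for w using family[of F "\<lambda>w. u (E w)"] F(1) that by blast
    then show False using t F by blast
  qed
  moreover have "T w \<in> span (E ` I)" if "w \<in> I" for w
    using that
  proof (induction "rank w" arbitrary: w rule: less_induct)
    case less
    have "T ` {v \<in> I. rank v < rank w} \<subseteq> span (E ` I)" using less.hyps by auto
    then have "E w - T w \<in> span (E ` I)"
      using tri[OF less.prems] span_minimal[OF _ subspace_span] by blast
    moreover have "E w \<in> span (E ` I)" using less.prems by (intro span_base) auto
    ultimately have "E w - (E w - T w) \<in> span (E ` I)" by (rule span_diff[rotated])
    then show ?case by simp
  qed
  then have "span (T ` I) \<subseteq> span (E ` I)" by (intro span_minimal subspace_span) auto
  ultimately show ?thesis using span injE by (auto simp: indexed_basis_def)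
qed

section \<open>Weights\<close>

lemma ring_inverse_eqI:
  fixes a :: "'k::ring_1"
  assumes "a * b = 1" "b * a = 1"
  shows "ring_inverse a = b"
  unfolding ring_inverse_def
proof (rule the_equality)
  fix c assume "a * c = 1 \<and> c * a = 1"
  then have "c = c * (a * b)" "c * a = 1" using assms by auto
  then show "c = b" by (simp flip: mult.assoc)
qed (use assms in simp)

definition int_exponents :: "('c \<Rightarrow>\<^sub>0 nat) \<Rightarrow> 'c \<Rightarrow>\<^sub>0 int"
  where "int_exponents m = Poly_Mapping.map int m"

lemma lookup_int_exponents: "Poly_Mapping.lookup (int_exponents m) k = int (Poly_Mapping.lookup m k)"
  by (simp add: int_exponents_def Poly_Mapping.map.rep_eq when_def)

lemma int_exponents_add: "int_exponents (m + n) = int_exponents m + int_exponents n"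
  by (rule poly_mapping_eqI) (simp add: lookup_int_exponents lookup_add)

lemma int_exponents_zero: "int_exponents 0 = 0"
  by (rule poly_mapping_eqI) (simp add: lookup_int_exponents)

lemma int_exponents_single: "int_exponents (Poly_Mapping.single i (Suc 0)) = Poly_Mapping.single i 1"
  by (rule poly_mapping_eqI) (simp add: lookup_int_exponents lookup_single when_def)

definition qmono :: "('c \<Rightarrow>\<^sub>0 int) \<Rightarrow> 'c qlaurent"
  where "qmono e = Poly_Mapping.single e 1"

lemma qmono_add: "qmono (e + e') = qmono e * qmono e'"
  by (simp add: qmono_def mult_single)

lemma qmono_zero: "qmono 0 = 1"
  by (simp add: qmono_def)

lemma qmono_minus: "qmono (- e) * qmono e = 1" "qmono e * qmono (- e) = 1"
  by (simp_all add: qmono_zero flip: qmono_add)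

lemma qpoly_incl_monomial:
  "qpoly_incl (Poly_Mapping.single m 1) = qmono (int_exponents m + int_exponents m)"
proof -
  have "Poly_Mapping.map (\<lambda>n. 2 * int n) m = int_exponents m + int_exponents m"
    by (rule poly_mapping_eqI)
      (simp add: lookup_int_exponents lookup_add Poly_Mapping.map.rep_eq when_def)
  then show ?thesis by (simp add: qpoly_incl_def qmono_def)
qed

locale hecke_ctx = based_root_datum_ctx D
  for D :: "('x::ab_group_add, 'y::ab_group_add) root_datum" +
  fixes cl :: "'x weyl_elt \<Rightarrow> 'c"
    and H :: "('x weyl_elt, 'c, 'h::ring_1) hecke"
    and K :: "('c, 'h, 'k::ring_1) scalar_ext"
  assumes weight_index: "weight_index D cl"
    and hecke: "generic_hecke D cl H"
    and ext: "hecke_sqrt_ext D H K"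
begin

text \<open>The class of the simple reflections whose roots lie in the orbit of \<open>b\<close>. It is unambiguous
  because these reflections are conjugate in the full group, and being defined by the orbit it is
  invariant.\<close>
definition root_class :: "'x \<times> int \<Rightarrow> 'c"
  where "root_class b = (SOME c. \<exists>h\<in>carrier (weyl D). \<exists>a\<in>asimples. b = aact h a \<and> c = cl (arefl a))"

lemma root_class_aact:
  assumes g: "g \<in> carrier (weyl D)" and b: "b \<in> aroots"
  shows "root_class (aact g b) = root_class b"
proof -
  have "(\<exists>h\<in>carrier (weyl D). \<exists>a\<in>asimples. aact g b = aact h a \<and> c = cl (arefl a)) \<longleftrightarrow>
    (\<exists>h\<in>carrier (weyl D). \<exists>a\<in>asimples. b = aact h a \<and> c = cl (arefl a))" for c
  proof
    assume "\<exists>h\<in>carrier (weyl D). \<exists>a\<in>asimples. aact g b = aact h a \<and> c = cl (arefl a)"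
    then obtain h a where h: "h \<in> carrier (weyl D)" "a \<in> asimples" "aact g b = aact h a"
      "c = cl (arefl a)" by blast
    have "b = aact (inv\<^bsub>weyl D\<^esub> g) (aact h a)" using W.act_inv[OF g b] h(3) by simp
    also have "\<dots> = aact (inv\<^bsub>weyl D\<^esub> g \<otimes>\<^bsub>weyl D\<^esub> h) a"
      by (rule W.act_mult[symmetric, OF W.inv_closed[OF g] h(1) W.simplesD(2)[OF h(2)]])
    finally show "\<exists>h\<in>carrier (weyl D). \<exists>a\<in>asimples. b = aact h a \<and> c = cl (arefl a)"
      using W.m_closed[OF W.inv_closed[OF g] h(1)] h by blast
  next
    assume "\<exists>h\<in>carrier (weyl D). \<exists>a\<in>asimples. b = aact h a \<and> c = cl (arefl a)"
    then obtain h a where h: "h \<in> carrier (weyl D)" "a \<in> asimples" "b = aact h a"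
      "c = cl (arefl a)" by blast
    have "aact g b = aact (g \<otimes>\<^bsub>weyl D\<^esub> h) a"
      unfolding h(3) by (rule W.act_mult[symmetric, OF g h(1) W.simplesD(2)[OF h(2)]])
    then show "\<exists>h\<in>carrier (weyl D). \<exists>a\<in>asimples. aact g b = aact h a \<and> c = cl (arefl a)"
      using W.m_closed[OF g h(1)] h by blast
  qed
  then show ?thesis by (simp add: root_class_def)
qed

lemma root_class_simple:
  assumes a: "a \<in> asimples"
  shows "root_class a = cl (arefl a)"
  unfolding root_class_def
proof (rule someI2_ex)
  have "a = aact \<one>\<^bsub>weyl D\<^esub> a" using W.act_one[OF W.simplesD(2)[OF a]] by simp
  then show "\<exists>c. \<exists>h\<in>carrier (weyl D). \<exists>a'\<in>asimples. a = aact h a' \<and> c = cl (arefl a')"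
    using a W.one_closed by blast
next
  fix c assume "\<exists>h\<in>carrier (weyl D). \<exists>a'\<in>asimples. a = aact h a' \<and> c = cl (arefl a')"
  then obtain h a' where h: "h \<in> carrier (weyl D)" "a' \<in> asimples" "a = aact h a'"
    "c = cl (arefl a')" by blast
  have "arefl a = h \<otimes>\<^bsub>weyl D\<^esub> arefl a' \<otimes>\<^bsub>weyl D\<^esub> inv\<^bsub>weyl D\<^esub> h"
    unfolding h(3) by (rule W.refl_act[OF h(1) W.simplesD(2)[OF h(2)]])
  moreover have "arefl a \<in> aff_gens D" "arefl a' \<in> aff_gens D" using a h by (auto simp: aff_gens_eq)
  ultimately have "cl (arefl a') = cl (arefl a)"
    using weight_index h(1) unfolding weight_index_def by blast
  then show "c = cl (arefl a)" using h by simp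
qed

end

sublocale hecke_ctx \<subseteq> W: weighted_root_action "weyl D" aact aroots apos aneg arefl asimples
  "\<lambda>b. Poly_Mapping.single (root_class b) (1::nat)"
  by unfold_locales (simp add: root_class_aact del: weyl_simps)

sublocale hecke_ctx \<subseteq> HM: module "hscale H"
  using hecke by (simp add: generic_hecke_def assoc_algebra_def)

sublocale hecke_ctx \<subseteq> KM: module "kscale K"
  using ext by (simp add: hecke_sqrt_ext_def assoc_algebra_def)

context hecke_ctx
begin

definition qexp :: "'x weyl_elt \<Rightarrow> 'c \<Rightarrow>\<^sub>0 int"
  where "qexp w = int_exponents (W.wt w)"

text \<open>This removes the choice of a reduced word from the monomials.\<close>
lemma sqrt_q_exponent_eq:
  assumes w: "w \<in> carrier (weyl D)"
  shows "sqrt_q_exponent D cl w = qexp w"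
proof -
  have "\<exists>ss. reduced_word D ss \<and> (\<exists>u\<in>Omega D. w = u \<otimes>\<^bsub>weyl D\<^esub> word_prod D ss)"
  proof -
    obtain u as where "u \<in> carrier (weyl D)" "W.len u = 0"
      "w = u \<otimes>\<^bsub>weyl D\<^esub> W.wprod as" "reduced_word D (map arefl as)"
      using reduced_decomposition[OF w] by blast
    then show ?thesis
      by (intro exI[of _ "map arefl as"] conjI bexI[of _ u]) (simp_all add: word_prod_arefl Omega_eq)
  qed
  then have "reduced_word D (chosen_word D w) \<and>
      (\<exists>u\<in>Omega D. w = u \<otimes>\<^bsub>weyl D\<^esub> word_prod D (chosen_word D w))"
    unfolding chosen_word_def by (rule someI_ex)
  then obtain u where u: "u \<in> carrier (weyl D)" "W.len u = 0"
    "w = u \<otimes>\<^bsub>weyl D\<^esub> word_prod D (chosen_word D w)" and red: "reduced_word D (chosen_word D w)"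
    by (auto simp: Omega_eq)
  then obtain as where as: "set as \<subseteq> asimples" "chosen_word D w = map arefl as"
    using aff_gens_words unfolding reduced_word_def by blast
  have weq: "w = u \<otimes>\<^bsub>weyl D\<^esub> W.wprod as" using u(3) as(2) word_prod_arefl by simp
  have "W.wprod as \<in> carrier (weyl D)" using as W.simples_Rts by (intro W.wprod_closed) auto
  then have "W.len w = length as"
    using red as W.len_zero_mult[OF u(1,2)] by (simp add: weq reduced_word_iff del: weyl_simps)
  then have "(\<Sum>a\<leftarrow>as. Poly_Mapping.single (root_class a) 1) = W.wt w"
    using W.wt_word(2)[OF u(1,2) as(1)] by (simp add: weq del: weyl_simps)
  moreover have "(\<Sum>s\<leftarrow>map arefl as. Poly_Mapping.single (cl s) 1) =
      int_exponents (\<Sum>a\<leftarrow>as. Poly_Mapping.single (root_class a) 1)"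
    using as(1) by (induction as)
      (simp_all add: int_exponents_zero int_exponents_add int_exponents_single root_class_simple)
  ultimately show ?thesis by (simp add: sqrt_q_exponent_def qexp_def as(2))
qed

section \<open>Normalized elements of the Hecke algebra\<close>
abbreviation "T \<equiv> Tbasis H"
abbreviation "tt \<equiv> Ttilde D cl H K"

lemma incl_simps:
  "incl K 1 = 1" "incl K (a + b) = incl K a + incl K b" "incl K (a * b) = incl K a * incl K b"
  "incl K (hscale H p a) = kscale K (qpoly_incl p) (incl K a)"
  using ext by (auto simp: hecke_sqrt_ext_def)

lemma incl_diff: "incl K (a - b) = incl K a - incl K b"
  using incl_simps(2)[of "a - b" b] by (simp add: algebra_simps)

lemma hscale_mult: "hscale H c a * b = hscale H c (a * b)" "a * hscale H c b = hscale H c (a * b)"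
  using hecke by (auto simp: generic_hecke_def assoc_algebra_def)

lemma kscale_mult: "kscale K c a * b = kscale K c (a * b)" "a * kscale K c b = kscale K c (a * b)"
  using ext by (auto simp: hecke_sqrt_ext_def assoc_algebra_def)

lemma T_mult:
  assumes "v \<in> carrier (weyl D)" "w \<in> carrier (weyl D)"
    "W.len (v \<otimes>\<^bsub>weyl D\<^esub> w) = W.len v + W.len w"
  shows "T (v \<otimes>\<^bsub>weyl D\<^esub> w) = T v * T w"
proof -
  have "weyl_length D (v \<otimes>\<^bsub>weyl D\<^esub> w) = weyl_length D v + weyl_length D w"
    using assms W.m_closed by (simp add: weyl_length_eq del: weyl_simps)
  then show ?thesis using assms hecke unfolding generic_hecke_def by blast
qed

lemma T_one: "T \<one>\<^bsub>weyl D\<^esub> = 1"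
proof -
  have basis: "HM.span (T ` carrier (weyl D)) = UNIV"
    using hecke by (auto simp: generic_hecke_def indexed_basis_def)
  have "T \<one>\<^bsub>weyl D\<^esub> * x = x" for x
  proof (rule HM.span_induct[of x "T ` carrier (weyl D)"])
    show "x \<in> HM.span (T ` carrier (weyl D))" by (simp only: basis UNIV_I)
    show "HM.subspace {x. T \<one>\<^bsub>weyl D\<^esub> * x = x}"
      by (auto simp: HM.subspace_def algebra_simps hscale_mult)
    fix y assume "y \<in> T ` carrier (weyl D)"
    then obtain w where w: "w \<in> carrier (weyl D)" "y = T w" by blast
    then show "T \<one>\<^bsub>weyl D\<^esub> * y = y"
      using T_mult[OF W.one_closed w(1)] W.l_one[OF w(1)] by (simp add: W.len_one del: weyl_simps)
  qed
  from this[of 1] show ?thesis by simp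
qed

lemma tt_eq: "w \<in> carrier (weyl D) \<Longrightarrow> tt w = kscale K (qmono (- qexp w)) (incl K (T w))"
  by (simp add: Ttilde_def inv_sqrt_q_def qmono_def sqrt_q_exponent_eq del: weyl_simps)

lemma tt_mult:
  assumes "v \<in> carrier (weyl D)" "w \<in> carrier (weyl D)"
    "W.len (v \<otimes>\<^bsub>weyl D\<^esub> w) = W.len v + W.len w"
  shows "tt (v \<otimes>\<^bsub>weyl D\<^esub> w) = tt v * tt w"
proof -
  have "- qexp (v \<otimes>\<^bsub>weyl D\<^esub> w) = - qexp v + - qexp w"
    using W.wt_mult[OF assms] by (simp add: qexp_def int_exponents_add)
  then have "qmono (- qexp (v \<otimes>\<^bsub>weyl D\<^esub> w)) = qmono (- qexp v) * qmono (- qexp w)"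
    by (simp only: qmono_add)
  then show ?thesis
    using assms T_mult[OF assms] W.m_closed
    by (simp add: tt_eq incl_simps kscale_mult ac_simps del: weyl_simps)
qed

lemma tt_one: "tt \<one>\<^bsub>weyl D\<^esub> = 1"
  using W.wt_len_zero[OF W.one_closed W.len_one] W.one_closed
  by (simp add: tt_eq T_one incl_simps qexp_def int_exponents_zero qmono_zero del: weyl_simps)

definition qroot :: "'x \<times> int \<Rightarrow> 'c \<Rightarrow>\<^sub>0 int"
  where "qroot a = Poly_Mapping.single (root_class a) 1"

text \<open>This is \<open>q\<^sub>s\<^sup>1\<^sup>/\<^sup>2 - q\<^sub>s\<^sup>-\<^sup>1\<^sup>/\<^sup>2\<close> for the reflection \<open>s\<close> in \<open>a\<close>; in the normalized generator the quadratic
  relation reads \<open>\<T>\<^sub>s\<^sup>2 = 1 + (q\<^sub>s\<^sup>1\<^sup>/\<^sup>2 - q\<^sub>s\<^sup>-\<^sup>1\<^sup>/\<^sup>2) \<T>\<^sub>s\<close>.\<close>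
definition qdiff :: "'x \<times> int \<Rightarrow> 'c qlaurent"
  where "qdiff a = qmono (qroot a) - qmono (- qroot a)"

lemma qexp_simple:
  assumes a: "a \<in> asimples"
  shows "qexp (arefl a) = qroot a"
proof -
  have "W.wt (\<one>\<^bsub>weyl D\<^esub> \<otimes>\<^bsub>weyl D\<^esub> arefl a) =
      W.wt \<one>\<^bsub>weyl D\<^esub> + Poly_Mapping.single (root_class a) 1"
    using W.simplesD[OF a] by (intro W.wt_up a W.one_closed) (simp add: W.act_one del: weyl_simps)
  then show ?thesis
    using W.wt_len_zero[OF W.one_closed W.len_one] W.l_one[OF W.refl_closed[OF W.simplesD(2)[OF a]]]
    by (simp add: qexp_def qroot_def int_exponents_single del: weyl_simps)
qed

lemma tt_simple_square:
  assumes a: "a \<in> asimples"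
  shows "tt (arefl a) * tt (arefl a) = 1 + kscale K (qdiff a) (tt (arefl a))"
proof -
  let ?t = "incl K (T (arefl a))"
  let ?v = "qmono (qroot a)" and ?v' = "qmono (- qroot a)"
  have s: "arefl a \<in> carrier (weyl D)" using W.refl_closed W.simplesD[OF a] by blast
  have "(T (arefl a) + 1) * (T (arefl a) - hscale H (qvar (cl (arefl a))) 1) = 0"
    using hecke a unfolding generic_hecke_def aff_gens_eq by blast
  then have "T (arefl a) * T (arefl a) + T (arefl a) =
      hscale H (qvar (cl (arefl a))) (T (arefl a)) + hscale H (qvar (cl (arefl a))) 1"
    by (simp add: algebra_simps hscale_mult)
  then have "incl K (T (arefl a) * T (arefl a) + T (arefl a)) =
      incl K (hscale H (qvar (cl (arefl a))) (T (arefl a)) + hscale H (qvar (cl (arefl a))) 1)"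
    by simp
  moreover have "qpoly_incl (qvar (cl (arefl a))) = ?v * ?v"
    by (simp add: qpoly_incl_qvar sqrt_qvar_def power2_eq_square qmono_def qroot_def
        root_class_simple[OF a])
  ultimately have "?t * ?t + ?t = kscale K (?v * ?v) ?t + kscale K (?v * ?v) 1"
    by (simp add: incl_simps)
  then have tt2: "?t * ?t = kscale K (?v * ?v) ?t + kscale K (?v * ?v) 1 - ?t"
    by (simp add: algebra_simps)
  have tt: "tt (arefl a) = kscale K ?v' ?t" using s a by (simp add: tt_eq qexp_simple del: weyl_simps)
  have vv: "?v' * (?v * ?v) = ?v"
    by (simp add: qmono_minus flip: mult.assoc)
  have "tt (arefl a) * tt (arefl a) = kscale K (?v' * ?v') (?t * ?t)"
    by (simp add: tt kscale_mult)
  also have "\<dots> = kscale K (?v' * (?v' * (?v * ?v))) ?t + kscale K (?v' * (?v' * (?v * ?v))) 1 -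
      kscale K (?v' * ?v') ?t"
    unfolding tt2 by (simp add: KM.scale_right_diff_distrib KM.scale_right_distrib mult.assoc)
  also have "\<dots> = 1 + kscale K (qdiff a) (tt (arefl a))"
    unfolding vv by (simp add: qmono_minus qdiff_def tt KM.scale_left_diff_distrib left_diff_distrib)
  finally show ?thesis .
qed

lemma tt_simple_inverse:
  assumes a: "a \<in> asimples"
  defines "b \<equiv> tt (arefl a) - kscale K (qdiff a) 1"
  shows "tt (arefl a) * b = 1" "b * tt (arefl a) = 1"
  using tt_simple_square[OF a] by (simp_all add: b_def right_diff_distrib left_diff_distrib kscale_mult)

lemma len_mult_len_zero:
  assumes "g \<in> carrier (weyl D)" "u \<in> carrier (weyl D)" "W.len u = 0"
  shows "W.len (g \<otimes>\<^bsub>weyl D\<^esub> u) = W.len g"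
proof -
  have "W.len (g \<otimes>\<^bsub>weyl D\<^esub> u) \<le> W.len g" using W.len_mult_le assms by fastforce
  moreover have "W.len (g \<otimes>\<^bsub>weyl D\<^esub> u \<otimes>\<^bsub>weyl D\<^esub> inv\<^bsub>weyl D\<^esub> u) \<le> W.len (g \<otimes>\<^bsub>weyl D\<^esub> u)"
    using W.len_mult_le[OF W.m_closed[OF assms(1,2)] W.inv_closed[OF assms(2)]]
      W.len_zero_inv[OF assms(2,3)] by simp
  ultimately show ?thesis using assms by (simp add: W.m_assoc del: weyl_simps)
qed

lemma tt_inverse_len_zero:
  assumes u: "u \<in> carrier (weyl D)" "W.len u = 0"
  shows "tt u * tt (inv\<^bsub>weyl D\<^esub> u) = 1" "tt (inv\<^bsub>weyl D\<^esub> u) * tt u = 1"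
proof -
  note iu = W.inv_closed[OF u(1)] W.len_zero_inv[OF u]
  show "tt u * tt (inv\<^bsub>weyl D\<^esub> u) = 1"
    using tt_mult[OF u(1) iu(1)] u iu by (simp add: W.len_one tt_one del: weyl_simps)
  show "tt (inv\<^bsub>weyl D\<^esub> u) * tt u = 1"
    using tt_mult[OF iu(1) u(1)] u iu by (simp add: W.len_one tt_one del: weyl_simps)
qed

lemma down_factor:
  assumes u: "u \<in> carrier (weyl D)" and a: "a \<in> asimples" "aact u a \<notin> apos"
  defines "u' \<equiv> u \<otimes>\<^bsub>weyl D\<^esub> arefl a"
  shows "u' \<in> carrier (weyl D)" "W.len u = Suc (W.len u')" "u' \<otimes>\<^bsub>weyl D\<^esub> arefl a = u"
    "aact u' a \<in> apos" "tt u = tt u' * tt (arefl a)"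
proof -
  have aR: "a \<in> aroots" "arefl a \<in> carrier (weyl D)"
    using a W.simplesD W.refl_closed by auto
  show u': "u' \<in> carrier (weyl D)" using u aR W.m_closed by (simp add: u'_def del: weyl_simps)
  show len: "W.len u = Suc (W.len u')" using W.len_down[OF u a] by (simp add: u'_def)
  show eq: "u' \<otimes>\<^bsub>weyl D\<^esub> arefl a = u" using W.mult_refl_refl[OF u aR(1)] by (simp add: u'_def)
  show "aact u' a \<in> apos" using W.act_mult_refl_self_pos[OF u aR(1)] a by (simp add: u'_def)
  have "\<one>\<^bsub>weyl D\<^esub> \<otimes>\<^bsub>weyl D\<^esub> arefl a = arefl a" by (rule W.l_one[OF aR(2)])
  then have "W.len (arefl a) = 1"
    using W.len_up[OF W.one_closed a(1)] W.act_one[OF aR(1)] W.simplesD[OF a(1)] W.len_one by simp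
  then show "tt u = tt u' * tt (arefl a)"
    using tt_mult[OF u' aR(2)] eq len by simp
qed

lemma tt_invertible:
  assumes "u \<in> carrier (weyl D)"
  shows "tt u * ring_inverse (tt u) = 1" "ring_inverse (tt u) * tt u = 1"
proof -
  have "\<exists>b. tt u * b = 1 \<and> b * tt u = 1"
    using assms
  proof (induction "W.len u" arbitrary: u)
    case 0
    then show ?case using tt_inverse_len_zero[of u] by (metis)
  next
    case (Suc n)
    then obtain a where a: "a \<in> asimples" "aact u a \<notin> apos"
      using W.ex_simple_down[of u] by force
    note d = down_factor[OF Suc.prems a]
    obtain b where b: "tt (u \<otimes>\<^bsub>weyl D\<^esub> arefl a) * b = 1" "b * tt (u \<otimes>\<^bsub>weyl D\<^esub> arefl a) = 1"
      using Suc.hyps(1)[OF _ d(1)] Suc.hyps(2) d(2) by auto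
    note c = tt_simple_inverse[OF a(1)]
    let ?c = "tt (arefl a) - kscale K (qdiff a) 1"
    have "tt u * (?c * b) = tt (u \<otimes>\<^bsub>weyl D\<^esub> arefl a) * (tt (arefl a) * ?c) * b"
      unfolding d(5) by (simp only: mult.assoc)
    then have "tt u * (?c * b) = 1" using b c by simp
    moreover have "?c * b * tt u = ?c * (b * tt (u \<otimes>\<^bsub>weyl D\<^esub> arefl a)) * tt (arefl a)"
      unfolding d(5) by (simp only: mult.assoc)
    then have "?c * b * tt u = 1" using b c by simp
    ultimately show ?case by blast
  qed
  then obtain b where "tt u * b = 1" "b * tt u = 1" by blast
  then show "tt u * ring_inverse (tt u) = 1" "ring_inverse (tt u) * tt u = 1"
    using ring_inverse_eqI[of "tt u" b] by auto
qed

lemma ring_inverse_down: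
  assumes u: "u \<in> carrier (weyl D)" and a: "a \<in> asimples" "aact u a \<notin> apos"
  shows "ring_inverse (tt u) =
    (tt (arefl a) - kscale K (qdiff a) 1) * ring_inverse (tt (u \<otimes>\<^bsub>weyl D\<^esub> arefl a))"
proof (rule ring_inverse_eqI)
  note d = down_factor[OF u a]
  note c = tt_simple_inverse[OF a(1)]
  note b = tt_invertible[OF d(1)]
  let ?c = "tt (arefl a) - kscale K (qdiff a) 1" and ?b = "ring_inverse (tt (u \<otimes>\<^bsub>weyl D\<^esub> arefl a))"
  have "tt u * (?c * ?b) = tt (u \<otimes>\<^bsub>weyl D\<^esub> arefl a) * (tt (arefl a) * ?c) * ?b"
    unfolding d(5) by (simp only: mult.assoc)
  then show "tt u * (?c * ?b) = 1" using b c by simp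
  have "?c * ?b * tt u = ?c * (?b * tt (u \<otimes>\<^bsub>weyl D\<^esub> arefl a)) * tt (arefl a)"
    unfolding d(5) by (simp only: mult.assoc)
  then show "?c * ?b * tt u = 1" using b c by simp
qed

section \<open>Triangularity\<close>
definition lower :: "'x weyl_elt \<Rightarrow> 'h set"
  where "lower w = HM.span (T ` {w'. W.below w' w})"

lemma lower_below:
  assumes "W.below w' w" "h - T w' \<in> lower w'"
  shows "h \<in> lower w"
proof -
  have "T ` {v. W.below v w'} \<subseteq> T ` {v. W.below v w}" using assms W.below_trans by blast
  then have "h - T w' \<in> lower w" using assms(2) HM.span_mono unfolding lower_def by blast
  moreover have "T w' \<in> lower w" using assms(1) unfolding lower_def by (intro HM.span_base) auto
  ultimately have "(h - T w') + T w' \<in> lower w" unfolding lower_def by (rule HM.span_add)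
  then show ?thesis by simp
qed

text \<open>The induction described at the beginning, on the length of \<open>u\<close>. For arbitrary \<open>v\<close> and \<open>u\<close> the
  induction closes up: both pairs \<open>(vs, u')\<close> and \<open>(v, u')\<close> are of the same kind. The second
  pair enters with coefficient \<open>- p (q\<^sub>s - 1)\<close>, where \<open>p\<close> is the monomial with exponent \<open>m\<close> from \<open>wt_step\<close>.\<close>
lemma normalized_quotient:
  assumes "v \<in> carrier (weyl D)" "u \<in> carrier (weyl D)"
  defines "w \<equiv> v \<otimes>\<^bsub>weyl D\<^esub> inv\<^bsub>weyl D\<^esub> u"
  shows "\<exists>h. incl K h = kscale K (qmono (qexp w)) (tt v * ring_inverse (tt u)) \<and> h - T w \<in> lower w"
  using assms(1,2) unfolding w_def
proof (induction "W.len u" arbitrary: u v)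
  case 0
  let ?w = "v \<otimes>\<^bsub>weyl D\<^esub> inv\<^bsub>weyl D\<^esub> u"
  have iu: "inv\<^bsub>weyl D\<^esub> u \<in> carrier (weyl D)" "W.len (inv\<^bsub>weyl D\<^esub> u) = 0"
    using 0 W.inv_closed W.len_zero_inv by auto
  have u0: "W.len u = 0" using 0 by simp
  have w: "?w \<in> carrier (weyl D)" using 0 iu W.m_closed by blast
  have "tt v * ring_inverse (tt u) = tt ?w"
    using tt_mult[OF 0(2) iu(1)] len_mult_len_zero[OF 0(2) iu] iu
      ring_inverse_eqI[OF tt_inverse_len_zero[OF 0(3) u0]] by simp
  then have "kscale K (qmono (qexp ?w)) (tt v * ring_inverse (tt u)) = incl K (T ?w)"
    using w by (simp add: tt_eq qmono_minus del: weyl_simps)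
  then show ?case
    by (intro exI[of _ "T ?w"]) (simp add: lower_def HM.span_zero)
next
  case (Suc n)
  note v = Suc.prems(1) and u = Suc.prems(2)
  obtain a where a: "a \<in> asimples" "aact u a \<notin> apos"
    using W.ex_simple_down[OF u] Suc.hyps(2) by force
  let ?s = "arefl a"
  define u' where "u' = u \<otimes>\<^bsub>weyl D\<^esub> ?s"
  define w where "w = v \<otimes>\<^bsub>weyl D\<^esub> inv\<^bsub>weyl D\<^esub> u"
  have aR: "a \<in> aroots" and s: "?s \<in> carrier (weyl D)"
    using a W.simplesD W.refl_closed by auto
  note d = down_factor[OF u a, folded u'_def]
  have vs: "v \<otimes>\<^bsub>weyl D\<^esub> ?s \<in> carrier (weyl D)" using v s W.m_closed by blast
  have iu': "inv\<^bsub>weyl D\<^esub> u' \<in> carrier (weyl D)" using d(1) W.inv_closed by blast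
  have invs: "inv\<^bsub>weyl D\<^esub> ?s = ?s" using W.inv_equality[OF W.refl_refl[OF aR] s s] .
  have iu: "inv\<^bsub>weyl D\<^esub> u = ?s \<otimes>\<^bsub>weyl D\<^esub> inv\<^bsub>weyl D\<^esub> u'"
    using W.inv_mult_group[OF d(1) s] d(3) invs by simp
  have w1: "v \<otimes>\<^bsub>weyl D\<^esub> ?s \<otimes>\<^bsub>weyl D\<^esub> inv\<^bsub>weyl D\<^esub> u' = w"
    using W.m_assoc[OF v s iu'] iu by (simp add: w_def)
  have wc: "w \<in> carrier (weyl D)" using v u W.m_closed W.inv_closed by (simp add: w_def del: weyl_simps)
  have n: "n = W.len u'" using d(2) Suc.hyps(2) by simp
  obtain h1 where h1: "incl K h1 =
      kscale K (qmono (qexp w)) (tt (v \<otimes>\<^bsub>weyl D\<^esub> ?s) * ring_inverse (tt u'))" "h1 - T w \<in> lower w"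
    using Suc.hyps(1)[OF n vs d(1)] unfolding w1 by blast
  note inv = ring_inverse_down[OF u a, folded u'_def]
  show ?case unfolding w_def[symmetric]
  proof (cases "aact v a \<in> apos")
    case False
    \<comment> \<open>Both \<open>v\<close> and \<open>u\<close> end in \<open>s\<close>, and the two normalized factors cancel.\<close>
    note dv = down_factor[OF v a(1) False]
    have "tt v * ring_inverse (tt u) =
        tt (v \<otimes>\<^bsub>weyl D\<^esub> ?s) * (tt ?s * (tt ?s - kscale K (qdiff a) 1)) * ring_inverse (tt u')"
      unfolding inv dv(5) by (simp only: mult.assoc)
    then have "tt v * ring_inverse (tt u) = tt (v \<otimes>\<^bsub>weyl D\<^esub> ?s) * ring_inverse (tt u')"
      using tt_simple_inverse[OF a(1)] by simp
    then show "\<exists>h. incl K h = kscale K (qmono (qexp w)) (tt v * ring_inverse (tt u)) \<and> h - T w \<in> lower w"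
      using h1 by (intro exI[of _ h1]) simp
  next
    case True
    define w' where "w' = v \<otimes>\<^bsub>weyl D\<^esub> inv\<^bsub>weyl D\<^esub> u'"
    obtain h2 where h2: "incl K h2 =
        kscale K (qmono (qexp w')) (tt v * ring_inverse (tt u'))" "h2 - T w' \<in> lower w'"
      using Suc.hyps(1)[OF n v d(1)] unfolding w'_def by blast
    \<comment> \<open>The reflection in \<open>b\<close> is \<open>u' s u'\<^sup>-\<^sup>1\<close>. As \<open>u' < u\<close>, \<open>b\<close> is positive; as \<open>v < vs\<close>, \<open>w\<close> makes it negative.\<close>
    define b where "b = aact u' a"
    have b: "b \<in> apos" "b \<in> aroots" using d(4) W.posD by (auto simp: b_def)
    have "aact w b = aact (v \<otimes>\<^bsub>weyl D\<^esub> ?s) (aact (inv\<^bsub>weyl D\<^esub> u') b)"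
      unfolding w1[symmetric] by (rule W.act_mult[OF vs iu' b(2)])
    also have "aact (inv\<^bsub>weyl D\<^esub> u') b = a" unfolding b_def by (rule W.act_inv[OF d(1) aR])
    finally have wb: "aact w b \<notin> apos" using W.act_mult_refl_self_pos[OF v aR] True by simp
    have "w \<otimes>\<^bsub>weyl D\<^esub> arefl b =
        v \<otimes>\<^bsub>weyl D\<^esub> ?s \<otimes>\<^bsub>weyl D\<^esub> inv\<^bsub>weyl D\<^esub> u' \<otimes>\<^bsub>weyl D\<^esub> (u' \<otimes>\<^bsub>weyl D\<^esub> ?s \<otimes>\<^bsub>weyl D\<^esub> inv\<^bsub>weyl D\<^esub> u')"
      unfolding b_def W.refl_act[OF d(1) aR] w1 ..
    also have "\<dots> = v \<otimes>\<^bsub>weyl D\<^esub> ?s \<otimes>\<^bsub>weyl D\<^esub> (inv\<^bsub>weyl D\<^esub> u' \<otimes>\<^bsub>weyl D\<^esub> u') \<otimes>\<^bsub>weyl D\<^esub> ?s \<otimes>\<^bsub>weyl D\<^esub> inv\<^bsub>weyl D\<^esub> u'"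
      using v s d(1) iu' by (simp only: W.m_assoc W.m_closed)
    also have "\<dots> = w'"
      unfolding W.l_inv[OF d(1)] W.r_one[OF vs] W.mult_refl_refl[OF v aR] w'_def ..
    finally have w': "w \<otimes>\<^bsub>weyl D\<^esub> arefl b = w'" .
    have below: "W.below w' w" using W.below_step[OF wc b(1) wb] w' by simp
    obtain m where m: "W.wt w = W.wt w' + Poly_Mapping.single (root_class b) 1 + m + m"
      using W.wt_step[OF wc b(1) wb] w' by auto
    have "root_class b = root_class a" unfolding b_def by (rule root_class_aact[OF d(1) aR])
    then have qw: "qexp w = (int_exponents m + int_exponents m) + qroot a + qexp w'"
      using m by (simp add: qexp_def qroot_def int_exponents_add int_exponents_single ac_simps)
    let ?p = "Poly_Mapping.single m 1 :: 'c qpoly" and ?q = "qvar (root_class a)"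
    define h where "h = h1 - hscale H ?p (hscale H ?q h2 - h2)"
    have coeff: "qmono (qexp w) * qdiff a =
        qpoly_incl ?p * (qpoly_incl ?q - 1) * qmono (qexp w')"
    proof -
      have "qpoly_incl ?q = qmono (qroot a) * qmono (qroot a)"
        by (simp add: qpoly_incl_qvar sqrt_qvar_def power2_eq_square qmono_def qroot_def)
      moreover have "qmono (qroot a) * qdiff a = qmono (qroot a) * qmono (qroot a) - 1"
        by (simp add: qdiff_def right_diff_distrib qmono_minus)
      moreover have "qmono (qexp w) * qdiff a =
          qpoly_incl ?p * (qmono (qroot a) * qdiff a) * qmono (qexp w')"
        unfolding qw qmono_add qpoly_incl_monomial by (simp only: ac_simps)
      ultimately show ?thesis by simp
    qed
    have "tt v * ring_inverse (tt u) = tt v * tt ?s * ring_inverse (tt u') -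
        kscale K (qdiff a) (tt v * ring_inverse (tt u'))"
      unfolding inv by (simp add: algebra_simps kscale_mult)
    also have "tt v * tt ?s = tt (v \<otimes>\<^bsub>weyl D\<^esub> ?s)"
    proof -
      have neg: "aact (v \<otimes>\<^bsub>weyl D\<^esub> ?s) a \<notin> apos" using W.act_mult_refl_self_pos[OF v aR] True by simp
      show ?thesis
        using down_factor(5)[OF vs a(1) neg] W.mult_refl_refl[OF v aR] by simp
    qed
    finally have "kscale K (qmono (qexp w)) (tt v * ring_inverse (tt u)) = incl K h1 -
        kscale K (qmono (qexp w) * qdiff a) (tt v * ring_inverse (tt u'))"
      by (simp add: KM.scale_right_diff_distrib h1(1))
    also have "\<dots> = incl K h1 - kscale K (qpoly_incl ?p * (qpoly_incl ?q - 1)) (incl K h2)"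
      unfolding coeff by (simp add: h2(1))
    also have "\<dots> = incl K h"
      by (simp add: h_def incl_diff incl_simps KM.scale_left_diff_distrib right_diff_distrib
          KM.scale_right_diff_distrib)
    finally have "incl K h = kscale K (qmono (qexp w)) (tt v * ring_inverse (tt u))" by simp
    moreover have "h2 \<in> lower w" by (rule lower_below[OF below h2(2)])
    then have "(h1 - T w) - hscale H ?p (hscale H ?q h2 - h2) \<in> lower w"
      using h1(2) unfolding lower_def
      by (intro HM.span_diff[OF _ HM.span_scale[OF HM.span_diff[OF HM.span_scale]]])
    then have "h - T w \<in> lower w" by (simp add: h_def algebra_simps)
    ultimately show "\<exists>h. incl K h = kscale K (qmono (qexp w)) (tt v * ring_inverse (tt u)) \<and>
        h - T w \<in> lower w" by blast
  qed
qed

text \<open>For \<open>y\<close> dominant all pairings with positive coroots are nonnegative, so the absolute values in the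
  length formula split.\<close>
lemma len_mult_dominant:
  assumes w: "w \<in> fin_weyl D" and y: "dominant D y"
  shows "W.len (w, y) = W.len (w, 0) + W.len (id, y)"
proof -
  let ?n = "\<lambda>\<gamma>. if w \<gamma> \<in> Rpos then \<bar>pr 0 (cor \<gamma>)\<bar> else \<bar>1 + pr 0 (cor \<gamma>)\<bar>"
  let ?N = "\<lambda>\<gamma>. if id \<gamma> \<in> Rpos then \<bar>pr y (cor \<gamma>)\<bar> else \<bar>1 + pr y (cor \<gamma>)\<bar>"
  have "(\<Sum>\<gamma>\<in>Rpos. if w \<gamma> \<in> Rpos then \<bar>pr y (cor \<gamma>)\<bar> else \<bar>1 + pr y (cor \<gamma>)\<bar>) =
    (\<Sum>\<gamma>\<in>Rpos. ?n \<gamma> + ?N \<gamma>)"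
    using dominant_pr_nonneg[OF y] by (intro sum.cong) (auto simp: pr_zero_left)
  also have "\<dots> = (\<Sum>\<gamma>\<in>Rpos. ?n \<gamma>) + (\<Sum>\<gamma>\<in>Rpos. ?N \<gamma>)" by (rule sum.distrib)
  finally have "weyl_length D (w, y) = weyl_length D (w, 0) + weyl_length D (id, y)"
    unfolding weyl_length_sum[OF w] weyl_length_sum[OF id_fin_weyl]
    by (simp only:) (intro nat_add_distrib sum_nonneg; simp)
  then show ?thesis
    using w id_fin_weyl weyl_length_eq[of "(w, y)"] weyl_length_eq[of "(w, 0)"] weyl_length_eq[of "(id, y)"]
    by simp
qed

lemma Eelt_integral:
  assumes g: "g \<in> carrier (weyl D)"
  shows "\<exists>h. incl K h = Eelt D cl H K g \<and> h - T g \<in> lower g"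
proof -
  obtain w x where wx: "g = (w, x)" "w \<in> fin_weyl D" using g by auto
  obtain y z where yz: "(SOME (y, z). dominant D y \<and> dominant D z \<and> x = y - z) = (y, z)"
    by (cases "SOME (y, z). dominant D y \<and> dominant D z \<and> x = y - z")
  have "\<exists>p. case p of (y, z) \<Rightarrow> dominant D y \<and> dominant D z \<and> x = y - z"
    using ex_dominant_diff[of x] by auto
  then have "case (SOME (y, z). dominant D y \<and> dominant D z \<and> x = y - z) of
      (y, z) \<Rightarrow> dominant D y \<and> dominant D z \<and> x = y - z"
    by (rule someI_ex)
  then have dom: "dominant D y" "x = y - z" by (simp_all add: yz)
  have c: "(w, y) \<in> carrier (weyl D)" "(w, 0) \<in> carrier (weyl D)" "(id, y) \<in> carrier (weyl D)"
    "(id, z) \<in> carrier (weyl D)" using wx id_fin_weyl by auto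
  have "(w, 0) \<otimes>\<^bsub>weyl D\<^esub> (id, y) = (w, y)" by simp
  then have "tt (w, 0) * tt (id, y) = tt (w, y)"
    using tt_mult[OF c(2,3)] len_mult_dominant[OF wx(2) dom(1)] by simp
  then have "Eelt D cl H K g = kscale K (qmono (qexp g)) (tt (w, y) * ring_inverse (tt (id, z)))"
    using sqrt_q_exponent_eq[OF g]
    by (simp add: wx thetatilde_def yz sqrt_q_def qmono_def flip: mult.assoc)
  moreover have "(w, y) \<otimes>\<^bsub>weyl D\<^esub> inv\<^bsub>weyl D\<^esub> (id, z) = g"
  proof -
    have "g \<otimes>\<^bsub>weyl D\<^esub> (id, z) = (w, y)" using wx dom by simp
    then show ?thesis using W.inv_solve_right'[OF g c(1,4)] by simp
  qed
  ultimately show ?thesis using normalized_quotient[OF c(1,4)] by simp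
qed

end

theorem mainTheorem1:
  fixes D :: "('x::ab_group_add, 'y::ab_group_add) root_datum"
    and cl :: "'x weyl_elt \<Rightarrow> 'c"
    and H :: "('x weyl_elt, 'c, 'h::ring_1) hecke"
    and K :: "('c, 'h, 'k::ring_1) scalar_ext"
  assumes "based_root_datum D"
    and "weight_index D cl"
    and "generic_hecke D cl H"
    and "hecke_sqrt_ext D H K"
  shows "\<exists>E :: 'x weyl_elt \<Rightarrow> 'h.
    (\<forall>w \<in> carrier (weyl D). incl K (E w) = Eelt D cl H K w) \<and>
    indexed_basis (hscale H) (carrier (weyl D)) E \<and>
    (\<forall>w \<in> carrier (weyl D). \<exists>F a. finite F \<and> F \<subseteq> {w'. bruhat_less D w' w} \<and>
       E w = Tbasis H w + (\<Sum>w'\<in>F. hscale H (a w') (Tbasis H w')))"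
proof -
  interpret hecke_ctx D cl H K
    using assms by unfold_locales
  obtain E where E: "\<And>w. w \<in> carrier (weyl D) \<Longrightarrow> incl K (E w) = Eelt D cl H K w"
    and tri: "\<And>w. w \<in> carrier (weyl D) \<Longrightarrow> E w - T w \<in> lower w"
    using bchoice[of "carrier (weyl D)" "\<lambda>w h. incl K h = Eelt D cl H K w \<and> h - T w \<in> lower w"]
      Eelt_integral by blast
  have "indexed_basis (hscale H) (carrier (weyl D)) E"
  proof (rule triangular_indexed_basis[where T = T and rank = W.len])
    show "module (hscale H)" by (rule HM.module_axioms)
    show "indexed_basis (hscale H) (carrier (weyl D)) T" using hecke by (simp add: generic_hecke_def)
    fix w assume w: "w \<in> carrier (weyl D)"
    have "T ` {w'. W.below w' w} \<subseteq> T ` {v \<in> carrier (weyl D). W.len v < W.len w}"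
      using W.below_carrier(2) W.below_len by blast
    then show "E w - T w \<in> HM.span (T ` {v \<in> carrier (weyl D). W.len v < W.len w})"
      using tri[OF w] HM.span_mono unfolding lower_def by blast
  qed
  moreover have "\<exists>F a. finite F \<and> F \<subseteq> {w'. bruhat_less D w' w} \<and>
       E w = T w + (\<Sum>w'\<in>F. hscale H (a w') (T w'))" if w: "w \<in> carrier (weyl D)" for w
  proof -
    from HM.span_image_sum[OF tri[OF w, unfolded lower_def]] obtain F a
      where "finite F" "F \<subseteq> {w'. W.below w' w}" "E w - T w = (\<Sum>v\<in>F. hscale H (a v) (T v))"
      by auto
    moreover from this have "F \<subseteq> {w'. bruhat_less D w' w}" using below_imp_bruhat_less by blast
    ultimately show ?thesis by (intro exI[of _ F] exI[of _ a]) (simp add: diff_eq_eq add.commute)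
  qed
  ultimately show ?thesis using E by blast
qed

end
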